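(* Let $\Xi(s)=\xi\left(\tfrac12+is\right)$ be the Riemann Xi function, and for $k\in\mathbb N_0$ let $$m_k=-\frac{1}{2\,(2k+3)!}\left(\frac{\Xi'(s)}{\Xi(s)}\right)^{(2k+3)}\bigg|_{s=0}.$$ Let $\{a_n\}_{n\ge0}$ be the coefficients in $\xi\left(\tfrac12+s\right)=\sum_{n=0}^\infty a_ns^{2n}$, i.e. $$a_n=\frac{2}{(2n)!}\int_0^\infty\Phi(u)u^{2n}\,du>0 .$$ Then: (i) For every $n\in\mathbb N_0$, $m_n$ is $(-1)^n$ times the determinant of the $(n+1)\times(n+1)$ matrix obtained from the lower triangular Toeplitz matrix $(a_{i-j}/a_0)_{0\le i,j\le n}$ (with $a_r=0$ for $r<0$) by replacing its last column by the column with entries $\frac{a_1a_{i+1}}{a_0^2}-\frac{(i+2)a_{i+2}}{a_0}$, $0\le i\le n$; that is, $$m_n=(-1)^n\det\begin{pmatrix}1&0&0&\dots&\frac{a_1^2}{a_0^2}-\frac{2a_2}{a_0}\\ \frac{a_1}{a_0}&1&0&\dots&\frac{a_1a_2}{a_0^2}-\frac{3a_3}{a_0}\\ \frac{a_2}{a_0}&\frac{a_1}{a_0}&1&\dots&\frac{a_1a_3}{a_0^2}-\frac{4a_4}{a_0}\\ \vdots&\vdots&\vdots&\ddots&\vdots\\ \frac{a_n}{a_0}&\frac{a_{n-1}}{a_0}&\frac{a_{n-2}}{a_0}&\dots&\frac{a_1a_{n+1}}{a_0^2}-\frac{(n+2)a_{n+2}}{a_0}\end{pmatrix}.$$ (ii)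 For every $n\in\mathbb N_0$, $$(-1)^nm_n=\frac{a_1a_{n+1}}{a_0^2}-\frac{(n+2)a_{n+2}}{a_0}-\sum_{k=0}^{n-1}\frac{(-1)^km_ka_{n-k}}{a_0}.$$ (iii) The Riemann hypothesis holds if and only if there exists a positive number $L>s_1^{-2}$ such that $$\sum_{j=0}^k(-1)^j\binom kj\frac{m_{n+j}}{L^{n+j}}\ge0\qquad\forall n,k\in\mathbb N_0,$$ where $s_1\approx14.1347$ is the zero of $\Xi(s)$ with smallest positive real part.
   Context: $\mathbb N_0=\{0,1,2,\dots\}$. The Riemann $\xi$-function is $\xi(s)=\pi^{-s/2}(s-1)\Gamma\left(1+\frac s2\right)\zeta(s)$, an entire function of order $1$ satisfying $\xi(s)=\xi(1-s)$, where $\zeta$ is the Riemann zeta function. Thus $\Xi(s)=\xi(\frac12+is)$ is an even entire function of order $1$, whose zeros all satisfy $|\Im s|<\frac12$. The Riemann hypothesis is the assertion that all zeros of $\Xi$ are real. One has $\Xi(s)=2\int_0^\infty\Phi(u)\cos(us)\,du$ with $$\Phi(u)=\Phi(-u)=\sum_{n=1}^\infty\left(4n^4\pi^2e^{9u/2}-6n^2\pi e^{5u/2}\right)e^{-n^2\pi e^{2u}}>0 .$$ *)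

theory Defs
  imports
    "HOL-Complex_Analysis.Complex_Analysis"
    "Jordan_Normal_Form.Determinant"
begin

(* The analytic continuation of the Dirichlet series to the plane punctured at the pole 1.
   The clause f 1 = 0 only pins down the irrelevant value at the pole, so that the
   description is unique. *)
definition riemann_zeta :: "complex \<Rightarrow> complex" where
  "riemann_zeta = (THE f. f holomorphic_on (- {1}) \<and> f 1 = 0 \<and>
     (\<forall>s. Re s > 1 \<longrightarrow> (\<lambda>n. 1 / (of_nat (Suc n) powr s)) sums f s))"

(* At s = 1 and s = -2, -4, ... the literal product takes junk values, since the factors
   zeta and Gamma have poles there; remove_sings replaces them by the limits, so that
   riemann_xi is the entire function meant by the formula. *)
definition riemann_xi :: "complex \<Rightarrow> complex" where
  "riemann_xi = remove_sings (\<lambda>s.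
     of_real pi powr (- s / 2) * (s - 1) * Gamma (1 + s / 2) * riemann_zeta s)"

definition Xi :: "complex \<Rightarrow> complex" where
  "Xi s = riemann_xi (1 / 2 + \<i> * s)"

definition riemann_hypothesis :: bool where
  "riemann_hypothesis \<longleftrightarrow> (\<forall>s. Xi s = 0 \<longrightarrow> s \<in> \<real>)"

definition xi_Phi :: "real \<Rightarrow> real" where
  "xi_Phi u = (\<Sum>k. let n = real (Suc k) in
     (4 * n ^ 4 * pi\<^sup>2 * exp (9 * u / 2) - 6 * n\<^sup>2 * pi * exp (5 * u / 2))
       * exp (- (n\<^sup>2 * pi * exp (2 * u))))"

definition xi_coeff :: "nat \<Rightarrow> real" where
  "xi_coeff n = 2 / fact (2 * n) * (LBINT u:{0..}. xi_Phi u * u ^ (2 * n))"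

definition xi_moment :: "nat \<Rightarrow> complex" where
  "xi_moment k = - 1 / (2 * fact (2 * k + 3)) *
     (deriv ^^ (2 * k + 3)) (\<lambda>s. deriv Xi s / Xi s) 0"

definition xi_matrix :: "nat \<Rightarrow> real mat" where
  "xi_matrix n = mat (n + 1) (n + 1) (\<lambda>(i, j).
     if j = n then
       xi_coeff 1 * xi_coeff (i + 1) / (xi_coeff 0)\<^sup>2
         - real (i + 2) * xi_coeff (i + 2) / xi_coeff 0
     else if j \<le> i then xi_coeff (i - j) / xi_coeff 0
     else 0)"

(* This zero (14.1347...) is in fact real; where an order comparison needs a real number,
   its inverse square is written 1 / (Re xi_first_zero)^2. *)
definition xi_first_zero :: complex where
  "xi_first_zero = arg_min Re (\<lambda>s. Xi s = 0 \<and> Re s > 0)"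

end

theory Submission
  imports Defs "HOL-Real_Asymp.Real_Asymp"
begin

text \<open>
  Evenness of \<open>xi_Phi\<close> is the transformation law of the theta function, obtained here by Polya's
  argument: both sides of the law are limits of the two sides of a finite identity for
  binomial coefficients in an arithmetic progression. Hence the Dirichlet series of zeta, multiplied by
  the Gamma factor, is \<open>F ((s - 1/2)^2)\<close> for the entire function \<open>F(w) = \<Sum>n. a_n w^n\<close>, which also
  provides the analytic continuation of zeta, and \<open>\<Xi>(s) = F(-s^2)\<close>.

  The numbers \<open>m_k\<close> are, up to sign, the Taylor coefficients \<open>h_{k+1}\<close> of \<open>F'/F\<close>. Comparing
  coefficients in \<open>F' = F \<cdot> (F'/F)\<close> is the recursion (ii), and (i) is Cramer's rule for it.

  Under the Riemann hypothesis all zeros of \<open>F\<close> are negative reals \<open>-1/x\<close>. Dividing \<open>F\<close> by the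
  factors of its zeros in a disc of radius \<open>R\<close> and applying Borel-Caratheodory to the logarithm of the
  quotient shows that \<open>m_k\<close> is the limit of finite sums \<open>\<Sum> x^{k+2}\<close> (the growth of \<open>F\<close> is read off
  from its values at \<open>(2m - 1/2)^2\<close>), and such sums have the required differences.
  Conversely, complete monotonicity makes \<open>\<Sum>n. (-1)^n m_n z^n\<close> a limit of
  positive combinations of functions \<open>1/(1 + x z)\<close>, so it continues
  to the plane slit along \<open>(-\<infinity>, -1/L]\<close> by Montel's theorem; hence \<open>F' = q F\<close> with
  \<open>q\<close> holomorphic there, and \<open>F\<close> has no zeros off the slit.
\<close>

section \<open>The theta transformation\<close>

text \<open>Both directions of (iii) approximate an infinite object by finite ones. The product of
  \<open>xi_series\<close> over its zeros is cut off at a disc: on the circles used, log |F| is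
  O(sqrt r log r) with r the radius, so the logarithm of the zero-free rest contributes only
  O(r^(-n-1/2) log r) to the n-th coefficient of F'/F, which vanishes in the limit. Hausdorff's
  representing measure is approximated by Bernstein weights at the nodes j/N, and the limit is taken
  among their Stieltjes transforms, where compactness is available.

  The variable w = (s - 1/2)^2 has two effects. Real zeros of \<open>Xi\<close> lie on the negative
  w-axis, exactly where a Stieltjes transform of a positive measure may be singular. And since all
  coefficients are positive, the maximum modulus on a circle is the value at its positive point,
  which the Dirichlet series computes when that point is (x - 1/2)^2 with x > 1. The integrals are
  therefore evaluated for real parameters, and the identity theorem carries the result to complex
  ones.\<close>

lemma sum_cis_roots_of_unity:
  fixes d :: int
  assumes "l > 0"
  shows "(\<Sum>k<l. cis (2 * pi * real k * real_of_int d / real l)) = (if int l dvd d then of_nat l else 0)"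
proof -
  define w where "w = cis (2 * pi * real_of_int d / real l)"
  have pow: "cis (2 * pi * real k * real_of_int d / real l) = w ^ k" for k
    unfolding w_def by (subst Complex.DeMoivre, rule arg_cong[where f = cis]) simp
  have wl: "w ^ l = 1"
    using assms unfolding w_def Complex.DeMoivre by (simp add: cis_multiple_2pi)
  have w1: "w = 1 \<longleftrightarrow> int l dvd d"
  proof
    assume "w = 1"
    then have "cos (2 * pi * real_of_int d / real l) = 1" by (auto simp: w_def complex_eq_iff)
    then obtain n :: int where "2 * pi * real_of_int d / real l = real_of_int n * 2 * pi"
      by (auto simp: cos_one_2pi_int)
    then have "real_of_int d = real_of_int (n * int l)" using assms by (simp add: field_simps)
    then show "int l dvd d" using of_int_eq_iff by (metis dvd_triv_right)
  next
    assume "int l dvd d"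
    then obtain n where "d = int l * n" by auto
    then show "w = 1"
      using assms cis_multiple_2pi[of "real_of_int n"] unfolding w_def by (simp add: mult.assoc)
  qed
  show ?thesis
  proof (cases "w = 1")
    case False
    then show ?thesis using w1 geometric_sum[of w l] wl by (simp add: pow)
  qed (use w1 in \<open>simp add: pow\<close>)
qed

text \<open>Expand 2 cos t = e^(it) + e^(-it) binomially at t = pi k / l. The j-th term has argument
  2 t (j - m), so summing over k runs through l-th roots of unity and filters out the j with
  \<open>int l dvd int j - int m\<close>.\<close>

lemma polya_cos_power_sum:
  assumes "l > 0"
  shows "(\<Sum>k<l. (2 * cos (pi * real k / real l)) ^ (2 * m))
         = real l * (\<Sum>j | j \<le> 2 * m \<and> int l dvd int j - int m. real (2 * m choose j))"
proof -
  have eq: "complex_of_real ((2 * cos t) ^ (2 * m))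
        = (\<Sum>j\<le>2*m. of_nat (2 * m choose j) * cis (2 * t * real_of_int (int j - int m)))" for t
  proof -
    have "complex_of_real (2 * cos t) = cis t + cis (- t)" by (auto simp: complex_eq_iff)
    then have "complex_of_real ((2 * cos t) ^ (2 * m)) = (cis t + cis (- t)) ^ (2 * m)"
      by (metis of_real_power)
    also have "\<dots> = (\<Sum>j\<le>2*m. of_nat (2 * m choose j) * cis t ^ j * cis (- t) ^ (2 * m - j))"
      by (rule binomial_ring)
    also have "\<dots> = (\<Sum>j\<le>2*m. of_nat (2 * m choose j) * cis (2 * t * real_of_int (int j - int m)))"
    proof (intro sum.cong refl)
      fix j assume "j \<in> {..2*m}"
      then have "cis t ^ j * cis (- t) ^ (2 * m - j) = cis (2 * t * real_of_int (int j - int m))"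
        by (subst (1 2) Complex.DeMoivre, subst cis_mult, intro arg_cong[where f = cis])
           (auto simp: algebra_simps)
      then show "of_nat (2 * m choose j) * cis t ^ j * cis (- t) ^ (2 * m - j)
          = of_nat (2 * m choose j) * cis (2 * t * real_of_int (int j - int m))"
        by (simp only: mult.assoc)
    qed
    finally show ?thesis .
  qed
  have "complex_of_real (\<Sum>k<l. (2 * cos (pi * real k / real l)) ^ (2 * m))
      = (\<Sum>k<l. \<Sum>j\<le>2*m. of_nat (2 * m choose j) *
          cis (2 * pi * real k * real_of_int (int j - int m) / real l))"
    unfolding of_real_sum eq by (simp add: mult_ac)
  also have "\<dots> = (\<Sum>j\<le>2*m. of_nat (2 * m choose j) *
          (\<Sum>k<l. cis (2 * pi * real k * real_of_int (int j - int m) / real l)))"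
    by (subst sum.swap) (simp add: sum_distrib_left)
  also have "\<dots> = (\<Sum>j\<le>2*m. if int l dvd int j - int m then of_nat (2 * m choose j) * of_nat l else 0)"
    unfolding sum_cis_roots_of_unity[OF assms] by (intro sum.cong) auto
  also have "\<dots> = (\<Sum>j | j \<le> 2 * m \<and> int l dvd int j - int m. of_nat (2 * m choose j) * of_nat l)"
    by (subst sum.inter_filter[symmetric]) auto
  also have "\<dots> = complex_of_real (real l * (\<Sum>j | j \<le> 2 * m \<and> int l dvd int j - int m. real (2 * m choose j)))"
    by (simp add: sum_distrib_left mult.commute)
  finally show ?thesis unfolding of_real_eq_iff .
qed

text \<open>The admissible j are m + l v for integers v, and the reflection j -> 2 m - j pairs v
  with -v. Stopping at v = m loses nothing, because binomial coefficients with m + l v > 2 m are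
  0.\<close>

lemma sum_binomial_multiples:
  assumes "l > 0"
  shows "(\<Sum>j | j \<le> 2 * m \<and> int l dvd int j - int m. real (2 * m choose j))
         = real (2 * m choose m) + 2 * (\<Sum>v=1..m. real (2 * m choose (m + l * v)))"
proof -
  let ?f = "\<lambda>j. real (2 * m choose j)"
  let ?A = "{j. j \<le> 2 * m \<and> int l dvd int j - int m}"
  have up: "(\<Sum>j | j \<in> ?A \<and> j > m. ?f j) = (\<Sum>v=1..m. ?f (m + l * v))"
  proof -
    have "(\<Sum>j | j \<in> ?A \<and> j > m. ?f j) = (\<Sum>v | v \<in> {1..m} \<and> m + l * v \<le> 2 * m. ?f (m + l * v))"
    proof (rule sum.reindex_bij_witness[of _ "\<lambda>v. m + l * v" "\<lambda>j. (j - m) div l"], goal_cases)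
      case (1 j)
      then have "int l dvd int (j - m)" by (auto simp: of_nat_diff)
      then have "l dvd j - m" by (simp only: of_nat_dvd_iff)
      then show ?case using 1 by (auto)
    next
      case (2 j)
      then have "int l dvd int (j - m)" by (auto simp: of_nat_diff)
      then have "l dvd j - m" by (simp only: of_nat_dvd_iff)
      moreover have "0 < j - m" using 2 by auto
      ultimately obtain v where v: "j - m = l * v" "v > 0" by (metis dvdE gr0I mult_0_right less_numeral_extra(3))
      then have "v \<le> l * v" using assms by simp
      moreover have "j - m \<le> m" using 2 by auto
      ultimately have "v \<le> m" using v by linarith
      then show ?case using v 2 assms by auto
    next
      case (5 j)
      then have "int l dvd int (j - m)" by (auto simp: of_nat_diff)
      then have "l dvd j - m" by (simp only: of_nat_dvd_iff)
      then show ?case using 5 by auto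
    qed (use assms in auto)
    also have "\<dots> = (\<Sum>v=1..m. ?f (m + l * v))"
      by (rule sum.mono_neutral_left) auto
    finally show ?thesis .
  qed
  have down: "(\<Sum>j | j \<in> ?A \<and> j < m. ?f j) = (\<Sum>j | j \<in> ?A \<and> j > m. ?f j)"
  proof (rule sum.reindex_bij_witness[of _ "\<lambda>j. 2 * m - j" "\<lambda>j. 2 * m - j"], goal_cases)
    case (2 j)
    then have "int (2 * m - j) - int m = - (int j - int m)" by auto
    then have "int l dvd int (2 * m - j) - int m" using 2 by (metis dvd_minus_iff mem_Collect_eq)
    then show ?case using 2 by auto
  next
    case (4 j)
    then have "int (2 * m - j) - int m = - (int j - int m)" by auto
    then have "int l dvd int (2 * m - j) - int m" using 4 by (metis dvd_minus_iff mem_Collect_eq)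
    then show ?case using 4 by auto
  next
    case (5 j)
    then show ?case by (auto simp: binomial_symmetric[of j "2*m"])
  qed auto
  define D where "D = {j. j \<in> ?A \<and> j < m}"
  define U where "U = {j. j \<in> ?A \<and> j > m}"
  have A: "?A = insert m (D \<union> U)" by (auto simp: D_def U_def)
  have fin: "finite D" "finite U" "m \<notin> D \<union> U" "D \<inter> U = {}" by (auto simp: D_def U_def)
  have "sum ?f ?A = ?f m + (sum ?f D + sum ?f U)"
    unfolding A using fin by (simp add: sum.union_disjoint)
  then show ?thesis unfolding D_def U_def down up by simp
qed

text \<open>Both sides are finite theta sums: when m grows like l^2, the powers of cosines tend to
  exp (- pi k^2 t) and the binomial ratios to exp (- pi v^2 / t). An odd l pairs k with l - k and
  leaves only k = 0 unpaired.\<close>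

lemma polya_identity:
  fixes r m :: nat
  defines "l \<equiv> 2 * r + 1"
  shows "1 + 2 * (\<Sum>k=1..r. cos (pi * real k / real l) ^ (2 * m))
    = real l * real (2 * m choose m) / 4 ^ m
        * (1 + 2 * (\<Sum>v=1..m. real (2 * m choose (m + l * v)) / real (2 * m choose m)))"
proof -
  let ?f = "\<lambda>k. cos (pi * real k / real l) ^ (2 * m)"
  have l: "l > 0" by (simp add: l_def)
  have split: "{..<l} = insert 0 ({1..r} \<union> {r+1..2*r})"
    by (auto simp: l_def)
  have "(\<Sum>k<l. ?f k) = 1 + ((\<Sum>k=1..r. ?f k) + (\<Sum>k=r+1..2*r. ?f k))"
    unfolding split by (subst sum.insert, simp, simp, subst sum.union_disjoint) auto
  also have "(\<Sum>k=r+1..2*r. ?f k) = (\<Sum>k=1..r. ?f k)"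
  proof (rule sum.reindex_bij_witness[of _ "\<lambda>k. l - k" "\<lambda>k. l - k"], goal_cases)
    case (5 k)
    then have "pi * real (l - k) / real l = pi - pi * real k / real l"
      using l by (auto simp: field_simps of_nat_diff l_def)
    then show ?case by (simp add: power_mult)
  qed (auto simp: l_def)
  finally have *: "(\<Sum>k<l. ?f k) = 1 + 2 * (\<Sum>k=1..r. ?f k)" by simp
  have "4 ^ m * (\<Sum>k<l. ?f k) = (\<Sum>k<l. (2 * cos (pi * real k / real l)) ^ (2 * m))"
    by (simp add: sum_distrib_left power_mult_distrib power_mult)
  also have "\<dots> = real l * (real (2 * m choose m) + 2 * (\<Sum>v=1..m. real (2 * m choose (m + l * v))))"
    using polya_cos_power_sum[OF l] sum_binomial_multiples[OF l] by simp
  also have "\<dots> = real l * real (2 * m choose m)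
        * (1 + 2 * (\<Sum>v=1..m. real (2 * m choose (m + l * v)) / real (2 * m choose m)))"
    by (simp add: sum_divide_distrib[symmetric] field_simps)
  finally show ?thesis unfolding * by (simp add: field_simps)
qed

section \<open>Binomial coefficients near the centre\<close>

lemma central_binomial_ratio:
  assumes "j \<le> m"
  shows "real (2 * m choose (m + j)) / real (2 * m choose m) = (\<Prod>i<j. (real m - real i) / (real m + real i + 1))"
  using assms
proof (induction j)
  case (Suc j)
  have "Suc (m + j) * (2 * m choose Suc (m + j)) = (2 * m choose (m + j)) * (2 * m - (m + j))"
    using binomial_absorb_comp[of "2*m" "m+j"] binomial_absorption[of "m+j" "2*m"] Suc.prems
    by (simp add: mult.commute)
  then have "real (Suc (m + j)) * real (2 * m choose Suc (m + j)) = real (2 * m choose (m + j)) * real (m - j)"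
    by (metis of_nat_mult Suc.prems Suc_leD add_diff_cancel_left mult_2)
  then have "real (2 * m choose (m + Suc j)) = real (2 * m choose (m + j)) * ((real m - real j) / (real m + real j + 1))"
    using Suc.prems by (simp add: field_simps of_nat_diff)
  then show ?case using Suc by (simp add: prod.lessThan_Suc[symmetric] field_simps del: prod.lessThan_Suc)
     (simp add: field_simps)
qed auto

lemma sum_odd_real: "(\<Sum>i<j. 2 * real i + 1) = real j ^ 2"
  by (induction j) (auto simp: power2_eq_square algebra_simps)

text \<open>The reverse of 1 - y \<le> exp (- y), at the price of dividing the exponent by 1 - y.
  Both bounds agree to first order as y tends to 0, so together they give sandwiches.\<close>

lemma exp_minus_div_le:
  assumes "(y::real) < 1"
  shows "exp (- (y / (1 - y))) \<le> 1 - y"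
proof -
  have "1 / (1 - y) = 1 + y / (1 - y)" using assms by (simp add: field_simps)
  also have "\<dots> \<le> exp (y / (1 - y))" by (rule exp_ge_add_one_self)
  finally have "1 / exp (y / (1 - y)) \<le> 1 - y" using assms by (simp add: field_simps)
  then show ?thesis by (simp add: exp_minus field_simps)
qed

text \<open>Each factor of the product formula is 1 - (2 i + 1) / (m + i + 1); the denominators are
  enlarged to m + j, and the numerators 2 i + 1 add up to j^2.\<close>

lemma central_binomial_ratio_upper:
  assumes "j \<le> m"
  shows "real (2 * m choose (m + j)) / real (2 * m choose m) \<le> exp (- (real j ^ 2 / real (m + j)))"
proof (cases "m = 0")
  case False
  have "(\<Prod>i<j. (real m - real i) / (real m + real i + 1)) \<le> (\<Prod>i<j. exp (- ((2 * real i + 1) / real (m + j))))"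
  proof (intro prod_mono conjI)
    fix i assume i: "i \<in> {..<j}"
    show "0 \<le> (real m - real i) / (real m + real i + 1)" using i assms by auto
    have "(real m - real i) / (real m + real i + 1) = 1 + (- ((2 * real i + 1) / (real m + real i + 1)))"
      by (simp add: field_simps)
    also have "\<dots> \<le> exp (- ((2 * real i + 1) / (real m + real i + 1)))" by (rule exp_ge_add_one_self)
    also have "\<dots> \<le> exp (- ((2 * real i + 1) / real (m + j)))"
      using i assms by (auto intro!: divide_left_mono)
    finally show "(real m - real i) / (real m + real i + 1) \<le> \<dots>" .
  qed
  also have "\<dots> = exp (- (real j ^ 2 / real (m + j)))"
    by (simp add: exp_sum[symmetric] sum_negf sum_divide_distrib[symmetric] sum_odd_real)
  finally show ?thesis by (simp add: central_binomial_ratio[OF assms])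
qed (use assms in auto)

lemma central_binomial_ratio_lower:
  assumes "j < m"
  shows "real (2 * m choose (m + j)) / real (2 * m choose m) \<ge> exp (- (real j ^ 2 / (real m - real j)))"
proof -
  have "exp (- (real j ^ 2 / (real m - real j))) = (\<Prod>i<j. exp (- ((2 * real i + 1) / (real m - real j))))"
    by (simp add: exp_sum[symmetric] sum_negf sum_divide_distrib[symmetric] sum_odd_real)
  also have "\<dots> \<le> (\<Prod>i<j. (real m - real i) / (real m + real i + 1))"
  proof (intro prod_mono conjI)
    fix i assume i: "i \<in> {..<j}"
    define y where "y = (2 * real i + 1) / (real m + real i + 1)"
    have 1: "1 - y = (real m - real i) / (real m + real i + 1)" by (simp add: y_def field_simps)
    have "y / (1 - y) = (2 * real i + 1) / (real m - real i)"
      unfolding 1 unfolding y_def using i assms by (simp add: divide_divide_eq_right)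
    also have "\<dots> \<le> (2 * real i + 1) / (real m - real j)"
      using i assms by (intro divide_left_mono) auto
    finally have "exp (- ((2 * real i + 1) / (real m - real j))) \<le> exp (- (y / (1 - y)))" by simp
    also have "\<dots> \<le> 1 - y"
      by (rule exp_minus_div_le) (use i assms in \<open>auto simp: y_def field_simps\<close>)
    finally show "exp (- ((2 * real i + 1) / (real m - real j))) \<le> (real m - real i) / (real m + real i + 1)"
      by (simp add: 1)
  qed auto
  finally show ?thesis using assms by (simp add: central_binomial_ratio)
qed

text \<open>This is the limit formula for Gamma at 1/2: for m > 0 the sequence equals
  \<open>1 / Gamma_series' (1/2) m\<close>, and Gamma (1/2) = sqrt pi supplies the constant.\<close>

lemma central_binomial_asymp:
  "(\<lambda>m. sqrt (real m) * real (2 * m choose m) / 4 ^ m) \<longlonglongrightarrow> 1 / sqrt pi"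
proof -
  have "(\<lambda>m. 1 / Gamma_series' (1/2) m) \<longlonglongrightarrow> 1 / Gamma (1/2 :: real)"
    by (intro tendsto_intros Gamma_series'_LIMSEQ) (simp add: Gamma_one_half_real)
  moreover have "\<forall>\<^sub>F m in sequentially. 1 / Gamma_series' (1/2) m = sqrt (real m) * real (2 * m choose m) / 4 ^ m"
    using eventually_gt_at_top[of 0]
  proof eventually_elim
    case (elim m)
    define s where "s = sqrt (real m)"
    have s: "s > 0" "real m = s * s" using elim by (auto simp: s_def)
    have "real (2 * m choose m) = 4 ^ m * pochhammer (1/2) m / (real m * fact (m - 1))"
      using binomial_fact[of m "2*m", where ?'a = real] fact_double[of m, where ?'a = real]
        fact_reduce[OF elim, where ?'a = real]
      by (simp add: power_mult)
    then have "s * real (2 * m choose m) / 4 ^ m = pochhammer (1/2) m / (s * fact (m - 1))"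
      using s(1) unfolding s(2) by (simp add: field_simps)
    moreover have "exp (1/2 * ln (real m)) = s"
      using elim powr_half_sqrt[of "real m"] by (simp add: powr_def s_def)
    ultimately show ?case
      by (simp add: Gamma_series'_def mult.commute flip: s_def)
  qed
  ultimately show ?thesis using Lim_transform_eventually Gamma_one_half_real by fastforce
qed

text \<open>The Taylor bound gives sin x \<ge> x - x^3 / 6, and x \<le> 2 gives x^3 \<le> 4 x; the
  constant is 1 - 4/6.\<close>

lemma sin_ge_third:
  assumes "0 \<le> x" "x \<le> pi / 2"
  shows "x / 3 \<le> sin x"
proof -
  have "\<bar>sin x - (\<Sum>m<3. sin_coeff m * x ^ m)\<bar> \<le> inverse (fact 3) * \<bar>x\<bar> ^ 3"
    by (rule Maclaurin_sin_bound)
  moreover have "(\<Sum>m<3. sin_coeff m * x ^ m) = x"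
    by (simp add: sin_coeff_def eval_nat_numeral)
  ultimately have "sin x \<ge> x - x ^ 3 / 6" using assms by (simp add: abs_if eval_nat_numeral split: if_splits)
  moreover have "x ^ 3 \<le> 4 * x"
  proof -
    have "x \<le> 2" using assms pi_less_4 by linarith
    then have "x * x \<le> 2 * 2" using assms by (intro mult_mono) auto
    then have "x * (x * x) \<le> x * 4" using assms by (intro mult_left_mono) auto
    then show ?thesis by (simp add: eval_nat_numeral mult_ac)
  qed
  ultimately show ?thesis by simp
qed

section \<open>Passage to the limit in the finite identity\<close>

lemma tendsto_power_exp:
  fixes y :: "'a \<Rightarrow> real" and m :: "'a \<Rightarrow> nat"
  assumes "(y \<longlongrightarrow> 0) F" "((\<lambda>r. real (m r) * y r) \<longlongrightarrow> c) F" "eventually (\<lambda>r. y r < 1) F"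
  shows "((\<lambda>r. (1 - y r) ^ m r) \<longlongrightarrow> exp (- c)) F"
proof (rule tendsto_sandwich)
  show "eventually (\<lambda>r. exp (- (real (m r) * y r / (1 - y r))) \<le> (1 - y r) ^ m r) F"
    using assms(3)
  proof eventually_elim
    case (elim r)
    have "exp (- (y r / (1 - y r))) ^ m r \<le> (1 - y r) ^ m r"
      using exp_minus_div_le[OF elim] by (intro power_mono) auto
    then show ?case by (simp add: exp_of_nat_mult[symmetric])
  qed
  show "eventually (\<lambda>r. (1 - y r) ^ m r \<le> exp (- (real (m r) * y r))) F"
    using assms(3)
  proof eventually_elim
    case (elim r)
    have "(1 - y r) ^ m r \<le> exp (- y r) ^ m r"
      using elim exp_ge_add_one_self[of "- y r"] by (intro power_mono) auto
    then show ?case by (simp add: exp_of_nat_mult[symmetric])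
  qed
  show "((\<lambda>r. exp (- (real (m r) * y r))) \<longlongrightarrow> exp (- c)) F"
    by (intro tendsto_intros assms)
  have "((\<lambda>r. exp (- (real (m r) * y r / (1 - y r)))) \<longlongrightarrow> exp (- (c / (1 - 0)))) F"
    by (intro tendsto_intros assms) auto
  then show "((\<lambda>r. exp (- (real (m r) * y r / (1 - y r)))) \<longlongrightarrow> exp (- c)) F" by simp
qed

lemma suminf_tendsto_dominated:
  fixes a :: "nat \<Rightarrow> nat \<Rightarrow> real"
  assumes "\<And>k. (\<lambda>r. a k r) \<longlonglongrightarrow> b k"
    and "eventually (\<lambda>r. \<forall>k. \<bar>a k r\<bar> \<le> M k) sequentially" and "summable M"
  shows "(\<lambda>r. \<Sum>k. a k r) \<longlonglongrightarrow> (\<Sum>k. b k)"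
proof -
  have "eventually (\<lambda>(k, r). norm (a k r) \<le> M k) (at_top \<times>\<^sub>F sequentially)"
    unfolding eventually_prod_filter
    using assms(2) by (intro exI[of _ "\<lambda>_. True"] exI[of _ "\<lambda>r. \<forall>k. \<bar>a k r\<bar> \<le> M k"]) auto
  from tannerys_theorem[OF assms(1) this assms(3)] show ?thesis by auto
qed

theorem theta_transformation:
  fixes t :: real
  assumes "t > 0"
  shows "1 + 2 * (\<Sum>k. exp (- pi * real (Suc k) ^ 2 * t))
      = (1 + 2 * (\<Sum>k. exp (- pi * real (Suc k) ^ 2 / t))) / sqrt t"
proof -
  \<comment> \<open>With m about c l^2, cos (pi k / l)^(2 m) behaves like exp (- c pi^2 k^2), and
    the binomial ratio at distance l v from the centre like exp (- v^2 / c). The choice c = t / pi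
    turns these into exp (- pi k^2 t) and exp (- pi v^2 / t), and the prefactor, about l / sqrt (pi
    m), tends to 1 / sqrt t.\<close>
  define c where "c = t / pi"
  have c: "c > 0" using assms by (simp add: c_def)
  define l where "l r = 2 * r + 1" for r :: nat
  define m where "m r = nat \<lfloor>c * real (l r) ^ 2\<rfloor>" for r :: nat
  have lpos: "l r > 0" "real (l r) > 0" for r by (auto simp: l_def)
  have mle: "real (m r) \<le> c * real (l r) ^ 2" for r
    unfolding m_def using c by (simp add: of_nat_nat)
  have mge: "real (m r) \<ge> c * real (l r) ^ 2 - 1" for r
    unfolding m_def using c by (simp add: of_nat_nat)
  have mlim: "(\<lambda>r. real (m r) / real (l r) ^ 2) \<longlonglongrightarrow> c"
  proof (rule tendsto_sandwich)
    show "\<forall>\<^sub>F r in sequentially. c - 1 / real (l r) ^ 2 \<le> real (m r) / real (l r) ^ 2"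
    proof (intro always_eventually allI)
      fix r
      have "c - 1 / real (l r) ^ 2 = (c * real (l r) ^ 2 - 1) / real (l r) ^ 2"
        using lpos[of r] by (simp add: field_simps)
      also have "\<dots> \<le> real (m r) / real (l r) ^ 2" by (intro divide_right_mono mge) auto
      finally show "c - 1 / real (l r) ^ 2 \<le> real (m r) / real (l r) ^ 2" .
    qed
    show "\<forall>\<^sub>F r in sequentially. real (m r) / real (l r) ^ 2 \<le> c"
      using mle lpos by (intro always_eventually allI) (simp add: pos_divide_le_eq)
    show "(\<lambda>r. c - 1 / real (l r) ^ 2) \<longlonglongrightarrow> c" unfolding l_def by real_asymp
  qed auto
  have minf: "filterlim (\<lambda>r. real (m r)) at_top sequentially"
  proof (rule filterlim_at_top_mono)
    show "filterlim (\<lambda>r. c * real (l r) ^ 2 - 1) at_top sequentially"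
      unfolding l_def using c by real_asymp
  qed (use mge in auto)
  have minf': "filterlim m at_top sequentially"
    using minf filterlim_sequentially_iff_filterlim_real by blast
  have ev1: "eventually (\<lambda>r. real (m r) / real (l r) ^ 2 > c / 2) sequentially"
    using mlim c by (intro order_tendstoD(1)[of _ c]) auto
  have ev2: "eventually (\<lambda>r. m r > 0) sequentially"
    using filterlim_at_top_dense[THEN iffD1, OF minf, rule_format, of 0] by simp
  have summ: "summable (\<lambda>k. exp (- (d * real (Suc k))))" if "d > 0" for d :: real
  proof -
    have "exp (- (d * real (Suc k))) = exp (- d) * exp (- d) ^ k" for k
      by (simp add: exp_of_nat_mult[symmetric] exp_add[symmetric] algebra_simps)
    then show ?thesis using that by (auto intro!: summable_mult summable_geometric)
  qed

  define A where "A k r = (if Suc k \<le> r then cos (pi * real (Suc k) / real (l r)) ^ (2 * m r) else 0)" for k r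
  define B where "B k r = real (2 * m r choose (m r + l r * Suc k)) / real (2 * m r choose m r)" for k r
  have limA: "(\<lambda>r. \<Sum>k. A k r) \<longlonglongrightarrow> (\<Sum>k. exp (- pi * real (Suc k) ^ 2 * t))"
  proof (rule suminf_tendsto_dominated)
    fix k
    define y where "y r = sin (pi * real (Suc k) / real (l r)) ^ 2" for r
    have "(\<lambda>r. (1 - y r) ^ m r) \<longlonglongrightarrow> exp (- (c * (pi * real (Suc k)) ^ 2))"
    proof (rule tendsto_power_exp)
      show y0: "y \<longlonglongrightarrow> 0" unfolding y_def l_def by real_asymp
      show "eventually (\<lambda>r. y r < 1) sequentially"
        using y0 by (rule order_tendstoD) auto
      have "(\<lambda>r. (real (l r) * sin (pi * real (Suc k) / real (l r))) ^ 2) \<longlonglongrightarrow> (pi * real (Suc k)) ^ 2"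
        unfolding l_def by real_asymp
      then have "(\<lambda>r. (real (m r) / real (l r) ^ 2) * (real (l r) * sin (pi * real (Suc k) / real (l r))) ^ 2)
            \<longlonglongrightarrow> c * (pi * real (Suc k)) ^ 2"
        by (intro tendsto_mult mlim)
      also have "(\<lambda>r. (real (m r) / real (l r) ^ 2) * (real (l r) * sin (pi * real (Suc k) / real (l r))) ^ 2)
           = (\<lambda>r. real (m r) * y r)"
        using lpos by (auto simp: y_def power_mult_distrib fun_eq_iff field_simps)
      finally show "(\<lambda>r. real (m r) * y r) \<longlonglongrightarrow> c * (pi * real (Suc k)) ^ 2" .
    qed
    also have "c * (pi * real (Suc k)) ^ 2 = pi * real (Suc k) ^ 2 * t"
      by (simp add: c_def power_mult_distrib power2_eq_square)
    finally have "(\<lambda>r. (1 - y r) ^ m r) \<longlonglongrightarrow> exp (- pi * real (Suc k) ^ 2 * t)" by simp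
    moreover have "eventually (\<lambda>r. (1 - y r) ^ m r = A k r) sequentially"
      using eventually_ge_at_top[of "Suc k"]
      by eventually_elim (simp add: A_def y_def power_mult cos_squared_eq)
    ultimately show "(\<lambda>r. A k r) \<longlonglongrightarrow> exp (- pi * real (Suc k) ^ 2 * t)"
      by (rule Lim_transform_eventually)
  next
    \<comment> \<open>The rate c pi^2 / 18 combines m / l^2 > c / 2 with the square of sin x \<ge> x
      / 3. Replacing (k + 1)^2 by k + 1 leaves a geometric majorant.\<close>
    show "eventually (\<lambda>r. \<forall>k. \<bar>A k r\<bar> \<le> exp (- (c * pi ^ 2 / 18 * real (Suc k)))) sequentially"
      using ev1
    proof eventually_elim
      case (elim r)
      show ?case
      proof
        fix k
        show "\<bar>A k r\<bar> \<le> exp (- (c * pi ^ 2 / 18 * real (Suc k)))"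
        proof (cases "Suc k \<le> r")
          case True
          define x where "x = pi * real (Suc k) / real (l r)"
          have "real (Suc k) \<le> real (l r) / 2" using True by (simp add: l_def)
          then have "pi * real (Suc k) \<le> pi * (real (l r) / 2)" by (intro mult_left_mono) auto
          then have x: "0 \<le> x" "x \<le> pi / 2" using lpos[of r] by (auto simp: x_def field_simps)
          have "\<bar>A k r\<bar> = (cos x ^ 2) ^ m r" using True by (simp add: A_def x_def power_mult)
          also have "\<dots> \<le> (exp (- (sin x ^ 2))) ^ m r"
            using exp_ge_add_one_self[of "- (sin x ^ 2)"] by (intro power_mono) (simp_all add: cos_squared_eq[symmetric])
          also have "\<dots> \<le> exp (- ((x / 3) ^ 2)) ^ m r"
            using sin_ge_third[OF x] x by (intro power_mono) (auto intro!: power_mono)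
          also have "\<dots> = exp (- (real (m r) / real (l r) ^ 2 * (pi * real (Suc k)) ^ 2 / 9))"
            by (simp add: exp_of_nat_mult[symmetric] x_def power_divide)
          also have "\<dots> \<le> exp (- (c / 2 * (pi * real (Suc k)) ^ 2 / 9))"
            using mult_right_mono[OF less_imp_le[OF elim], of "(pi * real (Suc k)) ^ 2 / 9"] by simp
          also have "\<dots> = exp (- (c * pi ^ 2 / 18 * real (Suc k) ^ 2))"
            by (simp add: power_mult_distrib)
          also have "\<dots> \<le> exp (- (c * pi ^ 2 / 18 * real (Suc k)))"
            using c by (auto intro!: mult_left_mono simp: power2_eq_square)
          finally show ?thesis .
        qed (auto simp: A_def)
      qed
    qed
    show "summable (\<lambda>k. exp (- (c * pi ^ 2 / 18 * real (Suc k))))"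
      using c by (intro summ) auto
  qed
  have limB: "(\<lambda>r. \<Sum>k. B k r) \<longlonglongrightarrow> (\<Sum>k. exp (- pi * real (Suc k) ^ 2 / t))"
  proof (rule suminf_tendsto_dominated)
    fix k
    define j where "j r = l r * Suc k" for r
    have jm: "(\<lambda>r. real (j r) ^ 2 / real (m r)) \<longlonglongrightarrow> real (Suc k) ^ 2 / c"
    proof -
      have "(\<lambda>r. real (Suc k) ^ 2 / (real (m r) / real (l r) ^ 2)) \<longlonglongrightarrow> real (Suc k) ^ 2 / c"
        by (intro tendsto_intros mlim) (use c in auto)
      also have "(\<lambda>r. real (Suc k) ^ 2 / (real (m r) / real (l r) ^ 2)) = (\<lambda>r. real (j r) ^ 2 / real (m r))"
        unfolding j_def of_nat_mult power_mult_distrib by (simp add: mult.commute)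
      finally show ?thesis .
    qed
    have jm0: "(\<lambda>r. real (j r) / real (m r)) \<longlonglongrightarrow> 0"
    proof -
      have "(\<lambda>r. real (Suc k) / (real (m r) / real (l r) ^ 2) * (1 / real (l r))) \<longlonglongrightarrow> real (Suc k) / c * 0"
      proof (intro tendsto_mult tendsto_divide tendsto_const mlim)
        show "(\<lambda>r. 1 / real (l r)) \<longlonglongrightarrow> 0" unfolding l_def by real_asymp
      qed (use c in auto)
      also have "(\<lambda>r. real (Suc k) / (real (m r) / real (l r) ^ 2) * (1 / real (l r))) = (\<lambda>r. real (j r) / real (m r))"
        using lpos by (auto simp: j_def power2_eq_square fun_eq_iff algebra_simps)
      finally show ?thesis unfolding mult_zero_right .
    qed
    have evj: "eventually (\<lambda>r. j r < m r) sequentially"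
    proof -
      have "eventually (\<lambda>r. real (j r) / real (m r) < 1) sequentially"
        using jm0 by (rule order_tendstoD) simp
      then show ?thesis using ev2 by eventually_elim (simp add: pos_divide_less_eq)
    qed
    show "(\<lambda>r. B k r) \<longlonglongrightarrow> exp (- pi * real (Suc k) ^ 2 / t)"
    proof (rule tendsto_sandwich)
      show "eventually (\<lambda>r. exp (- (real (j r) ^ 2 / (real (m r) - real (j r)))) \<le> B k r) sequentially"
        using evj by eventually_elim (simp only: B_def j_def central_binomial_ratio_lower)
      show "eventually (\<lambda>r. B k r \<le> exp (- (real (j r) ^ 2 / real (m r + j r)))) sequentially"
        using evj by eventually_elim (simp only: B_def j_def central_binomial_ratio_upper less_imp_le)
      have e: "exp (- pi * real (Suc k) ^ 2 / t) = exp (- (real (Suc k) ^ 2 / c / (1 - 0)))"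
              "exp (- pi * real (Suc k) ^ 2 / t) = exp (- (real (Suc k) ^ 2 / c / (1 + 0)))"
        by (auto simp: c_def)
      have "(\<lambda>r. exp (- (real (j r) ^ 2 / real (m r) / (1 - real (j r) / real (m r))))) \<longlonglongrightarrow> exp (- pi * real (Suc k) ^ 2 / t)"
        unfolding e(1) by (intro tendsto_intros jm jm0) auto
      moreover have "eventually (\<lambda>r. exp (- (real (j r) ^ 2 / real (m r) / (1 - real (j r) / real (m r)))) =
          exp (- (real (j r) ^ 2 / (real (m r) - real (j r))))) sequentially"
        using ev2 evj by eventually_elim (simp add: field_simps)
      ultimately show "(\<lambda>r. exp (- (real (j r) ^ 2 / (real (m r) - real (j r))))) \<longlonglongrightarrow> exp (- pi * real (Suc k) ^ 2 / t)"
        by (rule Lim_transform_eventually)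
      have "(\<lambda>r. exp (- (real (j r) ^ 2 / real (m r) / (1 + real (j r) / real (m r))))) \<longlonglongrightarrow> exp (- pi * real (Suc k) ^ 2 / t)"
        unfolding e(2) by (intro tendsto_intros jm jm0) auto
      moreover have "eventually (\<lambda>r. exp (- (real (j r) ^ 2 / real (m r) / (1 + real (j r) / real (m r)))) =
          exp (- (real (j r) ^ 2 / real (m r + j r)))) sequentially"
        using ev2 evj by eventually_elim (simp add: field_simps)
      ultimately show "(\<lambda>r. exp (- (real (j r) ^ 2 / real (m r + j r)))) \<longlonglongrightarrow> exp (- pi * real (Suc k) ^ 2 / t)"
        by (rule Lim_transform_eventually)
    qed
  next
    \<comment> \<open>For j \<le> m one has m + j \<le> 2 m \<le> 2 c l^2, whence the rate 1 / (2
      c); for j > m the binomial coefficient is 0.\<close>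
    show "eventually (\<lambda>r. \<forall>k. \<bar>B k r\<bar> \<le> exp (- (1 / (2 * c) * real (Suc k)))) sequentially"
      using ev2
    proof eventually_elim
      case (elim r)
      show ?case
      proof
        fix k
        define j where "j = l r * Suc k"
        show "\<bar>B k r\<bar> \<le> exp (- (1 / (2 * c) * real (Suc k)))"
        proof (cases "j \<le> m r")
          case True
          have "\<bar>B k r\<bar> \<le> exp (- (real j ^ 2 / real (m r + j)))"
            using central_binomial_ratio_upper[OF True] by (simp add: B_def j_def)
          also have "\<dots> \<le> exp (- (real j ^ 2 / (2 * real (m r))))"
            using True elim by (auto intro!: divide_left_mono)
          also have "\<dots> \<le> exp (- (real j ^ 2 / (2 * (c * real (l r) ^ 2))))"
            using elim mle[of r] c lpos[of r] by (auto intro!: divide_left_mono)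
          also have "\<dots> = exp (- (1 / (2 * c) * real (Suc k) ^ 2))"
            using lpos[of r] unfolding j_def of_nat_mult power_mult_distrib by simp
          also have "\<dots> \<le> exp (- (1 / (2 * c) * real (Suc k)))"
            using c by (auto intro!: divide_right_mono simp: power2_eq_square)
          finally show ?thesis .
        next
          case False
          then have "B k r = 0" by (simp add: B_def j_def binomial_eq_0)
          then show ?thesis by simp
        qed
      qed
    qed
    show "summable (\<lambda>k. exp (- (1 / (2 * c) * real (Suc k))))"
      using c by (intro summ) auto
  qed
  have limc: "(\<lambda>r. real (l r) * real (2 * m r choose m r) / 4 ^ m r) \<longlonglongrightarrow> 1 / sqrt t"
  proof -
    have "(\<lambda>r. (sqrt (real (m r)) * real (2 * m r choose m r) / 4 ^ m r) / sqrt (real (m r) / real (l r) ^ 2))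
            \<longlonglongrightarrow> (1 / sqrt pi) / sqrt c"
      by (intro tendsto_intros mlim filterlim_compose[OF central_binomial_asymp minf']) (use c in auto)
    moreover have "(1 / sqrt pi) / sqrt c = 1 / sqrt t"
      using assms by (simp add: c_def real_sqrt_divide)
    moreover have "eventually (\<lambda>r. (sqrt (real (m r)) * real (2 * m r choose m r) / 4 ^ m r) / sqrt (real (m r) / real (l r) ^ 2)
         = real (l r) * real (2 * m r choose m r) / 4 ^ m r) sequentially"
      using ev2 by eventually_elim (simp add: real_sqrt_divide field_simps)
    ultimately show ?thesis using Lim_transform_eventually by fastforce
  qed
  have "1 + 2 * (\<Sum>k. A k r) = real (l r) * real (2 * m r choose m r) / 4 ^ m r * (1 + 2 * (\<Sum>k. B k r))" for r
  proof -
    have "(\<Sum>k. A k r) = (\<Sum>k<r. A k r)" by (rule suminf_finite) (auto simp: A_def)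
    also have "\<dots> = (\<Sum>k=1..r. cos (pi * real k / real (l r)) ^ (2 * m r))"
      unfolding One_nat_def sum.atLeast1_atMost_eq by (intro sum.cong) (auto simp: A_def)
    finally have 1: "(\<Sum>k. A k r) = \<dots>" .
    have "(\<Sum>k. B k r) = (\<Sum>k<m r. B k r)"
    proof (rule suminf_finite)
      fix k assume "k \<notin> {..<m r}"
      then have "m r < l r * Suc k" using lpos[of r]
        by (metis le_imp_less_Suc lessThan_iff less_le_trans mult.commute mult_le_mono2 nat_mult_1_right not_less Suc_leI One_nat_def)
      then show "B k r = 0" by (simp add: B_def binomial_eq_0)
    qed auto
    also have "\<dots> = (\<Sum>v=1..m r. real (2 * m r choose (m r + l r * v)) / real (2 * m r choose m r))"
      unfolding One_nat_def sum.atLeast1_atMost_eq by (intro sum.cong) (auto simp: B_def)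
    finally show ?thesis unfolding 1 using polya_identity[where m = "m r" and r = r] by (simp add: l_def)
  qed
  moreover have "(\<lambda>r. 1 + 2 * (\<Sum>k. A k r)) \<longlonglongrightarrow> 1 + 2 * (\<Sum>k. exp (- pi * real (Suc k) ^ 2 * t))"
    by (intro tendsto_intros limA)
  moreover have "(\<lambda>r. real (l r) * real (2 * m r choose m r) / 4 ^ m r * (1 + 2 * (\<Sum>k. B k r)))
      \<longlonglongrightarrow> 1 / sqrt t * (1 + 2 * (\<Sum>k. exp (- pi * real (Suc k) ^ 2 / t)))"
    by (intro tendsto_mult limc tendsto_add tendsto_const limB)
  ultimately show ?thesis using LIMSEQ_unique by fastforce
qed

section \<open>The kernel Phi\<close>

text \<open>The k-th derivative of (theta (t) - 1) / 2, where theta (t) sums exp (- pi n^2 t) over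
  all integers n.\<close>

definition theta_deriv :: "nat \<Rightarrow> real \<Rightarrow> real" where
  "theta_deriv k t = (\<Sum>n. (- pi * real (Suc n) ^ 2) ^ k * exp (- pi * real (Suc n) ^ 2 * t))"

lemma power_div_fact_le_exp:
  fixes x :: real
  assumes "x \<ge> 0"
  shows "x ^ n / fact n \<le> exp x"
proof -
  have "(\<lambda>n. x ^ n / fact n) sums exp x"
    using exp_converges[of x] by (simp add: field_simps)
  then show ?thesis
    using sum_le_suminf[of "\<lambda>n. x ^ n / fact n" "{n}"] assms by (simp add: sums_iff)
qed

text \<open>Comes from the single term y^(k+1) / (k+1)! of exp y at y = x t. The spare factor 1 / x
  gives convergence: at x = pi n^2 it is a multiple of 1 / n^2.\<close>

lemma power_times_exp_minus_bound:
  fixes x t :: real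
  assumes "x > 0" "t > 0"
  shows "x ^ k * exp (- x * t) \<le> (fact (Suc k) / t ^ Suc k) * (1 / x)"
proof -
  have "(x * t) ^ Suc k / fact (Suc k) \<le> exp (x * t)"
    using assms by (intro power_div_fact_le_exp) auto
  then have "(x * t) ^ Suc k \<le> fact (Suc k) * exp (x * t)"
    by (simp add: pos_divide_le_eq mult.commute del: fact_Suc)
  then have "(x * t) ^ Suc k * exp (- x * t) \<le> fact (Suc k)"
    by (simp add: exp_minus pos_divide_le_eq divide_inverse[symmetric] del: fact_Suc power_Suc)
  then have "x ^ k * exp (- x * t) * (t ^ Suc k * x) \<le> fact (Suc k)"
    by (simp add: power_mult_distrib mult_ac del: fact_Suc)
  then have "x ^ k * exp (- x * t) \<le> fact (Suc k) / (t ^ Suc k * x)"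
    using assms by (subst pos_le_divide_eq) (simp_all del: fact_Suc)
  then show ?thesis by simp
qed

lemma summable_theta_bound:
  assumes "t > 0"
  shows "summable (\<lambda>n. (pi * real (Suc n) ^ 2) ^ k * exp (- pi * real (Suc n) ^ 2 * t))"
proof (rule summable_comparison_test')
  have "summable (\<lambda>n. 1 / real (Suc n) ^ 2)"
    using inverse_squares_sums by (simp add: sums_iff)
  then show "summable (\<lambda>n. (fact (Suc k) / t ^ Suc k) * (1 / pi * (1 / real (Suc n) ^ 2)))"
    by (intro summable_mult)
  show "norm ((pi * real (Suc n) ^ 2) ^ k * exp (- pi * real (Suc n) ^ 2 * t)) \<le>
      (fact (Suc k) / t ^ Suc k) * (1 / pi * (1 / real (Suc n) ^ 2))" for n
    using power_times_exp_minus_bound[of "pi * real (Suc n) ^ 2" t k] assms by (simp add: mult_ac)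
qed

lemma summable_theta_deriv:
  assumes "t > 0"
  shows "summable (\<lambda>n. (- pi * real (Suc n) ^ 2) ^ k * exp (- pi * real (Suc n) ^ 2 * t))"
  by (rule summable_norm_cancel, rule summable_comparison_test'[OF summable_theta_bound[OF assms, of k]])
     (simp add: abs_mult power_abs del: of_nat_Suc)

lemma has_derivative_theta_deriv:
  assumes "t > 0"
  shows "(theta_deriv k has_real_derivative theta_deriv (Suc k) t) (at t)"
  unfolding theta_deriv_def
proof (rule has_field_derivative_series'(2)[of "{t/2..}" _ _ t])
  show "uniformly_convergent_on {t/2..}
      (\<lambda>n x. \<Sum>i<n. (- pi * real (Suc i) ^ 2) ^ Suc k * exp (- pi * real (Suc i) ^ 2 * x))"
  proof (rule Weierstrass_m_test')
    show "summable (\<lambda>n. (pi * real (Suc n) ^ 2) ^ Suc k * exp (- pi * real (Suc n) ^ 2 * (t/2)))"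
      using assms by (intro summable_theta_bound) auto
    show "norm ((- pi * real (Suc n) ^ 2) ^ Suc k * exp (- pi * real (Suc n) ^ 2 * x))
        \<le> (pi * real (Suc n) ^ 2) ^ Suc k * exp (- pi * real (Suc n) ^ 2 * (t/2))" if "x \<in> {t/2..}" for n x
      using that unfolding norm_mult norm_power by (intro mult_mono) (auto intro!: power_mono simp: abs_mult)
  qed
  show "((\<lambda>t. (- pi * real (Suc n) ^ 2) ^ k * exp (- pi * real (Suc n) ^ 2 * t)) has_real_derivative
      (- pi * real (Suc n) ^ 2) ^ Suc k * exp (- pi * real (Suc n) ^ 2 * x)) (at x within {t/2..})" for n x
    by (rule derivative_eq_intros refl | simp)+
  show "t \<in> interior {t/2..}" using assms by (simp add: interior_real_atLeast)
qed (use assms summable_theta_deriv in auto)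

lemma has_derivative_theta_deriv_exp:
  "((\<lambda>u. theta_deriv k (exp (2 * u))) has_real_derivative theta_deriv (Suc k) (exp (2 * u)) * (2 * exp (2 * u))) (at u)"
proof (rule DERIV_chain2[where f = "theta_deriv k" and g = "\<lambda>u. exp (2 * u)"])
  show "(theta_deriv k has_real_derivative theta_deriv (Suc k) (exp (2 * u))) (at (exp (2 * u)))"
    by (rule has_derivative_theta_deriv) simp
qed (auto intro!: derivative_eq_intros)

lemma theta_deriv_0_transformation:
  assumes "t > 0"
  shows "1 + 2 * theta_deriv 0 t = (1 + 2 * theta_deriv 0 (1 / t)) / sqrt t"
  using theta_transformation[OF assms] by (simp add: theta_deriv_def)

definition xi_Phi_term :: "nat \<Rightarrow> real \<Rightarrow> real" where
  "xi_Phi_term k u = (4 * real (Suc k) ^ 4 * pi\<^sup>2 * exp (9 * u / 2) - 6 * (real (Suc k))\<^sup>2 * pi * exp (5 * u / 2))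
       * exp (- ((real (Suc k))\<^sup>2 * pi * exp (2 * u)))"

lemma xi_Phi_term_eq:
  "xi_Phi_term k u = 4 * exp (9 * u / 2) * ((- pi * real (Suc k) ^ 2) ^ 2 * exp (- pi * real (Suc k) ^ 2 * exp (2 * u)))
     + 6 * exp (5 * u / 2) * ((- pi * real (Suc k) ^ 2) ^ 1 * exp (- pi * real (Suc k) ^ 2 * exp (2 * u)))"
  by (simp add: xi_Phi_term_def algebra_simps eval_nat_numeral del: of_nat_Suc)

lemma xi_Phi_term_sums: "(\<lambda>k. xi_Phi_term k u) sums xi_Phi u"
  and xi_Phi_theta: "xi_Phi u = 4 * exp (9 * u / 2) * theta_deriv 2 (exp (2 * u))
          + 6 * exp (5 * u / 2) * theta_deriv 1 (exp (2 * u))"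
proof -
  have "(\<lambda>k. xi_Phi_term k u) sums (4 * exp (9 * u / 2) * theta_deriv 2 (exp (2 * u))
          + 6 * exp (5 * u / 2) * theta_deriv 1 (exp (2 * u)))"
    unfolding xi_Phi_term_eq theta_deriv_def
    by (intro sums_add sums_mult summable_sums summable_theta_deriv) auto
  moreover have "xi_Phi u = (\<Sum>k. xi_Phi_term k u)"
    by (simp add: xi_Phi_def xi_Phi_term_def Let_def)
  ultimately show "(\<lambda>k. xi_Phi_term k u) sums xi_Phi u"
    "xi_Phi u = 4 * exp (9 * u / 2) * theta_deriv 2 (exp (2 * u))
          + 6 * exp (5 * u / 2) * theta_deriv 1 (exp (2 * u))"
    by (auto simp: sums_iff)
qed

lemma xi_Phi_even: "xi_Phi (- u) = xi_Phi u"
proof -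
  \<comment> \<open>\<open>K\<close> is even by the theta transformation, and \<open>2 \<Phi> = K'' - K / 4\<close>.\<close>
  define K where "K u = exp (u / 2) * (1 + 2 * theta_deriv 0 (exp (2 * u)))" for u
  define K1 where "K1 u = K u / 2 + 4 * exp (5 * u / 2) * theta_deriv 1 (exp (2 * u))" for u
  have K: "(K has_real_derivative K1 u) (at u)" for u
  proof -
    have "((\<lambda>u. theta_deriv 0 (exp (2 * u))) has_real_derivative theta_deriv 1 (exp (2 * u)) * (2 * exp (2 * u))) (at u)"
      using has_derivative_theta_deriv_exp[of 0 u] by simp
    then have "(K has_real_derivative
        exp (u / 2) / 2 * (1 + 2 * theta_deriv 0 (exp (2 * u))) +
        exp (u / 2) * (2 * (theta_deriv 1 (exp (2 * u)) * (2 * exp (2 * u))))) (at u)"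
      unfolding K_def by (auto intro!: derivative_eq_intros)
    also have "exp (u / 2) / 2 * (1 + 2 * theta_deriv 0 (exp (2 * u))) +
        exp (u / 2) * (2 * (theta_deriv 1 (exp (2 * u)) * (2 * exp (2 * u)))) =
        K u / 2 + 4 * (exp (u / 2) * exp (2 * u)) * theta_deriv 1 (exp (2 * u))"
      by (simp add: K_def algebra_simps)
    also have "exp (u / 2) * exp (2 * u) = exp (5 * u / 2)" by (simp add: exp_add[symmetric])
    finally show ?thesis by (simp add: K1_def)
  qed
  have K1: "(K1 has_real_derivative 2 * xi_Phi u + K u / 4) (at u)" for u
  proof -
    have "((\<lambda>u. theta_deriv 1 (exp (2 * u))) has_real_derivative theta_deriv 2 (exp (2 * u)) * (2 * exp (2 * u))) (at u)"
      using has_derivative_theta_deriv_exp[of 1 u] by (simp add: numeral_2_eq_2)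
    then have "(K1 has_real_derivative K1 u / 2 + (10 * exp (5 * u / 2) * theta_deriv 1 (exp (2 * u))
       + 4 * exp (5 * u / 2) * (theta_deriv 2 (exp (2 * u)) * (2 * exp (2 * u))))) (at u)"
      unfolding K1_def[abs_def] by (auto intro!: derivative_eq_intros K simp: K1_def)
    also have "4 * exp (5 * u / 2) * (theta_deriv 2 (exp (2 * u)) * (2 * exp (2 * u))) =
       8 * (exp (5 * u / 2) * exp (2 * u)) * theta_deriv 2 (exp (2 * u))" by simp
    also have "exp (5 * u / 2) * exp (2 * u) = exp (9 * u / 2)" by (simp add: exp_add[symmetric])
    also have "K1 u / 2 + (10 * exp (5 * u / 2) * theta_deriv 1 (exp (2 * u)) + 8 * exp (9 * u / 2) * theta_deriv 2 (exp (2 * u)))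
        = 2 * xi_Phi u + K u / 4"
      by (simp add: K1_def xi_Phi_theta algebra_simps)
    finally show ?thesis .
  qed
  have even: "K (- u) = K u" for u
  proof -
    have s: "sqrt (exp (2 * u)) = exp u"
      by (metis exp_double exp_ge_zero real_sqrt_unique)
    have "K u = exp (u / 2) * ((1 + 2 * theta_deriv 0 (1 / exp (2 * u))) / exp u)"
      unfolding K_def by (subst theta_deriv_0_transformation) (auto simp: s)
    also have "1 / exp (2 * u) = exp (2 * - u)" by (simp add: exp_minus field_simps)
    also have "exp (u / 2) * ((1 + 2 * theta_deriv 0 (exp (2 * - u))) / exp u)
       = exp (u / 2 - u) * (1 + 2 * theta_deriv 0 (exp (2 * - u)))"
      by (subst exp_diff) (simp only: times_divide_eq_right times_divide_eq_left)
    also have "\<dots> = K (- u)" by (simp add: K_def)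
    finally show ?thesis ..
  qed
  have odd: "K1 (- u) = - K1 u" for u
  proof -
    have "((\<lambda>u. K (- u)) has_real_derivative K1 (- u) * (- 1)) (at u)"
      by (rule DERIV_chain2[OF K]) (auto intro!: derivative_eq_intros)
    then show ?thesis unfolding even using K DERIV_unique by fastforce
  qed
  have "((\<lambda>u. K1 (- u)) has_real_derivative (2 * xi_Phi (- u) + K (- u) / 4) * (- 1)) (at u)"
    by (rule DERIV_chain2[OF K1]) (auto intro!: derivative_eq_intros)
  moreover have "((\<lambda>u. K1 (- u)) has_real_derivative - (2 * xi_Phi u + K u / 4)) (at u)"
    unfolding odd by (intro DERIV_minus K1)
  ultimately have "(2 * xi_Phi (- u) + K (- u) / 4) * (- 1) = - (2 * xi_Phi u + K u / 4)"
    by (rule DERIV_unique)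
  then show ?thesis by (simp add: even)
qed

text \<open>For u \<ge> 0 every summand is positive, since 2 n^2 pi e^(2u) \<ge> 2 pi > 3. For u < 0
  individual summands can be negative, and evenness transfers the sign of the sum.\<close>

lemma xi_Phi_pos: "xi_Phi u > 0"
proof -
  have pos: "xi_Phi u > 0" if "u \<ge> 0" for u
  proof -
    have term_pos: "xi_Phi_term k u > 0" for k
    proof -
      define n where "n = real (Suc k)"
      have "3 < 2 * pi" using pi_gt3 by simp
      also have "\<dots> \<le> 2 * n ^ 2 * pi * exp (2 * u)"
        using mult_mono[of 1 "n ^ 2" 1 "exp (2 * u)"] that by (simp add: n_def mult_ac)
      finally have "0 < 2 * n ^ 2 * pi * exp (5 * u / 2) * (2 * n ^ 2 * pi * exp (2 * u) - 3) * exp (- (n ^ 2 * pi * exp (2 * u)))"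
        by (intro mult_pos_pos) (auto simp: n_def)
      also have "\<dots> = (4 * n ^ 4 * pi ^ 2 * (exp (5 * u / 2) * exp (2 * u)) - 6 * n ^ 2 * pi * exp (5 * u / 2)) * exp (- (n ^ 2 * pi * exp (2 * u)))"
        by (simp add: algebra_simps eval_nat_numeral)
      also have "exp (5 * u / 2) * exp (2 * u) = exp (9 * u / 2)" by (simp add: exp_add[symmetric])
      finally show ?thesis by (simp add: xi_Phi_term_def n_def)
    qed
    show ?thesis
      using suminf_pos[of "\<lambda>k. xi_Phi_term k u"] xi_Phi_term_sums[of u] term_pos by (simp add: sums_iff)
  qed
  show ?thesis using pos[of u] pos[of "- u"] by (cases "u \<ge> 0") (auto simp: xi_Phi_even)
qed

lemma continuous_on_theta_deriv [continuous_intros]: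
  assumes "continuous_on A f" "\<And>x. x \<in> A \<Longrightarrow> f x > 0"
  shows "continuous_on A (\<lambda>x. theta_deriv k (f x))"
proof -
  have "continuous_on {0<..} (theta_deriv k)"
    by (intro continuous_at_imp_continuous_on ballI DERIV_isCont[OF has_derivative_theta_deriv]) auto
  then show ?thesis by (rule continuous_on_compose2[OF _ assms(1)]) (use assms(2) in auto)
qed

lemma continuous_on_xi_Phi: "continuous_on A xi_Phi"
  unfolding xi_Phi_theta[abs_def] by (intro continuous_intros) auto

section \<open>Mellin transform of Phi\<close>

text \<open>Up to the factor exp (u / 2), the n-th term of Phi is this function translated by ln
  n.\<close>

definition gauss_kernel :: "real \<Rightarrow> real" where
  "gauss_kernel v = (4 * (pi * exp (2 * v)) ^ 2 - 6 * (pi * exp (2 * v))) * exp (- (pi * exp (2 * v)))"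

text \<open>After the translation by ln n the index enters only through the translation and the
  factor n^(-(s + 1/2)). Integration over the line removes the former, and the Dirichlet series at s
  + 1/2 remains.\<close>

lemma xi_Phi_term_shift:
  "xi_Phi_term k u * exp (u * s) =
     real (Suc k) powr (- (s + 1/2)) * (gauss_kernel (ln (real (Suc k)) + u) * exp ((ln (real (Suc k)) + u) * (s + 1/2)))"
proof -
  define n where "n = real (Suc k)"
  have n: "n > 0" by (simp add: n_def)
  have X: "exp (2 * (ln n + u)) = n ^ 2 * exp (2 * u)"
  proof -
    have "exp (2 * (ln n + u)) = exp (ln n) ^ 2 * exp (2 * u)"
      by (simp add: exp_add[symmetric] exp_of_nat_mult[symmetric] power2_eq_square distrib_left)
    then show ?thesis using n by simp
  qed
  have "n powr (- (s + 1/2)) * exp ((ln n + u) * (s + 1/2)) = exp (u * s) * exp (u / 2)"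
    using n by (simp add: powr_def exp_add[symmetric] algebra_simps)
  then have "n powr (- (s + 1/2)) * (gauss_kernel (ln n + u) * exp ((ln n + u) * (s + 1/2)))
      = exp (u * s) * (exp (u / 2) * gauss_kernel (ln n + u))"
    by (simp add: mult_ac)
  also have "exp (u / 2) * gauss_kernel (ln n + u) = xi_Phi_term k u"
  proof -
    have "exp (9 * u / 2) = exp (u / 2) * (exp (2 * u)) ^ 2" "exp (5 * u / 2) = exp (u / 2) * exp (2 * u)"
      by (simp_all add: exp_add[symmetric] exp_of_nat_mult[symmetric] power2_eq_square)
    then show ?thesis unfolding gauss_kernel_def X xi_Phi_term_def n_def[symmetric]
      by (simp add: algebra_simps eval_nat_numeral)
  qed
  finally show ?thesis by (simp add: n_def mult.commute)
qed

text \<open>With x = pi e^(2v) the integral becomes pi^(-S/2) (2 Gamma (S/2 + 2) - 3 Gamma (S/2 +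
  1)), and 2 (S/2 + 1) - 3 = S - 1.\<close>

lemma gauss_kernel_mellin:
  assumes "S > 1"
  shows "integrable lborel (\<lambda>v. gauss_kernel v * exp (v * S))"
    and "integral\<^sup>L lborel (\<lambda>v. gauss_kernel v * exp (v * S)) = pi powr (- S / 2) * (S - 1) * Gamma (1 + S / 2)"
proof -
  define f where "f x = 2 * (x powr ((S / 2 + 2) - 1) / exp x) - 3 * (x powr ((S / 2 + 1) - 1) / exp x)" for x :: real
  define I where "I = (S - 1) * Gamma (1 + S / 2)"
  have G: "(\<lambda>x. x powr (a - 1) / exp x) absolutely_integrable_on {0<..} \<and>
           integral {0<..} (\<lambda>x. x powr (a - 1) / exp x) = Gamma a" if "a > 0" for a :: real
  proof -
    have "((\<lambda>x. x powr (a - 1) / exp x) has_integral Gamma a) {0<..}"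
    proof -
      have "((\<lambda>x. if x \<in> {0<..} then x powr (a - 1) / exp x else 0) has_integral Gamma a) {0..}"
        by (rule has_integral_spike[OF negligible_sing[of 0] _ Gamma_integral_real[OF that]]) auto
      then show ?thesis by (subst (asm) has_integral_restrict) auto
    qed
    then show ?thesis
      by (auto intro!: nonnegative_absolutely_integrable_1 simp: has_integral_iff)
  qed
  have fint: "f absolutely_integrable_on {0<..}" "integral {0<..} f = I"
  proof -
    have G1: "(\<lambda>x. x powr ((S / 2 + 2) - 1) / exp x) absolutely_integrable_on {0<..}"
        "integral {0<..} (\<lambda>x. x powr ((S / 2 + 2) - 1) / exp x) = Gamma (S / 2 + 2)"
      and G2: "(\<lambda>x. x powr ((S / 2 + 1) - 1) / exp x) absolutely_integrable_on {0<..}"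
        "integral {0<..} (\<lambda>x. x powr ((S / 2 + 1) - 1) / exp x) = Gamma (S / 2 + 1)"
      using G[of "S / 2 + 2"] G[of "S / 2 + 1"] assms by auto
    define p1 p2 where "p1 x = x powr ((S / 2 + 2) - 1) / exp x"
      and "p2 x = x powr ((S / 2 + 1) - 1) / exp x" for x :: real
    have f: "f = (\<lambda>x. 2 * p1 x - 3 * p2 x)" by (simp add: f_def p1_def p2_def fun_eq_iff)
    have ai: "(\<lambda>x. 2 * p1 x) absolutely_integrable_on {0<..}" "(\<lambda>x. 3 * p2 x) absolutely_integrable_on {0<..}"
      unfolding p1_def p2_def
      by (rule set_integrable_mult_right[OF G1(1)], rule set_integrable_mult_right[OF G2(1)])
    show "f absolutely_integrable_on {0<..}" unfolding f
      by (intro set_integral_diff ai)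
    have "integral {0<..} f = integral {0<..} (\<lambda>x. 2 * p1 x) - integral {0<..} (\<lambda>x. 3 * p2 x)"
      unfolding f by (intro integral_diff set_lebesgue_integral_eq_integral(1) ai)
    also have "\<dots> = 2 * Gamma (S / 2 + 2) - 3 * Gamma (S / 2 + 1)"
      unfolding integral_mult_right using G1(2) G2(2) by (simp only: p1_def p2_def)
    also have "Gamma (S / 2 + 2) = (S / 2 + 1) * Gamma (S / 2 + 1)"
    proof -
      have "S / 2 + 1 \<notin> \<int>\<^sub>\<le>\<^sub>0" using nonpos_Ints_nonpos[of "S / 2 + 1"] assms by auto
      from Gamma_plus1[OF this] show ?thesis by (simp add: add.assoc)
    qed
    finally show "integral {0<..} f = I" by (simp add: I_def algebra_simps)
  qed
  define g where "g v = pi * exp (2 * v)" for v :: real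
  have img: "g ` UNIV = {0<..}"
  proof -
    have "x \<in> g ` UNIV" if "x > 0" for x
    proof -
      have "g (ln (x / pi) / 2) = x" using that by (simp add: g_def)
      then show ?thesis by (metis UNIV_I image_eqI)
    qed
    then show ?thesis by (auto simp: g_def)
  qed
  have cov: "(\<lambda>v. \<bar>2 * g v\<bar> * f (g v)) absolutely_integrable_on UNIV \<and> integral UNIV (\<lambda>v. \<bar>2 * g v\<bar> * f (g v)) = I"
  proof (rule has_absolute_integral_change_of_variables_1'[where S = UNIV and g = g and f = f, THEN iffD2])
    show "(g has_real_derivative 2 * g x) (at x within UNIV)" for x
      unfolding g_def by (auto intro!: derivative_eq_intros)
    show "inj_on g UNIV" by (auto simp: inj_on_def g_def)
    show "f absolutely_integrable_on g ` UNIV \<and> integral (g ` UNIV) f = I"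
      unfolding img using fint by simp
  qed auto
  have eq: "gauss_kernel v * exp (v * S) = pi powr (- S / 2) * (\<bar>2 * g v\<bar> * f (g v))" for v
  proof -
    have gp: "g v > 0" by (simp add: g_def)
    have p: "g v powr (S / 2) = pi powr (S / 2) * exp (v * S)"
      by (simp add: g_def powr_mult powr_def[of "exp _"] mult_ac)
    have p1: "g v powr (S / 2 + 1) = g v * g v powr (S / 2)"
      using gp by (simp add: powr_add)
    have "f (g v) = g v powr (S / 2) * (2 * g v - 3) * exp (- g v)"
      unfolding f_def using gp p1 by (simp add: exp_minus field_simps)
    then have "\<bar>2 * g v\<bar> * f (g v) = pi powr (S / 2) * (exp (v * S) * (2 * g v * (2 * g v - 3)) * exp (- g v))"
      unfolding p using gp by simp
    then have "pi powr (- S / 2) * (\<bar>2 * g v\<bar> * f (g v))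
        = (pi powr (- S / 2) * pi powr (S / 2)) * (exp (v * S) * (2 * g v * (2 * g v - 3)) * exp (- g v))"
      by (simp only: mult.assoc)
    also have "pi powr (- S / 2) * pi powr (S / 2) = 1"
      by (simp add: powr_add[symmetric])
    finally have "pi powr (- S / 2) * (\<bar>2 * g v\<bar> * f (g v)) = exp (v * S) * (2 * g v * (2 * g v - 3)) * exp (- g v)"
      by (simp only: mult_1_left)
    moreover have gk: "gauss_kernel v = (4 * g v ^ 2 - 6 * g v) * exp (- g v)"
      by (simp add: gauss_kernel_def g_def)
    have "gauss_kernel v * exp (v * S) = exp (v * S) * (2 * g v * (2 * g v - 3)) * exp (- g v)"
      unfolding gk by (simp add: algebra_simps power2_eq_square)
    ultimately show ?thesis by simp
  qed
  have meas: "(\<lambda>v. gauss_kernel v * exp (v * S)) \<in> borel_measurable lborel"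
    unfolding gauss_kernel_def by measurable
  have ai: "(\<lambda>v. gauss_kernel v * exp (v * S)) absolutely_integrable_on UNIV"
    "integral UNIV (\<lambda>v. gauss_kernel v * exp (v * S)) = pi powr (- S / 2) * I"
    unfolding eq using cov by (auto intro!: set_integrable_mult_right)
  then have "integrable lebesgue (\<lambda>v. gauss_kernel v * exp (v * S))"
    by (simp add: set_integrable_def)
  then show "integrable lborel (\<lambda>v. gauss_kernel v * exp (v * S))"
    using integrable_completion[OF meas] by simp
  have "integral\<^sup>L lborel (\<lambda>v. gauss_kernel v * exp (v * S)) = integral\<^sup>L lebesgue (\<lambda>v. gauss_kernel v * exp (v * S))"
    by (rule integral_completion[OF meas, symmetric])
  also have "\<dots> = integral UNIV (\<lambda>v. gauss_kernel v * exp (v * S))"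
    using set_lebesgue_integral_eq_integral(2)[OF ai(1)] by (simp add: set_lebesgue_integral_def)
  finally show "integral\<^sup>L lborel (\<lambda>v. gauss_kernel v * exp (v * S)) = pi powr (- S / 2) * (S - 1) * Gamma (1 + S / 2)"
    using ai(2) by (simp add: I_def)
qed

lemma summable_Suc_powr:
  assumes "S > 1"
  shows "summable (\<lambda>k. real (Suc k) powr (- S))"
  using assms summable_real_powr_iff[of "- S"] summable_Suc_iff[of "\<lambda>k. real k powr (- S)"] by simp

text \<open>All terms come from translates of one integrable function, so their L1 norms are a
  constant times n^(-(s + 1/2)). These are summable for s > 1/2, which justifies integrating term by
  term.\<close>

lemma xi_Phi_laplace:
  assumes "s > 1 / 2"
  shows "integrable lborel (\<lambda>u. xi_Phi u * exp (u * s))"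
    and "integral\<^sup>L lborel (\<lambda>u. xi_Phi u * exp (u * s)) =
       pi powr (- (s + 1/2) / 2) * (s - 1/2) * Gamma (1 + (s + 1/2) / 2) * (\<Sum>k. real (Suc k) powr (- (s + 1/2)))"
proof -
  define S where "S = s + 1/2"
  have S: "S > 1" using assms by (simp add: S_def)
  define h where "h v = gauss_kernel v * exp (v * S)" for v
  define A where "A = pi powr (- S / 2) * (S - 1) * Gamma (1 + S / 2)"
  have h: "integrable lborel h" "integral\<^sup>L lborel h = A"
    using gauss_kernel_mellin[OF S] by (auto simp: h_def[abs_def] A_def)
  have shift: "integrable lborel (\<lambda>u. F (t + u))" "integral\<^sup>L lborel (\<lambda>u. F (t + u)) = integral\<^sup>L lborel F"
    if "integrable lborel F" for F :: "real \<Rightarrow> real" and t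
    using lborel_integrable_real_affine[OF that, of 1 t] lborel_integral_real_affine[of 1 F t] by simp_all
  define T where "T k u = xi_Phi_term k u * exp (u * s)" for k u
  have T: "T k = (\<lambda>u. real (Suc k) powr (- S) * h (ln (real (Suc k)) + u))" for k
    unfolding T_def xi_Phi_term_shift S_def h_def ..
  have Tint: "integrable lborel (T k)" for k
    unfolding T using h shift by (intro integrable_mult_right) auto
  have TI: "integral\<^sup>L lborel (T k) = real (Suc k) powr (- S) * A" for k
    unfolding T using shift(2)[OF h(1)] h(2) by simp
  have Tn: "(\<integral>u. norm (T k u) \<partial>lborel) = real (Suc k) powr (- S) * (\<integral>u. norm (h u) \<partial>lborel)" for k
    unfolding T norm_mult using shift(2)[OF integrable_norm[OF h(1)], of "ln (real (Suc k))"] by simp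
  have ptw: "summable (\<lambda>k. norm (T k u))" for u
  proof (rule summable_comparison_test')
    let ?e = "\<lambda>k p. (pi * real (Suc k) ^ 2) ^ p * exp (- pi * real (Suc k) ^ 2 * exp (2 * u))"
    show "summable (\<lambda>k. (4 * exp (9 * u / 2) * ?e k 2 + 6 * exp (5 * u / 2) * ?e k 1) * exp (u * s))"
      by (intro summable_mult2 summable_add summable_mult summable_theta_bound) auto
    fix k
    have "\<bar>xi_Phi_term k u\<bar> \<le> 4 * exp (9 * u / 2) * ?e k 2 + 6 * exp (5 * u / 2) * ?e k 1"
      unfolding xi_Phi_term_eq by (rule order_trans[OF abs_triangle_ineq]) (simp add: abs_mult)
    then show "norm (norm (T k u)) \<le> (4 * exp (9 * u / 2) * ?e k 2 + 6 * exp (5 * u / 2) * ?e k 1) * exp (u * s)"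
      unfolding T_def by (simp add: abs_mult del: power_one_right)
  qed
  have sumn: "summable (\<lambda>k. \<integral>u. norm (T k u) \<partial>lborel)"
    unfolding Tn by (intro summable_mult2 summable_Suc_powr S)
  have sumT: "(\<Sum>k. T k u) = xi_Phi u * exp (u * s)" for u
    unfolding T_def using xi_Phi_term_sums[of u] by (simp add: sums_iff suminf_mult2[symmetric])
  show "integrable lborel (\<lambda>u. xi_Phi u * exp (u * s))"
    using integrable_suminf[of lborel T, OF Tint _ sumn] ptw by (simp add: sumT)
  have "integral\<^sup>L lborel (\<lambda>u. xi_Phi u * exp (u * s)) = (\<Sum>k. integral\<^sup>L lborel (T k))"
    using integral_suminf[of lborel T, OF Tint _ sumn] ptw by (simp add: sumT)
  also have "\<dots> = A * (\<Sum>k. real (Suc k) powr (- S))"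
    unfolding TI using suminf_mult2[OF summable_Suc_powr[OF S], of A] by (simp only: mult.commute)
  finally show "integral\<^sup>L lborel (\<lambda>u. xi_Phi u * exp (u * s)) =
       pi powr (- (s + 1/2) / 2) * (s - 1/2) * Gamma (1 + (s + 1/2) / 2) * (\<Sum>k. real (Suc k) powr (- (s + 1/2)))"
    by (simp add: A_def S_def)
qed

lemma lborel_integral_uminus:
  fixes f :: "real \<Rightarrow> real"
  shows "integral\<^sup>L lborel (\<lambda>u. f (- u)) = integral\<^sup>L lborel f"
    and "integrable lborel f \<Longrightarrow> integrable lborel (\<lambda>u. f (- u))"
  using lborel_integral_real_affine[of "-1" f 0] lborel_integrable_real_affine[of f "-1" 0] by simp_all

lemma lborel_integral_even:
  fixes f :: "real \<Rightarrow> real"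
  assumes f: "integrable lborel f" and even: "\<And>u. f (- u) = f u"
  shows "integral\<^sup>L lborel f = 2 * (LBINT u:{0..}. f u)"
proof -
  have i: "set_integrable lborel A f" if "A \<in> sets borel" for A
    unfolding set_integrable_def using f that by (intro integrable_mult_indicator) auto
  have "integral\<^sup>L lborel f = (LBINT u:{0..} \<union> {..<0}. f u)"
    unfolding set_lebesgue_integral_def by (intro Bochner_Integration.integral_cong) (auto simp: indicator_def)
  also have "\<dots> = (LBINT u:{0..}. f u) + (LBINT u:{..<0}. f u)"
    by (rule set_integral_Un) (auto intro: i)
  also have "(LBINT u:{..<0}. f u) = (LBINT u:{0<..}. f u)"
    unfolding set_lebesgue_integral_def
    by (subst lborel_integral_uminus(1)[symmetric]) (auto intro!: Bochner_Integration.integral_cong simp: indicator_def even)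
  also have "(LBINT u:{0<..}. f u) = (LBINT u:{0..}. f u)"
    unfolding set_lebesgue_integral_def
  proof (rule integral_cong_AE)
    show "AE x in lborel. indicator {0<..} x *\<^sub>R f x = indicator {0..} x *\<^sub>R f x"
      using AE_lborel_singleton[of 0] by eventually_elim (auto simp: indicator_def)
  qed (use f in measurable)
  finally show ?thesis by simp
qed

lemma cosh_even_sums: "(\<lambda>n. x ^ (2 * n) / fact (2 * n)) sums cosh (x::real)"
proof -
  have "(\<lambda>n. if even n then x ^ n /\<^sub>R fact n else 0) sums cosh x" by (rule cosh_converges)
  then have "(\<lambda>n. (\<lambda>n. if even n then x ^ n /\<^sub>R fact n else 0) (2 * n)) sums cosh x"
    by (subst sums_mono_reindex) (auto simp: strict_mono_def elim!: evenE)
  then show ?thesis by (simp add: divide_inverse mult.commute)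
qed

lemma xi_Phi_measurable [measurable]: "xi_Phi \<in> borel_measurable borel"
  by (intro borel_measurable_continuous_onI continuous_on_xi_Phi)

text \<open>Evenness of Phi allows averaging exp (u s) with exp (- u s). The gain is a power series
  in u whose terms are all nonnegative.\<close>

lemma xi_Phi_cosh:
  assumes "s > 1 / 2"
  shows "integrable lborel (\<lambda>u. xi_Phi u * cosh (u * s))"
    and "integral\<^sup>L lborel (\<lambda>u. xi_Phi u * cosh (u * s)) = integral\<^sup>L lborel (\<lambda>u. xi_Phi u * exp (u * s))"
proof -
  define p where "p u = xi_Phi u * exp (u * s)" for u
  have p: "integrable lborel p" using xi_Phi_laplace(1)[OF assms] by (simp add: p_def[abs_def])
  have eq: "(\<lambda>u. xi_Phi u * cosh (u * s)) = (\<lambda>u. (p u + p (- u)) / 2)"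
    by (auto simp: fun_eq_iff p_def cosh_def xi_Phi_even algebra_simps)
  show "integrable lborel (\<lambda>u. xi_Phi u * cosh (u * s))"
    unfolding eq using p lborel_integral_uminus(2)[OF p] by auto
  show "integral\<^sup>L lborel (\<lambda>u. xi_Phi u * cosh (u * s)) = integral\<^sup>L lborel (\<lambda>u. xi_Phi u * exp (u * s))"
    unfolding eq using p lborel_integral_uminus[of p] by (simp add: p_def[symmetric])
qed

lemma xi_Phi_moment_integrable: "integrable lborel (\<lambda>u. xi_Phi u * u ^ (2 * n))"
proof (rule Bochner_Integration.integrable_bound)
  show "integrable lborel (\<lambda>u. fact (2 * n) * (xi_Phi u * cosh (u * 1)))"
    using xi_Phi_cosh(1)[of 1] by simp
  show "AE u in lborel. norm (xi_Phi u * u ^ (2 * n)) \<le> norm (fact (2 * n) * (xi_Phi u * cosh (u * 1)))"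
  proof (intro always_eventually allI)
    fix u :: real
    have "u ^ (2 * n) / fact (2 * n) \<le> cosh u"
      using sum_le_suminf[of "\<lambda>n. u ^ (2 * n) / fact (2 * n)" "{n}"] cosh_even_sums[of u] by (simp add: sums_iff)
    then have "u ^ (2 * n) \<le> fact (2 * n) * cosh u" by (simp add: field_simps)
    then have "xi_Phi u * u ^ (2 * n) \<le> xi_Phi u * (fact (2 * n) * cosh u)"
      using xi_Phi_pos[of u] by (intro mult_left_mono) auto
    then show "norm (xi_Phi u * u ^ (2 * n)) \<le> norm (fact (2 * n) * (xi_Phi u * cosh (u * 1)))"
      using xi_Phi_pos[of u] by (simp add: abs_mult power_mult mult_ac)
  qed
qed measurable

lemma xi_coeff_eq: "xi_coeff n = integral\<^sup>L lborel (\<lambda>u. xi_Phi u * u ^ (2 * n)) / fact (2 * n)"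
  using lborel_integral_even[OF xi_Phi_moment_integrable[of n]] by (simp add: xi_coeff_def xi_Phi_even)

lemma xi_coeff_pos: "xi_coeff n > 0"
proof -
  have nn: "0 \<le> xi_Phi u * u ^ (2 * n)" for u using xi_Phi_pos[of u] by simp
  have "integral\<^sup>L lborel (\<lambda>u. xi_Phi u * u ^ (2 * n)) \<noteq> 0"
  proof
    assume "integral\<^sup>L lborel (\<lambda>u. xi_Phi u * u ^ (2 * n)) = 0"
    then have "AE u in lborel. xi_Phi u * u ^ (2 * n) = 0"
      using integral_nonneg_eq_0_iff_AE[OF xi_Phi_moment_integrable[of n]] nn by simp
    \<comment> \<open>The interval avoids 0, the only point where the integrand can vanish, and has
      positive measure.\<close>
    then have ae: "AE u in lborel. u \<notin> {1..2::real}"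
    proof eventually_elim
      case (elim u)
      have "xi_Phi u \<noteq> 0" using xi_Phi_pos[of u] by simp
      then have "u = 0" using elim by auto
      then show ?case by simp
    qed
    have "emeasure lborel {1..2::real} = 0"
    proof (rule AE_iff_measurable[THEN iffD1, OF _ _ ae])
      show "{u \<in> space lborel. \<not> u \<notin> {1..2::real}} = {1..2}" by auto
    qed simp
    then show False by simp
  qed
  moreover have "integral\<^sup>L lborel (\<lambda>u. xi_Phi u * u ^ (2 * n)) \<ge> 0" using nn by simp
  ultimately show ?thesis unfolding xi_coeff_eq by simp
qed

text \<open>The cosh series is integrated term by term. Its terms are nonnegative, so the partial
  sums of their integrals are bounded by the integral of the limit, which is finite.\<close>

lemma xi_coeff_sums_real:
  assumes "s > 1 / 2"
  shows "(\<lambda>n. xi_coeff n * s ^ (2 * n)) sums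
     (pi powr (- (s + 1/2) / 2) * (s - 1/2) * Gamma (1 + (s + 1/2) / 2) * (\<Sum>k. real (Suc k) powr (- (s + 1/2))))"
proof -
  define T where "T n u = xi_Phi u * u ^ (2 * n) * (s ^ (2 * n) / fact (2 * n))" for n u
  have Tint: "integrable lborel (T n)" for n
    unfolding T_def by (intro integrable_mult_left xi_Phi_moment_integrable)
  have T0: "0 \<le> T n u" for n u using xi_Phi_pos[of u] by (simp add: T_def)
  have Ts: "(\<lambda>n. T n u) sums (xi_Phi u * cosh (u * s))" for u
    using sums_mult[OF cosh_even_sums[of "u * s"], of "xi_Phi u"]
    by (simp add: T_def[abs_def] power_mult_distrib mult_ac)
  have TI: "integral\<^sup>L lborel (T n) = xi_coeff n * s ^ (2 * n)" for n
    unfolding T_def xi_coeff_eq by simp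
  have sumn: "summable (\<lambda>n. \<integral>u. norm (T n u) \<partial>lborel)"
  proof (rule bounded_imp_summable)
    show "(\<integral>u. norm (T n u) \<partial>lborel) \<ge> 0" for n by simp
    show "(\<Sum>n\<le>N. \<integral>u. norm (T n u) \<partial>lborel) \<le> integral\<^sup>L lborel (\<lambda>u. xi_Phi u * cosh (u * s))" for N
    proof -
      have "(\<Sum>n\<le>N. \<integral>u. norm (T n u) \<partial>lborel) = (\<integral>u. (\<Sum>n\<le>N. T n u) \<partial>lborel)"
        using T0 Tint by (subst Bochner_Integration.integral_sum) auto
      also have "\<dots> \<le> integral\<^sup>L lborel (\<lambda>u. xi_Phi u * cosh (u * s))"
      proof (rule integral_mono)
        show "(\<Sum>n\<le>N. T n u) \<le> xi_Phi u * cosh (u * s)" for u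
          using sum_le_suminf[of "\<lambda>n. T n u" "{..N}"] T0 Ts[of u] by (simp add: sums_iff)
      qed (use Tint xi_Phi_cosh(1)[OF assms] in auto)
      finally show ?thesis .
    qed
  qed
  have "(\<lambda>n. integral\<^sup>L lborel (T n)) sums (\<integral>u. (\<Sum>n. T n u) \<partial>lborel)"
    using Ts T0 by (intro sums_integral Tint sumn) (auto simp: sums_iff)
  also have "(\<lambda>u. \<Sum>n. T n u) = (\<lambda>u. xi_Phi u * cosh (u * s))" using Ts by (auto simp: sums_iff fun_eq_iff)
  finally show ?thesis
    unfolding TI using xi_Phi_cosh(2)[OF assms] xi_Phi_laplace(2)[OF assms] by simp
qed

section \<open>Zeta and xi\<close>

text \<open>The \<open>F\<close> of the overview.\<close>

definition xi_series :: "complex \<Rightarrow> complex" where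
  "xi_series z = (\<Sum>n. of_real (xi_coeff n) * z ^ n)"

lemma summable_xi_coeff_real:
  assumes "r \<ge> 0"
  shows "summable (\<lambda>n. xi_coeff n * r ^ n)"
proof -
  \<comment> \<open>The point sqrt r + 1 exceeds 1/2, so the expansion is available there, and its
    square dominates r.\<close>
  have "summable (\<lambda>n. xi_coeff n * (sqrt r + 1) ^ (2 * n))"
    using xi_coeff_sums_real[of "sqrt r + 1"] assms by (simp add: sums_iff add_strict_increasing2)
  then show ?thesis
  proof (rule summable_comparison_test'[where N = 0])
    fix n
    have "r = sqrt r ^ 2" using assms by simp
    also have "\<dots> \<le> (sqrt r + 1) ^ 2" using assms by (intro power_mono) auto
    finally have "r ^ n \<le> ((sqrt r + 1) ^ 2) ^ n" using assms by (intro power_mono) auto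
    then show "norm (xi_coeff n * r ^ n) \<le> xi_coeff n * (sqrt r + 1) ^ (2 * n)"
      using xi_coeff_pos[of n] assms by (simp add: abs_mult power_mult)
  qed
qed

lemma summable_norm_xi_series: "summable (\<lambda>n. norm (of_real (xi_coeff n) * z ^ n :: complex))"
  using summable_xi_coeff_real[of "norm z"] xi_coeff_pos by (simp add: norm_mult norm_power less_imp_le)

lemma xi_series_sums: "(\<lambda>n. of_real (xi_coeff n) * z ^ n) sums xi_series z"
  unfolding xi_series_def by (rule summable_sums[OF summable_norm_cancel[OF summable_norm_xi_series]])

lemma xi_series_of_real:
  assumes "r \<ge> 0"
  shows "xi_series (of_real r) = of_real (\<Sum>n. xi_coeff n * r ^ n)"
proof -
  have "(\<lambda>n. of_real (xi_coeff n * r ^ n)) sums (of_real (\<Sum>n. xi_coeff n * r ^ n) :: complex)"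
    by (intro sums_of_real summable_sums summable_xi_coeff_real assms)
  then show ?thesis using xi_series_sums[of "of_real r"] by (simp add: sums_iff)
qed

lemma xi_series_expansion: "xi_series has_fps_expansion Abs_fps (\<lambda>n. of_real (xi_coeff n))"
  by (rule has_fps_expansionI) (use xi_series_sums in \<open>auto intro!: always_eventually\<close>)

lemma xi_series_holomorphic [holomorphic_intros]:
  assumes "f holomorphic_on A"
  shows "(\<lambda>z. xi_series (f z)) holomorphic_on A"
proof -
  have "xi_series holomorphic_on ball 0 r" for r
    by (rule power_series_holomorphic[where a = "\<lambda>n. of_real (xi_coeff n)"]) (use xi_series_sums in auto)
  then have "xi_series holomorphic_on (\<Union>r\<in>UNIV. ball 0 r)"
    by (intro holomorphic_on_UN_open) auto
  moreover have "(\<Union>r\<in>UNIV. ball (0::complex) r) = UNIV"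
    using gt_ex by (auto simp: set_eq_iff)
  ultimately have "xi_series holomorphic_on UNIV" by simp
  from holomorphic_on_compose_gen[OF assms this] show ?thesis by (simp add: o_def)
qed

lemma xi_series_0: "xi_series 0 = of_real (xi_coeff 0)"
  by (rule sums_unique2[OF xi_series_sums powser_sums_zero])

lemma norm_xi_series_le: "norm (xi_series z) \<le> (\<Sum>n. xi_coeff n * norm z ^ n)"
proof -
  have "norm (xi_series z) \<le> (\<Sum>n. norm (of_real (xi_coeff n) * z ^ n))"
    unfolding xi_series_def by (rule summable_norm[OF summable_norm_xi_series])
  also have "\<dots> = (\<Sum>n. xi_coeff n * norm z ^ n)"
    using xi_coeff_pos by (simp add: norm_mult norm_power less_imp_le)
  finally show ?thesis .
qed

lemma xi_series_square_real:
  assumes "x > 1"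
  shows "(\<Sum>n. xi_coeff n * ((x - 1 / 2) ^ 2) ^ n) =
    pi powr (- x / 2) * (x - 1) * Gamma (1 + x / 2) * (\<Sum>k. real (Suc k) powr (- x))"
  using xi_coeff_sums_real[of "x - 1/2"] assms by (simp add: sums_iff power_mult)

section \<open>Zeta beyond its half-plane of convergence\<close>

definition dirichlet_zeta :: "complex \<Rightarrow> complex" where
  "dirichlet_zeta s = (\<Sum>n. 1 / of_nat (Suc n) powr s)"

lemma norm_dirichlet_term: "norm (1 / of_nat (Suc n) powr s) = real (Suc n) powr (- Re s)"
  using norm_powr_real_powr[of "of_nat (Suc n)" s]
  by (simp add: norm_divide norm_inverse powr_minus divide_inverse del: of_nat_Suc)

lemma dirichlet_zeta_sums:
  assumes "Re s > 1"
  shows "(\<lambda>n. 1 / of_nat (Suc n) powr s) sums dirichlet_zeta s"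
  unfolding dirichlet_zeta_def
  by (intro summable_sums summable_norm_cancel[where f = "\<lambda>n. 1 / of_nat (Suc n) powr s"])
     (simp only: norm_dirichlet_term summable_Suc_powr[OF assms])

lemma dirichlet_zeta_holomorphic: "dirichlet_zeta holomorphic_on {s. Re s > 1}"
proof (rule holomorphic_uniform_sequence)
  show "open {s. Re s > 1}" by (rule open_halfspace_Re_gt)
  show "(\<lambda>s. \<Sum>i<n. 1 / of_nat (Suc i) powr s) holomorphic_on {s. Re s > 1}" for n
    by (intro holomorphic_intros) auto
  fix s assume "s \<in> {s. Re s > 1}"
  then have s: "Re s > 1" by simp
  define d where "d = (Re s - 1) / 2"
  have d: "d > 0" using s by (simp add: d_def)
  have re: "Re w \<ge> 1 + d" if "w \<in> cball s d" for w
  proof -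
    have "\<bar>Re s - Re w\<bar> \<le> d" using abs_Re_le_cmod[of "s - w"] that by (simp add: dist_norm)
    then have "Re s - Re w \<le> d" by linarith
    moreover have "Re s = 1 + 2 * d" by (simp add: d_def field_simps)
    ultimately show ?thesis by linarith
  qed
  show "\<exists>d>0. cball s d \<subseteq> {s. Re s > 1} \<and>
      uniform_limit (cball s d) (\<lambda>n s. \<Sum>i<n. 1 / of_nat (Suc i) powr s) dirichlet_zeta sequentially"
  proof (intro exI conjI)
    show "cball s d \<subseteq> {s. Re s > 1}" using re d by fastforce
    show "uniform_limit (cball s d) (\<lambda>n s. \<Sum>i<n. 1 / of_nat (Suc i) powr s) dirichlet_zeta sequentially"
      unfolding dirichlet_zeta_def
    proof (rule Weierstrass_m_test)
      show "norm (1 / of_nat (Suc n) powr w) \<le> real (Suc n) powr (- (1 + d))" if "w \<in> cball s d" for n w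
        unfolding norm_dirichlet_term using re[OF that] by (intro powr_mono) auto
      show "summable (\<lambda>n. real (Suc n) powr (- (1 + d)))"
        by (rule summable_Suc_powr) (use d in simp)
    qed
  qed (rule d)
qed

lemma dirichlet_zeta_of_real:
  assumes "x > 1"
  shows "dirichlet_zeta (of_real x) = of_real (\<Sum>k. real (Suc k) powr (- x))"
proof -
  have "(\<lambda>n. of_real (real (Suc n) powr (- x))) sums (of_real (\<Sum>k. real (Suc k) powr (- x)) :: complex)"
    by (intro sums_of_real summable_sums summable_Suc_powr assms)
  moreover have "of_real (real (Suc n) powr (- x)) = 1 / of_nat (Suc n) powr (of_real x :: complex)" for n
    using powr_of_real[of "real (Suc n)" x] by (simp add: powr_minus divide_inverse)
  ultimately show ?thesis using dirichlet_zeta_sums[of "of_real x"] assms by (simp add: sums_iff)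
qed

text \<open>The defining formula of xi solved for zeta. Writing 1 / Gamma as the entire function
  \<open>rGamma\<close> leaves s = 1 as the only singularity; the value 0 there matches the
  normalisation in \<open>riemann_zeta\<close>.\<close>

definition zeta_continuation :: "complex \<Rightarrow> complex" where
  "zeta_continuation s =
     (if s = 1 then 0 else xi_series ((s - 1 / 2) ^ 2) * of_real pi powr (s / 2) * rGamma (1 + s / 2) / (s - 1))"

lemma zeta_continuation_holomorphic: "zeta_continuation holomorphic_on - {1}"
proof -
  have "(\<lambda>s. xi_series ((s - 1 / 2) ^ 2) * of_real pi powr (s / 2) * rGamma (1 + s / 2) / (s - 1)) holomorphic_on - {1}"
    by (intro holomorphic_intros) auto
  then show ?thesis by (rule holomorphic_transform) (auto simp: zeta_continuation_def)
qed

lemma zeta_continuation_of_real: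
  assumes "x > 1"
  shows "zeta_continuation (of_real x) = dirichlet_zeta (of_real x)"
proof -
  have "zeta_continuation (of_real x) =
      xi_series (of_real ((x - 1 / 2) ^ 2)) * of_real (pi powr (x / 2)) * of_real (rGamma (1 + x / 2)) / of_real (x - 1)"
  proof -
    have "complex_of_real pi powr (of_real x / 2) = of_real (pi powr (x / 2))"
      using powr_of_real[of pi "x / 2"] by simp
    moreover have "rGamma (1 + complex_of_real x / 2) = of_real (rGamma (1 + x / 2))"
      using rGamma_complex_of_real[of "1 + x / 2"] by simp
    ultimately show ?thesis using assms by (simp add: zeta_continuation_def)
  qed
  also have "\<dots> = of_real ((pi powr (- x / 2) * (x - 1) * Gamma (1 + x / 2) * (\<Sum>k. real (Suc k) powr (- x)))
      * pi powr (x / 2) * rGamma (1 + x / 2) / (x - 1))"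
    by (subst xi_series_of_real) (simp_all add: xi_series_square_real[OF assms])
  also have "(pi powr (- x / 2) * (x - 1) * Gamma (1 + x / 2) * (\<Sum>k. real (Suc k) powr (- x)))
      * pi powr (x / 2) * rGamma (1 + x / 2) / (x - 1) =
      (pi powr (- x / 2) * pi powr (x / 2)) * (Gamma (1 + x / 2) * rGamma (1 + x / 2)) * (\<Sum>k. real (Suc k) powr (- x))"
    using assms by (simp add: mult_ac)
  also have "pi powr (- x / 2) * pi powr (x / 2) = 1" by (simp add: powr_add[symmetric])
  also have "Gamma (1 + x / 2) * rGamma (1 + x / 2) = 1"
    using assms Gamma_real_pos[of "1 + x / 2"] by (simp add: rGamma_inverse_Gamma less_imp_neq[symmetric])
  finally show ?thesis using dirichlet_zeta_of_real[OF assms] by simp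
qed

text \<open>The integral computation covers real s > 1. The identity theorem extends it to the
  half-plane, because the real ray accumulates at the interior point 2.\<close>

lemma zeta_continuation_eq_dirichlet:
  assumes "Re s > 1"
  shows "zeta_continuation s = dirichlet_zeta s"
proof -
  let ?S = "{s. Re s > 1}" and ?U = "{s. \<exists>x>1. s = complex_of_real x}"
  have "zeta_continuation s - dirichlet_zeta s = 0"
  proof (rule analytic_continuation[where S = ?S and U = ?U and \<xi> = 2
        and f = "\<lambda>s. zeta_continuation s - dirichlet_zeta s"])
    show "(\<lambda>s. zeta_continuation s - dirichlet_zeta s) holomorphic_on ?S"
      by (intro holomorphic_intros dirichlet_zeta_holomorphic holomorphic_on_subset[OF zeta_continuation_holomorphic]) auto
    show "connected ?S" by (intro convex_connected convex_halfspace_Re_gt)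
    show "2 islimpt ?U" unfolding islimpt_approachable
    proof (intro allI impI)
      fix e :: real assume e: "e > 0"
      have "dist (complex_of_real (2 + e / 2)) 2 < e"
        using e by (simp add: dist_norm)
      then show "\<exists>x'\<in>?U. x' \<noteq> 2 \<and> dist x' 2 < e"
        using e by (intro bexI[of _ "complex_of_real (2 + e / 2)"]) (auto simp: complex_eq_iff intro!: exI[of _ "2 + e / 2"])
    qed
  qed (use assms zeta_continuation_of_real in \<open>auto simp: open_halfspace_Re_gt\<close>)
  then show ?thesis by simp
qed

lemma riemann_zeta_eq: "riemann_zeta = zeta_continuation"
  unfolding riemann_zeta_def
proof (rule the_equality)
  show "zeta_continuation holomorphic_on - {1} \<and> zeta_continuation 1 = 0 \<and>
     (\<forall>s. Re s > 1 \<longrightarrow> (\<lambda>n. 1 / (of_nat (Suc n) powr s)) sums zeta_continuation s)"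
    using zeta_continuation_holomorphic zeta_continuation_eq_dirichlet dirichlet_zeta_sums
    by (auto simp: zeta_continuation_def[of 1] simp del: of_nat_Suc)
next
  fix f
  assume f: "f holomorphic_on - {1} \<and> f 1 = 0 \<and>
     (\<forall>s. Re s > 1 \<longrightarrow> (\<lambda>n. 1 / (of_nat (Suc n) powr s)) sums f s)"
  show "f = zeta_continuation"
  proof
    fix s
    show "f s = zeta_continuation s"
    proof (cases "s = 1")
      case False
      show ?thesis
      proof (rule analytic_continuation_open[where s = "{s. Re s > 1}" and s' = "- {1}"
            and f = f and g = zeta_continuation and z = s])
        show "connected (- {1::complex})" by (rule connected_punctured_universe) simp
        show "{s. Re s > 1} \<noteq> {}" by (auto intro!: exI[of _ 2])
        show "f w = zeta_continuation w" if "w \<in> {s. Re s > 1}" for w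
          using that f dirichlet_zeta_sums[of w] zeta_continuation_eq_dirichlet[of w] sums_unique2 by fastforce
      qed (use f False zeta_continuation_holomorphic in \<open>auto simp: open_halfspace_Re_gt\<close>)
    qed (use f in \<open>simp add: zeta_continuation_def\<close>)
  qed
qed

text \<open>The literal product agrees with the entire function off the zeros of
  \<open>rGamma (1 + w / 2) * (w - 1)\<close>. That function is nonzero at w = 0, so its zeros are
  isolated and both sides have the same limit at every s.\<close>

lemma riemann_xi_eq: "riemann_xi s = xi_series ((s - 1 / 2) ^ 2)"
  unfolding riemann_xi_def
proof (rule remove_sings_eqI)
  let ?f = "\<lambda>s. of_real pi powr (- s / 2) * (s - 1) * Gamma (1 + s / 2) * riemann_zeta s"
  have "(\<lambda>w. xi_series ((w - 1 / 2) ^ 2)) holomorphic_on UNIV" by (intro holomorphic_intros)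
  then have "isCont (\<lambda>w. xi_series ((w - 1 / 2) ^ 2)) s"
    by (meson holomorphic_on_imp_continuous_on continuous_on_eq_continuous_at open_UNIV UNIV_I)
  then have "(\<lambda>w. xi_series ((w - 1 / 2) ^ 2)) \<midarrow>s\<rightarrow> xi_series ((s - 1 / 2) ^ 2)"
    by (rule isContD)
  moreover have "eventually (\<lambda>w. xi_series ((w - 1 / 2) ^ 2) = ?f w) (at s)"
  proof -
    have "eventually (\<lambda>w. rGamma (1 + w / 2) * (w - 1) \<noteq> 0 \<and> w \<in> UNIV) (at s)"
      by (rule non_zero_neighbour_alt[where \<beta> = 0 and S = UNIV]) (auto intro!: holomorphic_intros)
    then show ?thesis
    proof eventually_elim
      case (elim w)
      have "of_real pi powr (- w / 2) * of_real pi powr (w / 2) = (1 :: complex)"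
        by (simp add: powr_add[symmetric])
      moreover have "Gamma (1 + w / 2) * rGamma (1 + w / 2) = 1"
        using elim by (simp add: Gamma_def)
      moreover have "?f w = xi_series ((w - 1 / 2) ^ 2) * (of_real pi powr (- w / 2) * of_real pi powr (w / 2))
          * (Gamma (1 + w / 2) * rGamma (1 + w / 2))"
        using elim by (simp add: riemann_zeta_eq zeta_continuation_def)
      ultimately show ?case by simp
    qed
  qed
  ultimately show "?f \<midarrow>s\<rightarrow> xi_series ((s - 1 / 2) ^ 2)"
    by (rule Lim_transform_eventually)
qed

lemma Xi_eq: "Xi s = xi_series (- (s ^ 2))"
  by (simp add: Xi_def riemann_xi_eq power_mult_distrib)

lemma riemann_xi_sums: "(\<lambda>n. of_real (xi_coeff n) * s ^ (2 * n)) sums riemann_xi (1 / 2 + s)"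
  using xi_series_sums[of "s ^ 2"] by (simp add: riemann_xi_eq power_mult)

text \<open>Positive coefficients reduce the circle to its positive point (x - 1/2)^2 with x = 2 m,
  where the value is explicit. An integral m makes the Gamma factor m! \<le> m^m, and zeta (2 m) is
  at most zeta (2) = pi^2 / 6.\<close>

lemma norm_xi_series_growth:
  assumes "m \<ge> 1" "norm z = (2 * real m - 1 / 2) ^ 2"
  shows "norm (xi_series z) \<le> pi ^ 2 / 6 * (2 * real m) * real m ^ m"
proof -
  define x where "x = 2 * real m"
  have x: "x > 1" using assms(1) by (simp add: x_def)
  have le: "real (Suc k) powr (- x) \<le> 1 / (real k + 1) ^ 2" for k
  proof -
    have "real (Suc k) powr (- x) \<le> real (Suc k) powr (- 2)"
      using assms(1) by (intro powr_mono) (auto simp: x_def)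
    also have "\<dots> = 1 / (real k + 1) ^ 2"
      by (simp add: powr_minus powr_numeral divide_inverse add.commute)
    finally show ?thesis .
  qed
  have isq: "(\<lambda>k. 1 / (real k + 1) ^ 2) sums (pi ^ 2 / 6)"
    using inverse_squares_sums by (simp add: add.commute)
  have zs: "(\<Sum>k. real (Suc k) powr (- x)) \<le> pi ^ 2 / 6"
  proof -
    have "(\<Sum>k. real (Suc k) powr (- x)) \<le> (\<Sum>k. 1 / (real k + 1) ^ 2)"
      by (intro suminf_le le summable_Suc_powr x sums_summable[OF isq])
    then show ?thesis using sums_unique[OF isq] by simp
  qed
  have "norm (xi_series z) \<le> (\<Sum>n. xi_coeff n * norm z ^ n)" by (rule norm_xi_series_le)
  also have "\<dots> = pi powr (- x / 2) * (x - 1) * Gamma (1 + x / 2) * (\<Sum>k. real (Suc k) powr (- x))"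
    unfolding assms(2) using xi_series_square_real[OF x] by (simp add: x_def)
  also have "\<dots> \<le> 1 * x * real m ^ m * (pi ^ 2 / 6)"
  proof (intro mult_mono zs)
    have "pi powr (- x / 2) \<le> pi powr 0" using x pi_gt3 by (intro powr_mono) auto
    then show "pi powr (- x / 2) \<le> 1" by simp
    have "Gamma (1 + x / 2) = fact m" using Gamma_fact[of m, where ?'a = real] by (simp add: x_def)
    then show "Gamma (1 + x / 2) \<le> real m ^ m"
      using fact_le_power[of m, where ?'a = real] by simp
    show "0 \<le> (\<Sum>k. real (Suc k) powr (- x))" by (intro suminf_nonneg summable_Suc_powr x) auto
  qed (use x Gamma_real_pos[of "1 + x / 2"] in auto)
  finally show ?thesis by (simp add: x_def mult_ac)
qed

section \<open>Logarithmic derivatives of entire functions\<close>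

text \<open>The map k / (2 M - k) sends the half-plane Re k < M into the unit disc and fixes 0, so
  the Schwarz lemma bounds it by 1/2 on the circle of radius R / 2. Solving for k gives |k| \<le> 2
  M there, and Cauchy's inequality yields the coefficients.\<close>

lemma borel_caratheodory_coeff:
  assumes k: "k holomorphic_on ball 0 R" "k 0 = 0" and R: "R > 0"
    and re: "\<And>z. norm z < R \<Longrightarrow> Re (k z) < M"
  shows "norm ((deriv ^^ n) k 0) \<le> fact n * (2 * M) / (R / 2) ^ n"
proof -
  have M: "M > 0" using re[of 0] k(2) R by simp
  have bd: "norm (k w) \<le> 2 * M" if w: "norm w = R / 2" for w
  proof -
    define \<phi> where "\<phi> z = k (of_real R * z) / (of_real (2 * M) - k (of_real R * z))" for z
    have in_ball: "norm (of_real R * z) < R" if "norm z < 1" for z :: complex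
      using that R by (simp add: norm_mult)
    have ne: "of_real (2 * M) - k z \<noteq> 0" if "norm z < R" for z
    proof
      assume "of_real (2 * M) - k z = 0"
      then have "Re (k z) = 2 * M" by (auto simp: complex_eq_iff)
      then show False using re[OF that] M by simp
    qed
    have less: "norm (k z) < norm (of_real (2 * M) - k z)" if "norm z < R" for z
    proof -
      have "0 < 4 * M * (M - Re (k z))" using M re[OF that] by simp
      then have "Re (k z) ^ 2 + Im (k z) ^ 2 < (2 * M - Re (k z)) ^ 2 + Im (k z) ^ 2"
        by (simp add: power2_eq_square algebra_simps)
      then show ?thesis unfolding cmod_def by simp
    qed
    have "norm (\<phi> (w / of_real R)) \<le> norm (w / of_real R)"
    proof (rule Schwarz_Lemma(1))
      show "\<phi> holomorphic_on ball 0 1" unfolding \<phi>_def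
        using R by (intro holomorphic_intros holomorphic_on_compose_gen[OF _ k(1), unfolded o_def])
          (use ne in_ball in auto)
      show "norm (\<phi> z) < 1" if "norm z < 1" for z
        unfolding \<phi>_def norm_divide using less[OF in_ball[OF that]] ne[OF in_ball[OF that]]
        by (subst divide_less_eq_1_pos) auto
    qed (use w R in \<open>auto simp: \<phi>_def k norm_divide\<close>)
    also have "norm (w / of_real R) = 1 / 2" using w R by (simp add: norm_divide)
    finally have "norm (k w) \<le> norm (of_real (2 * M) - k w) / 2"
      using R w ne[of w] by (simp add: \<phi>_def norm_divide divide_le_eq)
    also have "\<dots> \<le> (2 * M + norm (k w)) / 2"
      using norm_triangle_ineq4[of "of_real (2 * M)" "k w"] M by simp
    finally show ?thesis by simp
  qed
  show ?thesis
  proof (rule Cauchy_inequality)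
    show "k holomorphic_on ball 0 (R / 2)" "continuous_on (cball 0 (R / 2)) k"
      using R by (auto intro!: holomorphic_on_imp_continuous_on holomorphic_on_subset[OF k(1)])
  qed (use R bd in auto)
qed

section \<open>Dividing out finitely many zeros\<close>

text \<open>The exponent is 0 when a is not a zero. The condition at 0 excludes f = 0, which has no
  finite order.\<close>

lemma entire_divide_zero:
  assumes "f holomorphic_on UNIV" "f (0::complex) \<noteq> 0"
  obtains q n where "q holomorphic_on UNIV" "\<And>z. f z = (z - a) ^ n * q z" "q a \<noteq> 0"
proof -
  define n where "n = nat (zorder f a)"
  define g where "g = zor_poly f a"
  obtain r where r: "r > 0" "g holomorphic_on cball a r" "\<And>w. w \<in> cball a r \<Longrightarrow> f w = g w * (w - a) ^ n \<and> g w \<noteq> 0"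
    using zorder_exist_zero[OF assms(1) open_UNIV connected_UNIV UNIV_I, of a] assms(2)
    unfolding n_def g_def by blast
  define q where "q z = (if z = a then g a else f z / (z - a) ^ n)" for z
  have qg: "q w = g w" if "w \<in> cball a r" for w
    using r(3)[OF that] by (auto simp: q_def)
  have "q holomorphic_on UNIV"
  proof (rule no_isolated_singularity'[where K = "{a}"])
    have "q holomorphic_on - {a} \<longleftrightarrow> (\<lambda>z. f z / (z - a) ^ n) holomorphic_on - {a}"
      by (rule holomorphic_cong) (auto simp: q_def)
    moreover have "(\<lambda>z. f z / (z - a) ^ n) holomorphic_on - {a}"
      by (intro holomorphic_intros holomorphic_on_subset[OF assms(1)]) auto
    ultimately show "q holomorphic_on UNIV - {a}" by (simp add: Compl_eq_Diff_UNIV)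
    fix z assume "z \<in> {a}"
    have "isCont g a"
      using r(1,2) by (meson analytic_at analytic_at_imp_isCont ball_subset_cball centre_in_ball holomorphic_on_subset open_ball)
    moreover have "eventually (\<lambda>w. g w = q w) (at a)"
      using eventually_at_ball[OF r(1), of a UNIV] by eventually_elim (use qg in auto)
    ultimately have "(q \<longlongrightarrow> g a) (at a)"
      unfolding isCont_def using Lim_transform_eventually by blast
    then show "(q \<longlongrightarrow> q z) (at z)" using \<open>z \<in> {a}\<close> by (simp add: q_def)
  qed auto
  moreover have "f z = (z - a) ^ n * q z" for z
    using r(3)[of a] r(1) by (auto simp: q_def)
  moreover have "q a \<noteq> 0" using r(3)[of a] r(1) by (simp add: q_def)
  ultimately show thesis by (rule that)
qed

text \<open>The factors are normalised to 1 at the origin, so that g 0 = f 0 whatever the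
  multiplicities.\<close>

lemma entire_divide_finite_zeros:
  assumes "finite Z" "0 \<notin> Z" "f holomorphic_on UNIV" "f (0::complex) \<noteq> 0"
  shows "\<exists>g N. g holomorphic_on UNIV \<and> (\<forall>z. f z = (\<Prod>a\<in>Z. (1 - z / a) ^ N a) * g z) \<and> (\<forall>a\<in>Z. g a \<noteq> 0)"
  using assms(1,2)
proof (induction Z)
  case empty
  then show ?case using assms by auto
next
  case (insert b Z)
  then obtain g N where g: "g holomorphic_on UNIV" "\<And>z. f z = (\<Prod>a\<in>Z. (1 - z / a) ^ N a) * g z" "\<And>a. a \<in> Z \<Longrightarrow> g a \<noteq> 0"
    by auto
  have "g 0 \<noteq> 0" using g(2)[of 0] assms(4) by simp
  then obtain q n where q: "q holomorphic_on UNIV" "\<And>z. g z = (z - b) ^ n * q z" "q b \<noteq> 0"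
    using entire_divide_zero[OF g(1), of b] by metis
  define N' where "N' = N(b := n)"
  have b: "b \<noteq> 0" using insert by auto
  have "g z = (1 - z / b) ^ n * ((- b) ^ n * q z)" for z
  proof -
    have "(z - b) = (1 - z / b) * (- b)" using b by (simp add: field_simps)
    then show ?thesis unfolding q(2) by (metis mult.assoc power_mult_distrib)
  qed
  moreover have "(\<Prod>a\<in>Z. (1 - z / a) ^ N' a) = (\<Prod>a\<in>Z. (1 - z / a) ^ N a)" for z
    using insert by (intro prod.cong) (auto simp: N'_def)
  ultimately have "f z = (\<Prod>a\<in>insert b Z. (1 - z / a) ^ N' a) * ((- b) ^ n * q z)" for z
    using insert g(2)[of z] by (simp add: N'_def mult_ac)
  moreover have "(\<lambda>z. (- b) ^ n * q z) holomorphic_on UNIV" by (intro holomorphic_intros q)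
  moreover have "(- b) ^ n * q a \<noteq> 0" if "a \<in> insert b Z" for a
    using that q g(3) b by (cases "a = b") auto
  ultimately show ?case by blast
qed

text \<open>A factor with exponent N at a contributes - N / (a - z), a geometric series in z / a;
  hence the coefficients are power sums of reciprocals.\<close>

lemma log_deriv_prod_expansion:
  fixes N :: "complex \<Rightarrow> nat"
  assumes "finite Z" "0 \<notin> Z"
  defines "P \<equiv> \<lambda>z. \<Prod>a\<in>Z. (1 - z / a) ^ N a"
  shows "(\<lambda>z. deriv P z / P z) has_fps_expansion Abs_fps (\<lambda>n. - (\<Sum>a\<in>Z. of_nat (N a) / a ^ Suc n))"
proof (rule has_fps_expansionI)
  have "open (- Z)" using assms by (simp add: finite_imp_closed open_Compl)
  then obtain r where r: "r > 0" "ball 0 r \<subseteq> - Z"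
    using assms(2) by (meson ComplI openE)
  have "eventually (\<lambda>u. u \<in> ball 0 r) (nhds 0)"
    using r(1) by (intro eventually_nhds_in_open) auto
  then show "\<forall>\<^sub>F u in nhds 0. (\<lambda>n. fps_nth (Abs_fps (\<lambda>n. - (\<Sum>a\<in>Z. of_nat (N a) / a ^ Suc n))) n * u ^ n) sums (deriv P u / P u)"
  proof eventually_elim
    case (elim u)
    have lt: "norm u < norm a" if "a \<in> Z" for a
    proof (rule ccontr)
      assume "\<not> norm u < norm a"
      then have "a \<in> ball 0 r" using elim by simp
      then show False using r that by auto
    qed
    have ne: "a \<noteq> 0" "a - u \<noteq> 0" "1 - u / a \<noteq> 0" if "a \<in> Z" for a
      using lt[OF that] assms(2) that by (auto simp: field_simps)
    have "(P has_field_derivative P u *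
        (\<Sum>a\<in>Z. (of_nat (N a) * (1 - u / a) ^ (N a - 1) * (- 1 / a)) / (1 - u / a) ^ N a)) (at u)"
      unfolding P_def
      by (rule has_field_derivative_prod'[where f = "\<lambda>a u. (1 - u / a) ^ N a"])
         (use ne in \<open>auto intro!: derivative_eq_intros\<close>)
    then have "deriv P u = P u *
        (\<Sum>a\<in>Z. (of_nat (N a) * (1 - u / a) ^ (N a - 1) * (- 1 / a)) / (1 - u / a) ^ N a)"
      by (rule DERIV_imp_deriv)
    also have "(\<Sum>a\<in>Z. (of_nat (N a) * (1 - u / a) ^ (N a - 1) * (- 1 / a)) / (1 - u / a) ^ N a)
        = (\<Sum>a\<in>Z. - of_nat (N a) / (a - u))"
    proof (intro sum.cong refl)
      fix a assume a: "a \<in> Z"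
      show "(of_nat (N a) * (1 - u / a) ^ (N a - 1) * (- 1 / a)) / (1 - u / a) ^ N a = - of_nat (N a) / (a - u)"
      proof (cases "N a")
        case (Suc m)
        have "a * (1 - u / a) = a - u" using ne[OF a] by (simp add: field_simps)
        then show ?thesis using ne[OF a] by (simp add: Suc field_simps)
      qed auto
    qed
    finally have eq: "deriv P u / P u = (\<Sum>a\<in>Z. - of_nat (N a) / (a - u))"
      using assms(1) ne by (simp add: P_def)
    have "(\<lambda>n. \<Sum>a\<in>Z. - of_nat (N a) / a * (u / a) ^ n) sums (\<Sum>a\<in>Z. - of_nat (N a) / a * (1 / (1 - u / a)))"
      using lt ne by (intro sums_sum sums_mult geometric_sums) (auto simp: norm_divide divide_less_eq)
    also have "(\<Sum>a\<in>Z. - of_nat (N a) / a * (1 / (1 - u / a))) = deriv P u / P u"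
      unfolding eq using ne by (intro sum.cong) (auto simp: field_simps)
    also have "(\<lambda>n. \<Sum>a\<in>Z. - of_nat (N a) / a * (u / a) ^ n) =
        (\<lambda>n. fps_nth (Abs_fps (\<lambda>n. - (\<Sum>a\<in>Z. of_nat (N a) / a ^ Suc n))) n * u ^ n)"
      by (simp add: fun_eq_iff sum_negf[symmetric] sum_distrib_right power_divide)
    finally show ?case .
  qed
qed

text \<open>The error is of size ln B / R^(n+1). Thus, up to sign, the coefficients of f'/f are
  limits of power sums over zeros as soon as ln B = o(R) along some sequence of radii.\<close>

lemma log_deriv_coeff_approx:
  assumes f: "f holomorphic_on UNIV" "f 0 \<noteq> 0" and R: "R > 0"
    and B: "\<And>z. norm z = 2 * R \<Longrightarrow> norm (f z) \<le> B"
    and H: "(\<lambda>z. deriv f z / f z) has_fps_expansion H"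
  shows "\<exists>Z N. finite Z \<and> (\<forall>a\<in>Z. f a = 0) \<and>
    (\<forall>n. norm (fps_nth H n + (\<Sum>a\<in>Z. of_nat (N a) / a ^ Suc n))
      \<le> real (Suc n) * (2 * ln (2 * B / norm (f 0))) * (2 / R) ^ Suc n)"
proof -
  define Z where "Z = {z \<in> cball 0 R. f z = 0}"
  have "finite Z"
  proof (rule ccontr)
    assume inf: "infinite Z"
    have sub: "Z \<subseteq> cball 0 R" by (auto simp: Z_def)
    have "\<exists>x\<in>cball 0 R. x islimpt Z"
      by (rule Heine_Borel_imp_Bolzano_Weierstrass[OF compact_cball inf sub])
    then obtain x where x: "x islimpt Z" by blast
    have "f 0 = 0"
      by (rule analytic_continuation[OF f(1) open_UNIV connected_UNIV subset_UNIV UNIV_I x])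
         (auto simp: Z_def)
    then show False using f(2) by simp
  qed
  have "0 \<notin> Z" using f by (simp add: Z_def)
  obtain g N where g: "g holomorphic_on UNIV"
    "\<And>z. f z = (\<Prod>a\<in>Z. (1 - z / a) ^ N a) * g z" "\<And>a. a \<in> Z \<Longrightarrow> g a \<noteq> 0"
    using entire_divide_finite_zeros[OF \<open>finite Z\<close> \<open>0 \<notin> Z\<close> f] by blast
  \<comment> \<open>On the circle of radius \<open>2 R\<close> each factor of \<open>P\<close> has modulus at least 1, so the maximum principle
    bounds \<open>g\<close> on the disc by the maximum of \<open>f\<close> on that circle.\<close>
  define P where "P z = (\<Prod>a\<in>Z. (1 - z / a) ^ N a)" for z
  have fP: "f z = P z * g z" for z by (simp add: P_def g(2))
  have g0: "g 0 = f 0" using g(2)[of 0] by simp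
  have gne: "g z \<noteq> 0" if "norm z \<le> R" for z
    using that fP[of z] g(3)[of z] by (cases "f z = 0") (auto simp: Z_def)
  have gB: "norm (g z) \<le> B" if "norm z \<le> 2 * R" for z
  proof (rule maximum_modulus_frontier[where f = g and \<xi> = z and S = "cball 0 (2 * R)"])
    fix w :: complex assume "w \<in> frontier (cball 0 (2 * R))"
    then have w: "norm w = 2 * R" using R by auto
    have "1 \<le> norm (P w)"
      unfolding P_def prod_norm[symmetric] norm_power
    proof (intro prod_ge_1 one_le_power)
      fix a assume a: "a \<in> Z"
      then have a: "norm a \<le> R" "a \<noteq> 0" using \<open>0 \<notin> Z\<close> by (auto simp: Z_def)
      have "2 \<le> norm (w / a)" using a w by (simp add: norm_divide le_divide_eq)
      then show "1 \<le> norm (1 - w / a)"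
        using norm_triangle_ineq2[of "w / a" 1] by (simp add: norm_minus_commute)
    qed
    then have "1 * norm (g w) \<le> norm (P w) * norm (g w)" by (intro mult_right_mono) auto
    also have "\<dots> = norm (f w)" by (simp add: fP norm_mult)
    also have "\<dots> \<le> B" using B w by simp
    finally show "norm (g w) \<le> B" by simp
  qed (use that g(1) in \<open>auto intro!: holomorphic_on_imp_continuous_on holomorphic_on_subset[OF g(1)]\<close>)
  \<comment> \<open>The factor 2 makes the later bound Re (k z) < M strict, as
    \<open>borel_caratheodory_coeff\<close> demands.\<close>
  define M where "M = ln (2 * B / norm (f 0))"
  have Bpos: "B > 0"
  proof -
    have "0 < norm (f 0)" using f by simp
    also have "\<dots> \<le> B" using gB[of 0] g0 R by simp
    finally show ?thesis .
  qed
  \<comment> \<open>The quotient has no zeros on the disc, which is contractible, so it has a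
    holomorphic logarithm there; subtracting the value at 0 normalises it to k 0 = 0.\<close>
  have "(\<lambda>z. g z / f 0) holomorphic_on ball 0 R"
    by (intro holomorphic_intros holomorphic_on_subset[OF g(1)]) (use f in auto)
  then obtain k0 where k0: "k0 holomorphic_on ball 0 R" "\<And>z. z \<in> ball 0 R \<Longrightarrow> g z / f 0 = exp (k0 z)"
    using contractible_imp_holomorphic_log[of "\<lambda>z. g z / f 0" "ball 0 R"] gne f
    by (metis convex_ball convex_imp_contractible divide_eq_0_iff dist_0_norm less_imp_le mem_ball)
  define k where "k z = k0 z - k0 0" for z
  have k: "k holomorphic_on ball 0 R" "k 0 = 0" unfolding k_def by (auto intro!: holomorphic_intros k0)
  have ek0: "exp (k0 0) = 1" using k0(2)[of 0] g0 f R by simp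
  have ek: "g z = f 0 * exp (k z)" if "norm z < R" for z
    using k0(2)[of z] that f ek0 by (simp add: k_def exp_diff field_simps)
  have "Re (k z) < M" if "norm z < R" for z
  proof -
    have "norm (f 0) * exp (Re (k z)) \<le> B"
      using gB[of z] ek[OF that] that R by (simp add: norm_mult)
    then have "exp (Re (k z)) < 2 * B / norm (f 0)"
      using Bpos f by (simp add: field_simps)
    then show ?thesis unfolding M_def using Bpos f by (subst exp_less_cancel_iff[symmetric]) (simp add: )
  qed
  then have bound: "norm ((deriv ^^ Suc n) k 0) \<le> fact (Suc n) * (2 * M) / (R / 2) ^ Suc n" for n
    by (intro borel_caratheodory_coeff k R) auto

  have kexp: "deriv k has_fps_expansion fps_expansion (deriv k) 0"
    using R by (intro has_fps_expansion_fps_expansion[of "ball 0 R"] holomorphic_deriv k) auto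
  have "eventually (\<lambda>z. deriv P z / P z + deriv k z = deriv f z / f z) (nhds 0)"
  proof -
    have "eventually (\<lambda>z. z \<in> ball 0 R) (nhds 0)"
      using R by (intro eventually_nhds_in_open) auto
    moreover have "eventually (\<lambda>z. f z \<noteq> 0) (nhds 0)"
    proof -
      have "isCont f 0"
        by (meson f(1) holomorphic_on_imp_continuous_on continuous_on_eq_continuous_at open_UNIV UNIV_I)
      then have "(f \<longlongrightarrow> f 0) (nhds 0)"
        by (simp add: isCont_def tendsto_at_iff_tendsto_nhds)
      then show ?thesis using f(2) by (rule tendsto_imp_eventually_ne)
    qed
    ultimately show ?thesis
    proof eventually_elim
      case (elim z)
      have "eventually (\<lambda>z. z \<in> ball 0 R) (nhds z)"
        using elim by (intro eventually_nhds_in_open) auto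
      then have "eventually (\<lambda>z. f z = P z * (f 0 * exp (k z))) (nhds z)"
        by eventually_elim (use ek fP in auto)
      then have "deriv f z = deriv (\<lambda>z. P z * (f 0 * exp (k z))) z"
        by (intro deriv_cong_ev) auto
      also have "(k has_field_derivative deriv k z) (at z)"
        using elim by (intro holomorphic_derivI[OF k(1)]) auto
      then have "((\<lambda>z. P z * (f 0 * exp (k z))) has_field_derivative
           deriv P z * (f 0 * exp (k z)) + P z * (f 0 * (exp (k z) * deriv k z))) (at z)"
      proof (intro derivative_eq_intros)
        have "P holomorphic_on UNIV" unfolding P_def by (intro holomorphic_intros) (use \<open>0 \<notin> Z\<close> in auto)
        then show "(P has_field_derivative deriv P z) (at z)" by (intro holomorphic_derivI) auto
      qed (auto simp: algebra_simps)
      then have "deriv (\<lambda>z. P z * (f 0 * exp (k z))) z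
          = deriv P z * (f 0 * exp (k z)) + P z * (f 0 * (exp (k z) * deriv k z))"
        by (rule DERIV_imp_deriv)
      finally have "deriv f z = deriv P z * g z + P z * g z * deriv k z"
        using ek[of z] elim by simp
      then show ?case using elim unfolding fP by (simp add: field_simps)
    qed
  qed
  then have "(\<lambda>z. deriv P z / P z + deriv k z) has_fps_expansion H \<longleftrightarrow> (\<lambda>z. deriv f z / f z) has_fps_expansion H"
    by (intro has_fps_expansion_cong) auto
  then have 1: "(\<lambda>z. deriv P z / P z + deriv k z) has_fps_expansion H" using H by simp
  have "(\<lambda>z. deriv P z / P z + deriv k z) has_fps_expansion
      Abs_fps (\<lambda>n. - (\<Sum>a\<in>Z. of_nat (N a) / a ^ Suc n)) + fps_expansion (deriv k) 0"
    unfolding P_def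
    by (intro has_fps_expansion_add log_deriv_prod_expansion kexp) fact+
  note Heq = fps_expansion_unique_complex[OF 1 this]
  have "norm (fps_nth H n + (\<Sum>a\<in>Z. of_nat (N a) / a ^ Suc n))
      \<le> real (Suc n) * (2 * ln (2 * B / norm (f 0))) * (2 / R) ^ Suc n" for n
  proof -
    have "fps_nth H n = - (\<Sum>a\<in>Z. of_nat (N a) / a ^ Suc n) + (deriv ^^ Suc n) k 0 / fact n"
      using arg_cong[OF Heq, of "\<lambda>F. fps_nth F n"] by (simp add: fps_expansion_def funpow_swap1)
    then have "norm (fps_nth H n + (\<Sum>a\<in>Z. of_nat (N a) / a ^ Suc n)) = norm ((deriv ^^ Suc n) k 0) / fact n"
      by (simp add: norm_divide)
    also have "\<dots> \<le> (fact (Suc n) * (2 * M) / (R / 2) ^ Suc n) / fact n"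
      by (intro divide_right_mono bound) auto
    also have "\<dots> = real (Suc n) * (2 * M) * (2 / R) ^ Suc n"
      unfolding fact_Suc by (simp add: power_divide field_simps del: power_Suc of_nat_Suc)
    finally show ?thesis
      by (simp add: M_def)
  qed
  then show ?thesis using \<open>finite Z\<close> by (intro exI[of _ Z] exI[of _ N]) (auto simp: Z_def)
qed

section \<open>Completely monotone sequences\<close>

text \<open>If \<nu> n is the integral of x^n against a measure on [0,1], this is the integral of
  x^n (1 - x)^k. Nonnegativity for all n and k is Hausdorff's condition.\<close>

definition moment_diff :: "(nat \<Rightarrow> real) \<Rightarrow> nat \<Rightarrow> nat \<Rightarrow> real" where
  "moment_diff \<nu> n k = (\<Sum>j\<le>k. (- 1) ^ j * real (k choose j) * \<nu> (n + j))"

lemma moment_diff_Suc: "moment_diff \<nu> n (Suc k) = moment_diff \<nu> n k - moment_diff \<nu> (Suc n) k"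
proof -
  have "moment_diff \<nu> n (Suc k) = \<nu> n + (\<Sum>j\<le>k. (- 1) ^ Suc j * real (Suc k choose Suc j) * \<nu> (n + Suc j))"
    unfolding moment_diff_def by (subst sum.atMost_Suc_shift) simp
  also have "(\<Sum>j\<le>k. (- 1) ^ Suc j * real (Suc k choose Suc j) * \<nu> (n + Suc j))
      = (\<Sum>j\<le>k. (- 1) ^ Suc j * real (k choose Suc j) * \<nu> (n + Suc j)) - moment_diff \<nu> (Suc n) k"
    unfolding moment_diff_def sum_subtractf[symmetric] by (intro sum.cong) (auto simp: algebra_simps)
  also have "\<nu> n + ((\<Sum>j\<le>k. (- 1) ^ Suc j * real (k choose Suc j) * \<nu> (n + Suc j)) - moment_diff \<nu> (Suc n) k)
     = (\<Sum>j\<le>Suc k. (- 1) ^ j * real (k choose j) * \<nu> (n + j)) - moment_diff \<nu> (Suc n) k"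
    by (subst sum.atMost_Suc_shift) simp
  also have "(\<Sum>j\<le>Suc k. (- 1) ^ j * real (k choose j) * \<nu> (n + j)) = moment_diff \<nu> n k"
    by (simp add: moment_diff_def binomial_eq_0)
  finally show ?thesis .
qed

text \<open>For moments of a measure this is the binomial expansion of x^n (x + (1 - x))^N under the
  integral. At n = 0 it says that the Bernstein weights have total mass \<nu> 0.\<close>

lemma sum_choose_moment_diff:
  "(\<Sum>i\<le>N. real (N choose i) * moment_diff \<nu> (n + i) (N - i)) = \<nu> n"
proof (induction N arbitrary: n)
  case 0
  then show ?case by (simp add: moment_diff_def)
next
  case (Suc N)
  have "(\<Sum>i\<le>Suc N. real (Suc N choose i) * moment_diff \<nu> (n + i) (Suc N - i))
      = moment_diff \<nu> n (Suc N) + (\<Sum>i\<le>N. real (Suc N choose Suc i) * moment_diff \<nu> (Suc n + i) (N - i))"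
    by (subst sum.atMost_Suc_shift) simp
  also have "(\<Sum>i\<le>N. real (Suc N choose Suc i) * moment_diff \<nu> (Suc n + i) (N - i))
     = \<nu> (Suc n) + (\<Sum>i\<le>N. real (N choose Suc i) * moment_diff \<nu> (Suc n + i) (N - i))"
    unfolding Suc.IH[of "Suc n", symmetric] sum.distrib[symmetric]
    by (intro sum.cong) (auto simp: algebra_simps)
  also have "moment_diff \<nu> n (Suc N) + (\<nu> (Suc n) + (\<Sum>i\<le>N. real (N choose Suc i) * moment_diff \<nu> (Suc n + i) (N - i)))
    = \<nu> (Suc n) + (\<Sum>i\<le>Suc N. real (N choose i) * moment_diff \<nu> (n + i) (Suc N - i))"
  proof -
    have "(\<Sum>i\<le>Suc N. real (N choose i) * moment_diff \<nu> (n + i) (Suc N - i))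
        = moment_diff \<nu> n (Suc N) + (\<Sum>i\<le>N. real (N choose Suc i) * moment_diff \<nu> (Suc n + i) (N - i))"
      by (subst sum.atMost_Suc_shift) simp
    then show ?thesis by simp
  qed
  also have "(\<Sum>i\<le>Suc N. real (N choose i) * moment_diff \<nu> (n + i) (Suc N - i))
     = (\<Sum>i\<le>N. real (N choose i) * moment_diff \<nu> (n + i) (Suc (N - i)))"
    by (simp add: binomial_eq_0 Suc_diff_le)
  also have "\<dots> = (\<Sum>i\<le>N. real (N choose i) * moment_diff \<nu> (n + i) (N - i))
       - (\<Sum>i\<le>N. real (N choose i) * moment_diff \<nu> (Suc n + i) (N - i))"
    unfolding moment_diff_Suc by (simp add: sum_subtractf algebra_simps)
  also have "\<dots> = \<nu> n - \<nu> (Suc n)" by (simp only: Suc.IH)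
  finally show ?case by simp
qed

text \<open>Relates the weights of the expansion of \<nu> n to those of \<nu> 0. The quotient is
  close to (j / N)^n, so one discrete measure approximates all the \<nu> n.\<close>

lemma choose_shift_ratio:
  assumes "n \<le> j" "j \<le> N"
  shows "real ((N - n) choose (j - n)) = real (N choose j) * (\<Prod>i<n. (real j - real i) / (real N - real i))"
  using assms
proof (induction n)
  case (Suc n)
  have "Suc (j - Suc n) * (Suc (N - Suc n) choose Suc (j - Suc n)) = Suc (N - Suc n) * ((N - Suc n) choose (j - Suc n))"
    by (subst Suc_times_binomial_eq) (rule mult.commute)
  moreover have "Suc (j - Suc n) = j - n" "Suc (N - Suc n) = N - n" using Suc.prems by auto
  ultimately have "real ((N - n) * ((N - Suc n) choose (j - Suc n))) = real ((j - n) * ((N - n) choose (j - n)))" by simp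
  then have "(real N - real n) * real ((N - Suc n) choose (j - Suc n)) = (real j - real n) * real ((N - n) choose (j - n))"
    using Suc.prems by (simp add: of_nat_diff)
  moreover have "real N - real n \<noteq> 0" using Suc.prems by simp
  ultimately have "real ((N - Suc n) choose (j - Suc n)) = (real j - real n) / (real N - real n) * real ((N - n) choose (j - n))"
    by (simp add: field_simps)
  then show ?case using Suc by simp
qed simp

text \<open>The exact expansion of \<nu> n has factors (j - i) / (N - i) where the n-th moment of w
  has j / N. Each of the n factors is off by at most 2 n / N, because 2 n \<le> N keeps N - i \<ge>
  N / 2, and w has total mass \<nu> 0.\<close>

lemma moment_discrete_approx:
  assumes pos: "\<And>n k. moment_diff \<nu> n k \<ge> 0" and N: "2 * n \<le> N" "N > 0"
  defines "w \<equiv> \<lambda>j. real (N choose j) * moment_diff \<nu> j (N - j)"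
  shows "\<bar>\<nu> n - (\<Sum>j\<le>N. w j * (real j / real N) ^ n)\<bar> \<le> \<nu> 0 * (real n * (2 * real n / real N))"
proof -
  define q where "q j = (\<Prod>i<n. (real j - real i) / (real N - real i))" for j
  have w0: "w j \<ge> 0" for j using pos by (simp add: w_def)
  have tot: "(\<Sum>j\<le>N. w j) = \<nu> 0" using sum_choose_moment_diff[of N \<nu> 0] by (simp add: w_def)
  have "\<nu> n = (\<Sum>i\<le>N - n. real ((N - n) choose i) * moment_diff \<nu> (n + i) (N - n - i))"
    by (rule sum_choose_moment_diff[symmetric])
  also have "\<dots> = (\<Sum>j=n..N. real ((N - n) choose (j - n)) * moment_diff \<nu> j (N - j))"
    by (rule sum.reindex_bij_witness[of _ "\<lambda>j. j - n" "\<lambda>i. n + i"]) (use N in auto)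
  also have "\<dots> = (\<Sum>j=n..N. w j * q j)"
    by (intro sum.cong) (auto simp: choose_shift_ratio w_def q_def)
  \<comment> \<open>For j < n the product q j contains the factor with i = j, which is 0.\<close>
  also have "\<dots> = (\<Sum>j\<le>N. w j * q j)"
    by (rule sum.mono_neutral_left) (auto simp: q_def)
  finally have "\<nu> n - (\<Sum>j\<le>N. w j * (real j / real N) ^ n) = (\<Sum>j\<le>N. w j * (q j - (real j / real N) ^ n))"
    by (simp add: algebra_simps sum_subtractf)
  also have "\<bar>\<dots>\<bar> \<le> (\<Sum>j\<le>N. w j * (real n * (2 * real n / real N)))"
  proof (rule order_trans[OF sum_abs], rule sum_mono)
    fix j assume j: "j \<in> {..N}"
    have "norm (q j - (\<Prod>i<n. real j / real N)) \<le> (\<Sum>i<n. norm ((real j - real i) / (real N - real i) - real j / real N))"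
      unfolding q_def
    proof (rule norm_prod_diff)
      fix i assume i: "i \<in> {..<n}"
      show "norm ((real j - real i) / (real N - real i)) \<le> 1"
        using i j N by (simp add: abs_le_iff field_simps)
      show "norm (real j / real N) \<le> 1" using j N by (simp add: divide_le_eq)
    qed
    also have "\<dots> \<le> (\<Sum>i<n. 2 * real n / real N)"
    proof (rule sum_mono)
      fix i assume i: "i \<in> {..<n}"
      have "(real j - real i) / (real N - real i) - real j / real N = - (real i / (real N - real i) * (1 - real j / real N))"
        using i N by (simp add: field_simps)
      also have "norm \<dots> = real i / (real N - real i) * (1 - real j / real N)"
        using i j N by (simp add: abs_mult)
      also have "\<dots> \<le> real n / (real N / 2) * 1"
        using i j N by (intro mult_mono frac_le) auto
      finally show "norm ((real j - real i) / (real N - real i) - real j / real N) \<le> 2 * real n / real N" by (simp add: mult.commute)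
    qed
    finally have "\<bar>q j - (real j / real N) ^ n\<bar> \<le> real n * (2 * real n / real N)" by simp
    then show "\<bar>w j * (q j - (real j / real N) ^ n)\<bar> \<le> w j * (real n * (2 * real n / real N))"
      unfolding abs_mult using w0[of j] by (intro mult_mono) auto
  qed
  also have "\<dots> = \<nu> 0 * (real n * (2 * real n / real N))"
    unfolding tot[symmetric] by (rule sum_distrib_right[symmetric])
  finally show ?thesis .
qed

section \<open>Continuation to the slit plane\<close>

text \<open>The common domain of the functions 1 / (1 + x z) for x in [0,1]; the scale L is put in
  only when this is applied.\<close>

definition slit_plane :: "complex set" where
  "slit_plane = - {z. Im z = 0 \<and> Re z \<le> - 1}"

lemma open_slit_plane: "open slit_plane"
proof -
  have "closed ({z. Im z = 0} \<inter> {z. Re z \<le> - 1})"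
    by (intro closed_Int closed_Collect_eq closed_Collect_le continuous_intros)
  then show ?thesis unfolding slit_plane_def Collect_conj_eq by (rule open_Compl)
qed

lemma slit_plane_nonzero:
  assumes "z \<in> slit_plane" "0 \<le> x" "x \<le> 1"
  shows "1 + of_real x * z \<noteq> 0"
proof
  assume *: "1 + of_real x * z = 0"
  then have re: "1 + x * Re z = 0" and im: "x * Im z = 0" by (auto simp: complex_eq_iff)
  have "x > 0" using assms(2) re by (cases "x = 0") auto
  then have "Im z = 0" using im by simp
  moreover have "Re z \<le> - 1"
  proof (rule ccontr)
    assume "\<not> Re z \<le> - 1"
    then have "x * Re z > x * (- 1)" using \<open>x > 0\<close> by (intro mult_strict_left_mono) auto
    then show False using re assms(3) by simp
  qed
  ultimately show False using assms(1) by (simp add: slit_plane_def)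
qed

text \<open>The g N are Stieltjes transforms of discrete measures on [0,1], all of mass \<nu> 0,
  hence uniformly bounded on compact sets. Montel's theorem gives a limit G along a subsequence. Its
  Taylor coefficients at 0 are limits of signed moments, so they are (-1)^n \<nu> n whichever
  subsequence is chosen.\<close>

lemma completely_monotone_continuation:
  assumes pos: "\<And>n k. moment_diff \<nu> n k \<ge> 0"
  shows "\<exists>G. G holomorphic_on slit_plane \<and> G has_fps_expansion Abs_fps (\<lambda>n. of_real ((- 1) ^ n * \<nu> n))"
proof -
  \<comment> \<open>Using \<open>Suc N\<close> keeps the denominators of the nodes nonzero for every
    N.\<close>
  define w where "w N j = real (Suc N choose j) * moment_diff \<nu> j (Suc N - j)" for N j
  define x where "x N j = real j / real (Suc N)" for N j
  define g :: "nat \<Rightarrow> complex \<Rightarrow> complex" where "g N z = (\<Sum>j\<le>Suc N. of_real (w N j) / (1 + of_real (x N j) * z))" for N z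
  have w0: "w N j \<ge> 0" for N j using pos by (simp add: w_def)
  have tot: "(\<Sum>j\<le>Suc N. w N j) = \<nu> 0" for N
    using sum_choose_moment_diff[of "Suc N" \<nu> 0] by (simp add: w_def del: sum.atMost_Suc)
  have x: "0 \<le> x N j" "x N j \<le> 1" if "j \<le> Suc N" for N j using that by (auto simp: x_def)
  have hol: "g N holomorphic_on slit_plane" for N
    unfolding g_def by (intro holomorphic_intros) (use slit_plane_nonzero x in auto)
  have bdd: "\<exists>B. \<forall>h \<in> range g. \<forall>z \<in> K. norm (h z) \<le> B" if K: "compact K" "K \<subseteq> slit_plane" for K
  proof -
    \<comment> \<open>Compactness of the product of [0,1] with K gives one bound C for all nodes at
      once.\<close>
    let ?h = "\<lambda>(t, z). 1 / (1 + of_real t * z) :: complex"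
    have "compact (?h ` ({0..1} \<times> K))"
    proof (rule compact_continuous_image)
      show "compact ({0..1::real} \<times> K)" using K by (intro compact_Times) auto
      show "continuous_on ({0..1} \<times> K) ?h"
        unfolding case_prod_unfold using slit_plane_nonzero K(2)
        by (intro continuous_intros) auto
    qed
    then obtain C where C': "\<forall>y \<in> ?h ` ({0..1} \<times> K). norm y \<le> C"
      by (auto simp only: bounded_iff dest!: compact_imp_bounded)
    have C: "norm (1 / (1 + of_real t * z) :: complex) \<le> C" if "0 \<le> t" "t \<le> 1" "z \<in> K" for t z
      using bspec[OF C', of "?h (t, z)"] that by force
    have "norm (g N z) \<le> \<nu> 0 * C" if "z \<in> K" for N z
    proof -
      have "norm (g N z) \<le> (\<Sum>j\<le>Suc N. norm (of_real (w N j) / (1 + of_real (x N j) * z)))"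
        unfolding g_def by (rule norm_sum)
      also have "\<dots> \<le> (\<Sum>j\<le>Suc N. w N j * C)"
      proof (rule sum_mono)
        fix j assume "j \<in> {..Suc N}"
        then have "norm (1 / (1 + of_real (x N j) * z)) \<le> C" using C x that by auto
        then have "w N j * norm (1 / (1 + of_real (x N j) * z)) \<le> w N j * C" using w0 by (intro mult_left_mono)
        then show "norm (of_real (w N j) / (1 + of_real (x N j) * z)) \<le> w N j * C"
          using w0 by (simp add: norm_divide)
      qed
      also have "\<dots> = \<nu> 0 * C" unfolding tot[symmetric, of N] by (simp only: sum_distrib_right)
      finally show ?thesis .
    qed
    then show ?thesis by blast
  qed
  obtain G r where G: "G holomorphic_on slit_plane" "strict_mono (r :: nat \<Rightarrow> nat)"
    "\<And>K. compact K \<Longrightarrow> K \<subseteq> slit_plane \<Longrightarrow> uniform_limit K (g \<circ> r) G sequentially"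
  proof (rule Montel[where \<F> = g and \<H> = "range g", OF open_slit_plane _ bdd subset_refl])
    show "h holomorphic_on slit_plane" if "h \<in> range g" for h using that hol by auto
  next
    fix G r
    assume a: "G holomorphic_on slit_plane" "strict_mono (r :: nat \<Rightarrow> nat)"
      "\<And>x. x \<in> slit_plane \<Longrightarrow> (\<lambda>n. g (r n) x) \<longlonglongrightarrow> G x"
      "\<And>K. compact K \<Longrightarrow> K \<subseteq> slit_plane \<Longrightarrow> uniform_limit K (g \<circ> r) G sequentially"
    show thesis by (rule that[OF a(1,2,4)])
  qed
  have sub: "cball 0 (1/2) \<subseteq> slit_plane"
  proof
    fix z :: complex assume "z \<in> cball 0 (1/2)"
    then have "\<bar>Re z\<bar> \<le> 1 / 2" using abs_Re_le_cmod[of z] by simp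
    then show "z \<in> slit_plane" by (auto simp: slit_plane_def)
  qed
  have sub': "ball 0 (1/2) \<subseteq> slit_plane" using sub ball_subset_cball by blast
  have unif: "uniform_limit (ball 0 (1/2)) (g \<circ> r) G sequentially"
    by (rule uniform_limit_on_subset[OF G(3)[OF compact_cball sub]]) auto
  have coeff: "(deriv ^^ n) (g N) 0 / fact n = of_real ((- 1) ^ n * (\<Sum>j\<le>Suc N. w N j * x N j ^ n))" for n N
  proof -
    have "g N has_fps_expansion Abs_fps (\<lambda>n. of_real ((- 1) ^ n * (\<Sum>j\<le>Suc N. w N j * x N j ^ n)))"
    proof (rule has_fps_expansionI)
      have "eventually (\<lambda>z. z \<in> ball 0 (1/2)) (nhds (0::complex))"
        by (intro eventually_nhds_in_open) auto
      then show "\<forall>\<^sub>F u in nhds 0. (\<lambda>n. fps_nth (Abs_fps (\<lambda>n. of_real ((- 1) ^ n * (\<Sum>j\<le>Suc N. w N j * x N j ^ n)))) n * u ^ n) sums g N u"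
      proof eventually_elim
        case (elim u)
        have "(\<lambda>n. \<Sum>j\<le>Suc N. of_real (w N j) * (- (of_real (x N j) * u)) ^ n) sums
            (\<Sum>j\<le>Suc N. of_real (w N j) * (1 / (1 - (- (of_real (x N j) * u)))))"
        proof (intro sums_sum sums_mult geometric_sums)
          fix j assume "j \<in> {..Suc N}"
          then have "x N j * norm u \<le> 1 * norm u" using x by (intro mult_right_mono) auto
          then show "norm (- (of_real (x N j) * u)) < 1"
            using elim x[of j N] \<open>j \<in> _\<close> by (simp add: norm_mult)
        qed
        also have "(\<Sum>j\<le>Suc N. of_real (w N j) * (1 / (1 - (- (of_real (x N j) * u))))) = g N u"
          by (simp add: g_def)
        also have "(\<lambda>n. \<Sum>j\<le>Suc N. of_real (w N j) * (- (of_real (x N j) * u)) ^ n) =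
          (\<lambda>n. fps_nth (Abs_fps (\<lambda>n. of_real ((- 1) ^ n * (\<Sum>j\<le>Suc N. w N j * x N j ^ n)))) n * u ^ n)"
        proof
          fix n
          have "of_real (w N j) * (- (of_real (x N j) * u)) ^ n = of_real ((-1) ^ n * (w N j * x N j ^ n)) * u ^ n" for j
            by (simp add: power_minus[of "of_real (x N j) * u"] power_mult_distrib)
          then show "(\<Sum>j\<le>Suc N. of_real (w N j) * (- (of_real (x N j) * u)) ^ n) =
            fps_nth (Abs_fps (\<lambda>n. of_real ((- 1) ^ n * (\<Sum>j\<le>Suc N. w N j * x N j ^ n)))) n * u ^ n"
            by (simp only: fps_nth_Abs_fps sum_distrib_left of_real_sum sum_distrib_right)
        qed
        finally show ?case .
      qed
    qed
    from fps_nth_fps_expansion[OF this, of n] show ?thesis by simp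
  qed
  have lim: "(\<lambda>N. \<Sum>j\<le>Suc N. w N j * x N j ^ n) \<longlonglongrightarrow> \<nu> n" for n
  proof -
    have "(\<lambda>N. \<nu> n - (\<Sum>j\<le>Suc N. w N j * x N j ^ n)) \<longlonglongrightarrow> 0"
    proof (rule Lim_null_comparison)
      show "\<forall>\<^sub>F N in sequentially. norm (\<nu> n - (\<Sum>j\<le>Suc N. w N j * x N j ^ n)) \<le> \<nu> 0 * (real n * (2 * real n / real (Suc N)))"
        using eventually_ge_at_top[of "2 * n"]
        by eventually_elim
          (use moment_discrete_approx[OF pos, of n] in \<open>simp add: w_def x_def del: sum.atMost_Suc of_nat_Suc\<close>)
      have "(\<lambda>N. \<nu> 0 * (real n * (2 * real n * inverse (real (Suc N))))) \<longlonglongrightarrow> \<nu> 0 * (real n * (2 * real n * 0))"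
        by (intro tendsto_intros LIMSEQ_inverse_real_of_nat)
      then show "(\<lambda>N. \<nu> 0 * (real n * (2 * real n / real (Suc N)))) \<longlonglongrightarrow> 0"
        by (simp add: divide_inverse)
    qed
    from tendsto_diff[OF tendsto_const[of "\<nu> n"] this] show ?thesis by simp
  qed
  have "G has_fps_expansion fps_expansion G 0"
    by (rule has_fps_expansion_fps_expansion[OF open_ball _ holomorphic_on_subset[OF G(1) sub']]) auto
  also have "fps_expansion G 0 = Abs_fps (\<lambda>n. of_real ((- 1) ^ n * \<nu> n))"
  proof (rule fps_ext)
    fix n
    have "(\<lambda>N. (deriv ^^ n) ((g \<circ> r) N) 0) \<longlonglongrightarrow> (deriv ^^ n) G 0"
      by (rule higher_deriv_complex_uniform_limit[OF unif])
         (auto intro!: always_eventually holomorphic_on_subset[OF hol sub'])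
    then have "(\<lambda>N. (deriv ^^ n) ((g \<circ> r) N) 0 / fact n) \<longlonglongrightarrow> (deriv ^^ n) G 0 / fact n"
      by (intro tendsto_divide tendsto_const) auto
    moreover have "(\<lambda>N. (deriv ^^ n) ((g \<circ> r) N) 0 / fact n) \<longlonglongrightarrow> of_real ((- 1) ^ n * \<nu> n)"
      unfolding o_def coeff
      by (intro tendsto_of_real tendsto_mult tendsto_const)
         (rule LIMSEQ_subseq_LIMSEQ[OF lim G(2), unfolded o_def])
    ultimately show "fps_nth (fps_expansion G 0) n = fps_nth (Abs_fps (\<lambda>n. of_real ((- 1) ^ n * \<nu> n))) n"
      using LIMSEQ_unique by (auto simp: fps_expansion_def)
  qed
  finally show ?thesis using G(1) by blast
qed

text \<open>The identity theorem spreads f' = f q over S. Locally q has a primitive u, and f exp (-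
  u) is constant; a zero of f would make this constant 0, hence f = 0 on a disc and then
  everywhere.\<close>

lemma log_deriv_continuation_nonzero:
  assumes f: "f holomorphic_on UNIV" and q: "q holomorphic_on S" and S: "open S" "connected S" "(0::complex) \<in> S"
    and ev: "eventually (\<lambda>z. deriv f z = f z * q z) (nhds 0)" and f0: "f 0 \<noteq> 0" and z: "z \<in> S"
  shows "f z \<noteq> 0"
proof
  assume fz: "f z = 0"
  obtain T where T: "open T" "0 \<in> T" "\<And>z. z \<in> T \<Longrightarrow> deriv f z = f z * q z"
    using ev by (auto simp: eventually_nhds)
  have eq: "deriv f y = f y * q y" if "y \<in> S" for y
  proof (rule analytic_continuation_open[of "T \<inter> S" S "deriv f" "\<lambda>z. f z * q z"])
    show "deriv f holomorphic_on S" by (rule holomorphic_on_subset[OF holomorphic_deriv[OF f open_UNIV]]) auto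
    show "(\<lambda>z. f z * q z) holomorphic_on S" by (intro holomorphic_intros q holomorphic_on_subset[OF f]) auto
  qed (use T S that in auto)
  obtain e where e: "e > 0" "ball z e \<subseteq> S" using S(1) z by (meson openE)
  obtain u where u: "\<And>y. y \<in> ball z e \<Longrightarrow> (u has_field_derivative q y) (at y within ball z e)"
    using holomorphic_convex_primitive'[OF convex_ball open_ball holomorphic_on_subset[OF q e(2)]] by blast
  have "\<exists>c. \<forall>y\<in>ball z e. f y * exp (- u y) = c"
  proof (rule has_field_derivative_zero_constant[OF convex_ball])
    fix y assume y: "y \<in> ball z e"
    have "(f has_field_derivative deriv f y) (at y within ball z e)"
      by (rule holomorphic_derivI[OF f]) auto
    then have "((\<lambda>y. f y * exp (- u y)) has_field_derivative
       deriv f y * exp (- u y) + f y * (exp (- u y) * (- q y))) (at y within ball z e)"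
      by (auto intro!: derivative_eq_intros u y)
    then show "((\<lambda>y. f y * exp (- u y)) has_field_derivative 0) (at y within ball z e)"
      using eq[of y] e(2) y by (auto simp: mult_ac)
  qed
  then obtain c where c: "\<And>y. y \<in> ball z e \<Longrightarrow> f y * exp (- u y) = c" by blast
  have "f y = 0" if "y \<in> ball z e" for y using c[of z] c[OF that] fz e(1) by simp
  then have "f 0 = 0"
    using analytic_continuation_open[OF open_ball[of z e] open_UNIV _ connected_UNIV subset_UNIV f
        holomorphic_on_const[of 0] _ UNIV_I, of 0] e(1) by auto
  then show False using f0 by simp
qed

section \<open>Moments and the Riemann hypothesis\<close>

text \<open>The h_n of the overview, taken as a formal quotient over the reals, so that the moments
  are visibly real.\<close>

definition xi_log_coeff :: "nat \<Rightarrow> real" where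
  "xi_log_coeff n = fps_nth (fps_deriv (Abs_fps xi_coeff) / Abs_fps xi_coeff) n"

definition xi_moment_real :: "nat \<Rightarrow> real" where
  "xi_moment_real k = (- 1) ^ Suc k * xi_log_coeff (Suc k)"

lemma xi_log_coeff_rec:
  "real (Suc n) * xi_coeff (Suc n) = (\<Sum>i\<le>n. xi_log_coeff i * xi_coeff (n - i))"
proof -
  have "fps_deriv (Abs_fps xi_coeff) / Abs_fps xi_coeff * Abs_fps xi_coeff = fps_deriv (Abs_fps xi_coeff)"
    using xi_coeff_pos[of 0] by (intro dvd_div_mult_self[OF unit_imp_dvd]) (simp add: fps_is_unit_iff)
  from arg_cong[OF this, of "\<lambda>F. fps_nth F n"] show ?thesis
    by (simp add: fps_mult_nth xi_log_coeff_def atLeast0AtMost)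
qed

lemma xi_log_deriv_expansion:
  "(\<lambda>z. deriv xi_series z / xi_series z) has_fps_expansion Abs_fps (\<lambda>n. of_real (xi_log_coeff n))"
proof -
  let ?A = "Abs_fps (\<lambda>n. complex_of_real (xi_coeff n))" and ?H = "Abs_fps (\<lambda>n. complex_of_real (xi_log_coeff n))"
  have A0: "fps_nth ?A 0 \<noteq> 0" using xi_coeff_pos[of 0] by simp
  have "?H * ?A = fps_deriv ?A"
  proof (rule fps_ext)
    fix n
    have "fps_nth (?H * ?A) n = of_real (\<Sum>i\<le>n. xi_log_coeff i * xi_coeff (n - i))"
      by (simp add: fps_mult_nth atLeast0AtMost)
    also have "\<dots> = fps_nth (fps_deriv ?A) n" by (subst xi_log_coeff_rec[symmetric]) simp
    finally show "fps_nth (?H * ?A) n = fps_nth (fps_deriv ?A) n" .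
  qed
  then have "fps_deriv ?A / ?A = ?H * ?A / ?A" by simp
  also have "?A \<noteq> 0" using A0 by force
  then have "?H * ?A / ?A = ?H" by simp
  finally have H: "fps_deriv ?A / ?A = ?H" .
  show ?thesis
    unfolding H[symmetric]
    by (intro has_fps_expansion_divide' has_fps_expansion_deriv xi_series_expansion A0)
qed

lemma has_fps_expansion_imp_eventually_sums:
  fixes f :: "complex \<Rightarrow> complex"
  assumes "f has_fps_expansion F"
  shows "eventually (\<lambda>z. (\<lambda>n. fps_nth F n * z ^ n) sums f z) (nhds 0)"
proof -
  have "eventually (\<lambda>z. z \<in> eball 0 (fps_conv_radius F)) (nhds 0)"
    using assms by (intro eventually_nhds_in_open) (auto simp: has_fps_expansion_def zero_ereal_def)
  moreover have "eventually (\<lambda>z. eval_fps F z = f z) (nhds 0)"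
    using assms by (simp add: has_fps_expansion_def)
  ultimately show ?thesis
  proof eventually_elim
    case (elim z)
    then show ?case using sums_eval_fps[of z F] by (simp add: in_eball_iff)
  qed
qed

lemma xi_series_deriv: "(xi_series has_field_derivative deriv xi_series z) (at z)"
  by (rule holomorphic_derivI[OF xi_series_holomorphic[OF holomorphic_on_ident] open_UNIV UNIV_I])

text \<open>By \<open>Xi_eq\<close> and the chain rule, Xi'/Xi (s) = - 2 s (F'/F) (- s^2). The
  coefficient of s^(2 k + 3) is therefore - 2 (-1)^(k+1) h_(k+1), and the factor - 1/2 in
  \<open>xi_moment\<close> cancels the - 2.\<close>

lemma xi_moment_eq: "xi_moment k = of_real (xi_moment_real k)"
proof -
  define G where "G m = (if odd m then - 2 * (- 1) ^ (m div 2) * complex_of_real (xi_log_coeff (m div 2)) else 0)" for m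
  have "(\<lambda>s. deriv Xi s / Xi s) has_fps_expansion Abs_fps G"
  proof (rule has_fps_expansionI)
    have "filterlim (\<lambda>s::complex. - (s ^ 2)) (nhds 0) (nhds 0)"
    proof -
      have "((\<lambda>s::complex. - (s ^ 2)) \<longlongrightarrow> - (0 ^ 2)) (nhds 0)" by (intro tendsto_intros filterlim_ident)
      then show ?thesis by simp
    qed
    from eventually_compose_filterlim[OF has_fps_expansion_imp_eventually_sums[OF xi_log_deriv_expansion] this]
    show "\<forall>\<^sub>F s in nhds 0. (\<lambda>m. fps_nth (Abs_fps G) m * s ^ m) sums (deriv Xi s / Xi s)"
    proof eventually_elim
      case (elim s)
      have "((\<lambda>s. xi_series (- (s ^ 2))) has_field_derivative deriv xi_series (- (s ^ 2)) * (- (2 * s))) (at s)"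
        by (rule DERIV_chain2[OF xi_series_deriv]) (auto intro!: derivative_eq_intros)
      then have "deriv Xi s = deriv xi_series (- (s ^ 2)) * (- (2 * s))"
        unfolding Xi_eq[abs_def] by (rule DERIV_imp_deriv)
      then have val: "deriv Xi s / Xi s = (- 2 * s) * (deriv xi_series (- (s ^ 2)) / xi_series (- (s ^ 2)))"
        by (simp add: Xi_eq)
      have "(\<lambda>n. (- 2 * s) * (of_real (xi_log_coeff n) * (- (s ^ 2)) ^ n)) sums (deriv Xi s / Xi s)"
        unfolding val using elim by (intro sums_mult) simp
      also have "(\<lambda>n. (- 2 * s) * (of_real (xi_log_coeff n) * (- (s ^ 2)) ^ n)) = (\<lambda>n. G (2 * n + 1) * s ^ (2 * n + 1))"
        by (auto simp: G_def fun_eq_iff power_minus[of "s ^ 2"] power_mult)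
      finally have "(\<lambda>n. (\<lambda>m. G m * s ^ m) (2 * n + 1)) sums (deriv Xi s / Xi s)" .
      then show ?case
        by (subst (asm) sums_mono_reindex) (auto simp: strict_mono_def G_def elim!: oddE)
    qed
  qed
  from fps_nth_fps_expansion[OF this, of "2 * k + 3"]
  have "(deriv ^^ (2 * k + 3)) (\<lambda>s. deriv Xi s / Xi s) 0 / fact (2 * k + 3) = G (2 * k + 3)" by simp
  moreover have "(2 * k + 3) div 2 = Suc k" by simp
  then have "G (2 * k + 3) = - 2 * of_real (xi_moment_real k)"
    by (simp add: G_def xi_moment_real_def)
  moreover have "xi_moment k = - 1 / 2 * ((deriv ^^ (2 * k + 3)) (\<lambda>s. deriv Xi s / Xi s) 0 / fact (2 * k + 3))"
    unfolding xi_moment_def by (simp del: fact_Suc funpow.simps)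
  ultimately show ?thesis by simp
qed

text \<open>In the convolution for a_(n+2) the term i = 0, with h_0 = a_1 / a_0, produces a_1
  a_(n+1) / a_0^2, and the term i = n + 1 carries the unknown moment.\<close>

lemma xi_moment_real_rec:
  "(- 1) ^ n * xi_moment_real n =
     xi_coeff 1 * xi_coeff (n + 1) / (xi_coeff 0)\<^sup>2 - real (n + 2) * xi_coeff (n + 2) / xi_coeff 0
     - (\<Sum>k<n. (- 1) ^ k * xi_moment_real k * xi_coeff (n - k) / xi_coeff 0)"
proof -
  have a0: "xi_coeff 0 \<noteq> 0" using xi_coeff_pos[of 0] by simp
  have h: "xi_log_coeff (Suc k) = - ((- 1) ^ k * xi_moment_real k)" for k
    by (simp add: xi_moment_real_def power_mult_distrib[symmetric])
  have h0: "xi_log_coeff 0 = xi_coeff 1 / xi_coeff 0"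
    using xi_log_coeff_rec[of 0] a0 by (simp add: field_simps)
  have "real (n + 2) * xi_coeff (n + 2) = (\<Sum>i\<le>Suc n. xi_log_coeff i * xi_coeff (Suc n - i))"
    using xi_log_coeff_rec[of "Suc n"] by simp
  also have "\<dots> = xi_log_coeff 0 * xi_coeff (n + 1) + (\<Sum>k\<le>n. xi_log_coeff (Suc k) * xi_coeff (n - k))"
    by (subst sum.atMost_Suc_shift) simp
  also have "(\<Sum>k\<le>n. xi_log_coeff (Suc k) * xi_coeff (n - k)) =
      - (\<Sum>k<n. (- 1) ^ k * xi_moment_real k * xi_coeff (n - k)) - (- 1) ^ n * xi_moment_real n * xi_coeff 0"
    unfolding h lessThan_Suc_atMost[symmetric] by (simp add: sum_negf)
  finally have "(- 1) ^ n * xi_moment_real n * xi_coeff 0 = xi_coeff 1 / xi_coeff 0 * xi_coeff (n + 1)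
      - real (n + 2) * xi_coeff (n + 2) - (\<Sum>k<n. (- 1) ^ k * xi_moment_real k * xi_coeff (n - k))"
    unfolding h0 by linarith
  then have "(- 1) ^ n * xi_moment_real n = (xi_coeff 1 / xi_coeff 0 * xi_coeff (n + 1)
      - real (n + 2) * xi_coeff (n + 2) - (\<Sum>k<n. (- 1) ^ k * xi_moment_real k * xi_coeff (n - k))) / xi_coeff 0"
    by (rule eq_divide_imp[OF a0])
  also have "\<dots> = xi_coeff 1 * xi_coeff (n + 1) / (xi_coeff 0)\<^sup>2 - real (n + 2) * xi_coeff (n + 2) / xi_coeff 0
     - (\<Sum>k<n. (- 1) ^ k * xi_moment_real k * xi_coeff (n - k)) / xi_coeff 0"
    by (simp add: diff_divide_distrib power2_eq_square)
  finally show ?thesis by (simp only: sum_divide_distrib)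
qed

text \<open>The recursions up to n form a linear system with unit lower triangular matrix T and
  unknowns (-1)^k m_k. As det T = 1, the last unknown is the determinant with the last column
  replaced by the right-hand side.\<close>

lemma xi_moment_real_det: "(- 1) ^ n * xi_moment_real n = Determinant.det (xi_matrix n)"
proof -
  define T where "T = mat (n + 1) (n + 1) (\<lambda>(i, j). if j \<le> i then xi_coeff (i - j) / xi_coeff 0 else 0)"
  define y where "y = vec (n + 1) (\<lambda>k. (- 1) ^ k * xi_moment_real k)"
  have a0: "xi_coeff 0 \<noteq> 0" using xi_coeff_pos[of 0] by simp
  have T: "T \<in> carrier_mat (n + 1) (n + 1)" and y: "y \<in> carrier_vec (n + 1)" by (auto simp: T_def y_def)
  have Ty: "vec_index (T *\<^sub>v y) i = xi_coeff 1 * xi_coeff (i + 1) / (xi_coeff 0)\<^sup>2 - real (i + 2) * xi_coeff (i + 2) / xi_coeff 0"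
    if "i < n + 1" for i
  proof -
    have "vec_index (T *\<^sub>v y) i = (\<Sum>k<n+1. (if k \<le> i then xi_coeff (i - k) / xi_coeff 0 else 0) * ((- 1) ^ k * xi_moment_real k))"
      using that by (simp add: T_def y_def scalar_prod_def lessThan_atLeast0)
    also have "\<dots> = (\<Sum>k<Suc i. (if k \<le> i then xi_coeff (i - k) / xi_coeff 0 else 0) * ((- 1) ^ k * xi_moment_real k))"
      by (rule sum.mono_neutral_right) (use that in auto)
    also have "\<dots> = (\<Sum>k<i. (- 1) ^ k * xi_moment_real k * xi_coeff (i - k) / xi_coeff 0) + (- 1) ^ i * xi_moment_real i"
      using a0 by (simp add: mult_ac)
    finally show ?thesis using xi_moment_real_rec[of i] by simp
  qed
  have "xi_matrix n = replace_col T (T *\<^sub>v y) n"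
  proof (rule eq_matI)
    fix i j assume "i < dim_row (replace_col T (T *\<^sub>v y) n)" "j < dim_col (replace_col T (T *\<^sub>v y) n)"
    then have ij: "i < n + 1" "j < n + 1" by (auto simp: replace_col_def T_def)
    show "xi_matrix n $$ (i, j) = replace_col T (T *\<^sub>v y) n $$ (i, j)"
      using ij Ty[of i] by (auto simp: replace_col_def xi_matrix_def T_def)
  qed (auto simp: replace_col_def xi_matrix_def T_def)
  moreover have "Determinant.det T = 1"
  proof -
    have "Determinant.det T = prod_list (diag_mat T)"
      by (rule det_lower_triangular[OF _ T]) (auto simp: T_def)
    also have "diag_mat T = map (\<lambda>_. 1) [0..<n + 1]"
      using a0 by (auto simp: diag_mat_def T_def)
    also have "prod_list \<dots> = (1 :: real)" by (induction n) auto
    finally show ?thesis .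
  qed
  ultimately show ?thesis using cramer_lemma_mat[OF T y, of n] by (simp add: y_def)
qed

lemma xi_series_nonzero_at_0: "xi_series 0 \<noteq> 0"
  using xi_coeff_pos[of 0] by (simp add: xi_series_0)

lemma eventually_xi_series_nonzero: "eventually (\<lambda>z. xi_series z \<noteq> 0) (nhds 0)"
proof -
  have "(xi_series \<longlongrightarrow> xi_series 0) (nhds 0)"
    using DERIV_isCont[OF xi_series_deriv[of 0]] by (simp add: isCont_def tendsto_at_iff_tendsto_nhds)
  then show ?thesis
    by (rule tendsto_imp_eventually_ne) (rule xi_series_nonzero_at_0)
qed

section \<open>From complete monotonicity to the Riemann hypothesis\<close>

lemma xi_zero_imp_real_if_completely_monotone:
  assumes L: "L > 0" and pos: "\<And>n k. moment_diff (\<lambda>n. xi_moment_real n / L ^ n) n k \<ge> 0"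
    and zero: "Xi s = 0"
  shows "s \<in> \<real>"
proof -
  obtain G where G: "G holomorphic_on slit_plane"
    "G has_fps_expansion Abs_fps (\<lambda>n. of_real ((- 1) ^ n * (xi_moment_real n / L ^ n)))"
    using completely_monotone_continuation[OF pos] by blast
  define S where "S = (\<lambda>z. of_real L * z) -` slit_plane"
  \<comment> \<open>G (L z) has the Taylor coefficients (-1)^n m_n = - h_(n+1), so q has the Taylor
    series of F'/F at 0.\<close>
  define q where "q z = of_real (xi_log_coeff 0) - z * G (of_real L * z)" for z
  have "open S" unfolding S_def
    by (intro open_vimage open_slit_plane continuous_intros)
  have sl0: "(0::complex) \<in> slit_plane" by (simp add: slit_plane_def)
  \<comment> \<open>The removed ray is stable under multiplication by factors \<ge> 1, so a segment
    from 0 to a point of S cannot meet it. This gives the connectedness that the identity theorem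
    demands.\<close>
  have "starlike S" unfolding starlike_def
  proof (intro bexI ballI subsetI)
    show "0 \<in> S" using sl0 by (simp add: S_def)
    fix z w assume z: "z \<in> S" and "w \<in> closed_segment 0 z"
    then obtain u where u: "0 \<le> u" "u \<le> 1" "w = of_real u * z"
      by (auto simp: closed_segment_def scaleR_conv_of_real)
    show "w \<in> S"
    proof (rule ccontr)
      assume "w \<notin> S"
      then have a: "u * (L * Im z) = 0" "u * (L * Re z) \<le> - 1"
        using u by (auto simp: S_def slit_plane_def mult_ac)
      then have "u > 0" using u by (cases "u = 0") auto
      then have im: "L * Im z = 0" using a(1) by simp
      have neg: "L * Re z < 0"
      proof (rule ccontr)
        assume "\<not> L * Re z < 0"
        then have "0 \<le> L * Re z" by simp
        then have "0 \<le> u * (L * Re z)" by (rule mult_nonneg_nonneg[OF u(1)])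
        then show False using a(2) by linarith
      qed
      have "L * Re z \<le> u * (L * Re z)"
        using mult_right_mono_neg[of u 1 "L * Re z"] u(2) neg by simp
      then have "of_real L * z \<notin> slit_plane" using a(2) im by (auto simp: slit_plane_def)
      then show False using z by (simp add: S_def)
    qed
  qed
  then have "connected S" by (rule starlike_imp_connected)
  have "q holomorphic_on S" unfolding q_def
    by (intro holomorphic_intros holomorphic_on_compose_gen[OF _ G(1), unfolded o_def]) (auto simp: S_def)
  have ev: "eventually (\<lambda>z. deriv xi_series z = xi_series z * q z) (nhds 0)"
  proof -
    have "((\<lambda>z. of_real L * z) \<longlongrightarrow> of_real L * 0) (nhds (0::complex))" by (intro tendsto_intros filterlim_ident)
    then have lim: "filterlim (\<lambda>z. of_real L * z) (nhds 0) (nhds (0::complex))" by simp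
    from has_fps_expansion_imp_eventually_sums[OF xi_log_deriv_expansion]
      eventually_compose_filterlim[OF has_fps_expansion_imp_eventually_sums[OF G(2)] lim]
      eventually_xi_series_nonzero
    show ?thesis
    proof eventually_elim
      case (elim z)
      have "(\<lambda>n. of_real (xi_log_coeff (Suc n)) * z ^ Suc n) sums (- (z * G (of_real L * z)))"
      proof -
        have "(\<lambda>n. - z * (of_real ((- 1) ^ n * (xi_moment_real n / L ^ n)) * (of_real L * z) ^ n)) sums (- z * G (of_real L * z))"
          using elim(2) by (intro sums_mult) simp
        moreover have "- z * (of_real ((- 1) ^ n * (xi_moment_real n / L ^ n)) * (of_real L * z) ^ n)
            = of_real (xi_log_coeff (Suc n)) * z ^ Suc n" for n
        proof -
          have "xi_log_coeff (Suc n) = - ((- 1) ^ n * xi_moment_real n)"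
            by (simp add: xi_moment_real_def power_mult_distrib[symmetric])
          then show ?thesis using L by (simp add: power_mult_distrib)
        qed
        ultimately show ?thesis by simp
      qed
      then have "(\<lambda>n. of_real (xi_log_coeff n) * z ^ n) sums (- (z * G (of_real L * z)) + of_real (xi_log_coeff 0))"
        by (subst (asm) sums_Suc_iff) simp
      then have "deriv xi_series z / xi_series z = q z"
        using elim(1) sums_unique2 by (fastforce simp: q_def)
      then show ?case using elim(3) by (simp add: field_simps)
    qed
  qed
  have "xi_series holomorphic_on UNIV" by (intro holomorphic_intros)
  have "xi_series z \<noteq> 0" if "z \<in> S" for z
    by (rule log_deriv_continuation_nonzero[OF \<open>xi_series holomorphic_on UNIV\<close> \<open>q holomorphic_on S\<close>
        \<open>open S\<close> \<open>connected S\<close> _ ev xi_series_nonzero_at_0 that]) (use sl0 in \<open>simp add: S_def\<close>)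
  \<comment> \<open>A zero of F lies on the slit, so L s^2 is real and at least 1. Hence Re s Im s =
    0, and s^2 > 0 leaves only Im s = 0.\<close>
  then have "of_real L * - (s ^ 2) \<notin> slit_plane" using zero by (auto simp: Xi_eq S_def)
  then have "L * (2 * Re s * Im s) = 0" "L * ((Re s)\<^sup>2 - (Im s)\<^sup>2) \<ge> 1"
    by (auto simp: slit_plane_def power2_eq_square algebra_simps)
  then have im: "Re s * Im s = 0" and re: "L * ((Re s)\<^sup>2 - (Im s)\<^sup>2) \<ge> 1"
    using L by auto
  have "(Re s)\<^sup>2 - (Im s)\<^sup>2 > 0"
  proof (rule ccontr)
    assume "\<not> (Re s)\<^sup>2 - (Im s)\<^sup>2 > 0"
    then have "L * ((Re s)\<^sup>2 - (Im s)\<^sup>2) \<le> 0" using L by (intro mult_nonneg_nonpos) auto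
    then show False using re by linarith
  qed
  moreover have "(Im s)\<^sup>2 \<ge> 0" by simp
  ultimately have "Re s \<noteq> 0" by (metis diff_gt_0_iff_gt not_less power_zero_numeral)
  then have "Im s = 0" using im by simp
  then show ?thesis by (simp add: complex_is_Real_iff)
qed

section \<open>From the Riemann hypothesis to complete monotonicity\<close>

lemma moment_diff_power:
  "(\<Sum>j\<le>k. (- 1) ^ j * real (k choose j) * y ^ (n + j)) = y ^ n * (1 - y) ^ k"
proof -
  have "(1 - y) ^ k = (\<Sum>j\<le>k. real (k choose j) * (- y) ^ j * 1 ^ (k - j))"
    using binomial_ring[of "- y" 1 k] by simp
  also have "\<dots> = (\<Sum>j\<le>k. (- 1) ^ j * real (k choose j) * y ^ j)"
    by (intro sum.cong) (auto simp: power_minus[of y])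
  finally show ?thesis by (simp add: sum_distrib_left power_add mult_ac)
qed

text \<open>Under RH a zero a of F is - t^2 with t = \<open>csqrt (- a)\<close> real, so a^n =
  (-1)^n |a|^n, and this sign cancels the one in \<open>xi_moment_real\<close>. The nodes are 1 /
  |a|, and the exponent k + 2 is that of a in the power sum for h_(k+1).\<close>

lemma xi_moment_power_sum_approx:
  assumes RH: riemann_hypothesis and m: "m \<ge> 1"
    and \<delta>: "\<delta> > 0" "\<And>z. norm z < \<delta> \<Longrightarrow> xi_series z \<noteq> 0"
  shows "\<exists>Z c x. finite (Z :: complex set) \<and> (\<forall>a\<in>Z. 0 \<le> c a \<and> 0 \<le> x a \<and> x a \<le> 1 / \<delta>) \<and>
    (\<forall>k. \<bar>xi_moment_real k - (\<Sum>a\<in>Z. c a * x a ^ (k + 2))\<bar>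
       \<le> real (k + 2) * (2 * ln (2 * (pi ^ 2 / 6 * (2 * real m) * real m ^ m) / xi_coeff 0))
          * (4 / (2 * real m - 1 / 2) ^ 2) ^ (k + 2))"
proof -
  \<comment> \<open>Half the radius of \<open>norm_xi_series_growth\<close>, since
    \<open>log_deriv_coeff_approx\<close> bounds the function on the circle of radius 2 R.\<close>
  define R where "R = (2 * real m - 1 / 2) ^ 2 / 2"
  define B where "B = pi ^ 2 / 6 * (2 * real m) * real m ^ m"
  have R: "R > 0" using m by (simp add: R_def)
  have "\<exists>Z N. finite Z \<and> (\<forall>a\<in>Z. xi_series a = 0) \<and>
    (\<forall>n. norm (fps_nth (Abs_fps (\<lambda>n. of_real (xi_log_coeff n))) n + (\<Sum>a\<in>Z. of_nat (N a) / a ^ Suc n))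
      \<le> real (Suc n) * (2 * ln (2 * B / norm (xi_series 0))) * (2 / R) ^ Suc n)"
    by (intro log_deriv_coeff_approx R xi_log_deriv_expansion xi_series_nonzero_at_0 holomorphic_intros)
       (use m norm_xi_series_growth in \<open>auto simp: B_def R_def\<close>)
  then obtain Z N where Z: "finite Z" "\<And>a. a \<in> Z \<Longrightarrow> xi_series a = 0"
    and bd: "\<And>n. norm (of_real (xi_log_coeff n) + (\<Sum>a\<in>Z. of_nat (N a) / a ^ Suc n))
      \<le> real (Suc n) * (2 * ln (2 * B / norm (xi_series 0))) * (2 / R) ^ Suc n"
    by auto
  have neg: "a = - of_real (norm a) \<and> norm a \<ge> \<delta>" if "a \<in> Z" for a
  proof -
    have "Xi (csqrt (- a)) = 0" using Z(2)[OF that] by (simp add: Xi_eq)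
    then have "csqrt (- a) \<in> \<real>" using RH by (simp add: riemann_hypothesis_def)
    then obtain t where t: "csqrt (- a) = of_real t" by (auto elim: Reals_cases)
    have "a = - (csqrt (- a) ^ 2)" by simp
    then have a: "a = - of_real (t ^ 2)" unfolding t by simp
    then have "norm a = t ^ 2" by (simp add: norm_power)
    moreover have "norm a \<ge> \<delta>" using \<delta>(2)[of a] Z(2)[OF that] by force
    ultimately show ?thesis using a by simp
  qed
  define x where "x a = 1 / norm a" for a :: complex
  have eq: "of_nat (N a) / a ^ n = (- 1) ^ n * of_real (real (N a) * x a ^ n)" if "a \<in> Z" for a n
  proof -
    have "a ^ n = (- of_real (norm a)) ^ n" using neg[OF that] by (intro arg_cong[where f = "\<lambda>z. z ^ n"]) blast
    also have "\<dots> = (- 1) ^ n * of_real (norm a ^ n)" by (subst power_minus) simp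
    finally have an: "a ^ n = (- 1) ^ n * of_real (norm a ^ n)" .
    show ?thesis unfolding an x_def by (cases "even n") (simp_all add: power_divide)
  qed
  have "\<bar>xi_moment_real k - (\<Sum>a\<in>Z. real (N a) * x a ^ (k + 2))\<bar>
      \<le> real (k + 2) * (2 * ln (2 * B / xi_coeff 0)) * (4 / (2 * real m - 1 / 2) ^ 2) ^ (k + 2)" for k
  proof -
    define s where "s = (\<Sum>a\<in>Z. real (N a) * x a ^ (k + 2))"
    have "(\<Sum>a\<in>Z. of_nat (N a) / a ^ Suc (Suc k)) = of_real ((- 1) ^ k * s)"
    proof -
      have "(\<Sum>a\<in>Z. of_nat (N a) / a ^ Suc (Suc k)) =
          (\<Sum>a\<in>Z. (- 1) ^ Suc (Suc k) * complex_of_real (real (N a) * x a ^ Suc (Suc k)))"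
        by (intro sum.cong refl eq)
      then show ?thesis by (simp add: s_def sum_distrib_left)
    qed
    then have "norm (of_real (xi_log_coeff (Suc k)) + complex_of_real ((- 1) ^ k * s))
      \<le> real (Suc (Suc k)) * (2 * ln (2 * B / norm (xi_series 0))) * (2 / R) ^ Suc (Suc k)"
      using bd[of "Suc k"] by simp
    also have "of_real (xi_log_coeff (Suc k)) + complex_of_real ((- 1) ^ k * s) =
        of_real (- ((- 1) ^ k * (xi_moment_real k - s)))"
      by (simp add: xi_moment_real_def algebra_simps power_mult_distrib[symmetric] flip: mult.assoc)
    also have "norm \<dots> = \<bar>xi_moment_real k - s\<bar>"
      by (simp only: norm_of_real abs_minus_cancel abs_mult power_abs abs_one power_one mult_1_left)
    also have "norm (xi_series 0) = xi_coeff 0" using xi_coeff_pos[of 0] by (simp add: xi_series_0)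
    also have "2 / R = 4 / (2 * real m - 1 / 2) ^ 2" by (simp add: R_def)
    finally show ?thesis by (simp add: s_def)
  qed
  moreover have "\<forall>a\<in>Z. 0 \<le> real (N a) \<and> 0 \<le> x a \<and> x a \<le> 1 / \<delta>"
    using neg \<delta>(1) by (auto simp: x_def intro!: divide_left_mono mult_pos_pos dest: order_less_le_trans)
  ultimately show ?thesis using Z(1) unfolding B_def by (intro exI[of _ Z] exI[of _ "\<lambda>a. real (N a)"] exI[of _ x]) simp
qed

text \<open>The logarithm grows like m ln m, and a single factor 4 / (2 m - 1/2)^2 already outweighs
  it; the other k + 1 factors tend to 0 as well.\<close>

lemma power_sum_error_tendsto_0:
  assumes "a > 0"
  shows "(\<lambda>m. real (k + 2) * (2 * ln (2 * (pi ^ 2 / 6 * (2 * real m) * real m ^ m) / a))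
          * (4 / (2 * real m - 1 / 2) ^ 2) ^ (k + 2)) \<longlonglongrightarrow> 0"
proof -
  define C where "C = ln (2 * (pi ^ 2 / 6 * 2) / a)"
  have C: "eventually (\<lambda>m. ln (2 * (pi ^ 2 / 6 * (2 * real m) * real m ^ m) / a) = C + ln (real m) + real m * ln (real m)) sequentially"
    using eventually_gt_at_top[of 0]
  proof eventually_elim
    case (elim m)
    define b where "b = 2 * (pi ^ 2 / 6 * 2) / a"
    have b: "b > 0" using assms by (simp add: b_def)
    have "2 * (pi ^ 2 / 6 * (2 * real m) * real m ^ m) / a = b * real m * real m ^ m" by (simp add: b_def)
    then have "ln (2 * (pi ^ 2 / 6 * (2 * real m) * real m ^ m) / a) = ln (b * real m * real m ^ m)"
      by (rule arg_cong)
    also have "\<dots> = ln (b * real m) + ln (real m ^ m)" using b elim by (intro ln_mult_pos) auto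
    also have "ln (b * real m) = C + ln (real m)" unfolding C_def b_def[symmetric] using b elim by (intro ln_mult_pos) auto
    finally show ?case using elim by (simp add: ln_realpow)
  qed
  have 1: "(\<lambda>m. (C + ln (real m) + real m * ln (real m)) * (4 / (2 * real m - 1 / 2) ^ 2)) \<longlonglongrightarrow> 0"
    by real_asymp
  have 2: "(\<lambda>m. (4 / (2 * real m - 1 / 2) ^ 2) ^ (k + 1)) \<longlonglongrightarrow> 0"
  proof -
    have "(\<lambda>m. 4 / (2 * real m - 1 / 2) ^ 2) \<longlonglongrightarrow> 0" by real_asymp
    from tendsto_power[OF this, of "k + 1"] show ?thesis by simp
  qed
  have "(\<lambda>m. real (k + 2) * 2 * (((C + ln (real m) + real m * ln (real m)) * (4 / (2 * real m - 1 / 2) ^ 2))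
      * (4 / (2 * real m - 1 / 2) ^ 2) ^ (k + 1))) \<longlonglongrightarrow> real (k + 2) * 2 * (0 * 0)"
    by (intro tendsto_mult tendsto_const 1 2)
  then have "(\<lambda>m. real (k + 2) * 2 * (((C + ln (real m) + real m * ln (real m)) * (4 / (2 * real m - 1 / 2) ^ 2))
      * (4 / (2 * real m - 1 / 2) ^ 2) ^ (k + 1))) \<longlonglongrightarrow> 0" by simp
  moreover have "eventually (\<lambda>m. real (k + 2) * 2 * (((C + ln (real m) + real m * ln (real m)) * (4 / (2 * real m - 1 / 2) ^ 2))
      * (4 / (2 * real m - 1 / 2) ^ 2) ^ (k + 1)) =
      real (k + 2) * (2 * ln (2 * (pi ^ 2 / 6 * (2 * real m) * real m ^ m) / a))
          * (4 / (2 * real m - 1 / 2) ^ 2) ^ (k + 2)) sequentially"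
    using C
  proof eventually_elim
    case (elim m)
    have "(4 / (2 * real m - 1 / 2) ^ 2) ^ (k + 2) = (4 / (2 * real m - 1 / 2) ^ 2) * (4 / (2 * real m - 1 / 2) ^ 2) ^ (k + 1)"
      by simp
    then show ?case unfolding elim by (simp only: mult_ac)
  qed
  ultimately show ?thesis by (rule Lim_transform_eventually)
qed

text \<open>A difference involves only finitely many moments, so it is the limit of the differences
  of the approximating sums. A node x contributes c x^2 (x / L)^n (1 - x / L)^k, which is
  nonnegative because x \<le> 1 / \<delta> \<le> L.\<close>

lemma completely_monotone_if_RH:
  assumes RH: riemann_hypothesis
    and \<delta>: "\<delta> > 0" "\<And>z. norm z < \<delta> \<Longrightarrow> xi_series z \<noteq> 0" and L: "L \<ge> 1 / \<delta>"
  shows "moment_diff (\<lambda>n. xi_moment_real n / L ^ n) n k \<ge> 0"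
proof -
  have Lpos: "L > 0" using \<delta>(1) L by (meson less_le_trans zero_less_divide_1_iff)
  define e where "e p m = real (p + 2) * (2 * ln (2 * (pi ^ 2 / 6 * (2 * real m) * real m ^ m) / xi_coeff 0))
          * (4 / (2 * real m - 1 / 2) ^ 2) ^ (p + 2)" for p m
  \<comment> \<open>With the guard \<open>m \<ge> 1\<close> inside the existential, choice yields Z,
    c and x as functions on all natural numbers.\<close>
  have "\<exists>Z c x. m \<ge> 1 \<longrightarrow> finite (Z :: complex set) \<and> (\<forall>a\<in>Z. 0 \<le> c a \<and> 0 \<le> x a \<and> x a \<le> 1 / \<delta>) \<and>
    (\<forall>p. \<bar>xi_moment_real p - (\<Sum>a\<in>Z. c a * x a ^ (p + 2))\<bar> \<le> e p m)" for m
  proof (cases "m \<ge> 1")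
    case True
    show ?thesis
      using xi_moment_power_sum_approx[OF RH True \<delta>] unfolding e_def by (simp only: True simp_thms)
  qed auto
  then have "\<forall>m. \<exists>Z c x. m \<ge> 1 \<longrightarrow> finite (Z :: complex set) \<and> (\<forall>a\<in>Z. 0 \<le> c a \<and> 0 \<le> x a \<and> x a \<le> 1 / \<delta>) \<and>
    (\<forall>p. \<bar>xi_moment_real p - (\<Sum>a\<in>Z. c a * x a ^ (p + 2))\<bar> \<le> e p m)"
    by (rule allI)
  then obtain Z c x where Zcx: "\<forall>m. m \<ge> 1 \<longrightarrow> finite (Z m :: complex set) \<and>
      (\<forall>a\<in>Z m. 0 \<le> c m a \<and> 0 \<le> x m a \<and> x m a \<le> 1 / \<delta>) \<and>
      (\<forall>p. \<bar>xi_moment_real p - (\<Sum>a\<in>Z m. c m a * x m a ^ (p + 2))\<bar> \<le> e p m)"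
    unfolding choice_iff by blast
  have cx: "0 \<le> c m a \<and> 0 \<le> x m a \<and> x m a \<le> 1 / \<delta>" if "m \<ge> 1" "a \<in> Z m" for m a
    using Zcx that by blast
  have bd: "\<bar>xi_moment_real p - (\<Sum>a\<in>Z m. c m a * x m a ^ (p + 2))\<bar> \<le> e p m" if "m \<ge> 1" for m p
    using Zcx that by blast
  have lim: "(\<lambda>m. \<Sum>a\<in>Z m. c m a * x m a ^ (p + 2)) \<longlonglongrightarrow> xi_moment_real p" for p
  proof -
    have "(\<lambda>m. xi_moment_real p - (\<Sum>a\<in>Z m. c m a * x m a ^ (p + 2))) \<longlonglongrightarrow> 0"
    proof (rule Lim_null_comparison)
      show "\<forall>\<^sub>F m in sequentially. norm (xi_moment_real p - (\<Sum>a\<in>Z m. c m a * x m a ^ (p + 2))) \<le> e p m"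
        using eventually_ge_at_top[of 1] by eventually_elim (use bd in simp)
      show "e p \<longlonglongrightarrow> 0" unfolding e_def[abs_def]
        by (rule power_sum_error_tendsto_0[OF xi_coeff_pos])
    qed
    from tendsto_diff[OF tendsto_const[of "xi_moment_real p"] this] show ?thesis by simp
  qed
  have "(\<lambda>m. moment_diff (\<lambda>p. (\<Sum>a\<in>Z m. c m a * x m a ^ (p + 2)) / L ^ p) n k)
      \<longlonglongrightarrow> moment_diff (\<lambda>p. xi_moment_real p / L ^ p) n k"
    unfolding moment_diff_def by (intro tendsto_intros lim) (use Lpos in auto)
  moreover have "eventually (\<lambda>m. moment_diff (\<lambda>p. (\<Sum>a\<in>Z m. c m a * x m a ^ (p + 2)) / L ^ p) n k \<ge> 0) sequentially"
    using eventually_ge_at_top[of 1]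
  proof eventually_elim
    case (elim m)
    have "moment_diff (\<lambda>p. (\<Sum>a\<in>Z m. c m a * x m a ^ (p + 2)) / L ^ p) n k
      = (\<Sum>j\<le>k. \<Sum>a\<in>Z m. c m a * x m a ^ 2 * ((- 1) ^ j * real (k choose j) * (x m a / L) ^ (n + j)))"
      unfolding moment_diff_def sum_divide_distrib sum_distrib_left
      by (intro sum.cong refl) (simp add: power_add power_divide power2_eq_square mult_ac)
    also have "\<dots> = (\<Sum>a\<in>Z m. c m a * x m a ^ 2 * (\<Sum>j\<le>k. (- 1) ^ j * real (k choose j) * (x m a / L) ^ (n + j)))"
      by (subst sum.swap) (simp add: sum_distrib_left)
    also have "\<dots> = (\<Sum>a\<in>Z m. c m a * x m a ^ 2 * ((x m a / L) ^ n * (1 - x m a / L) ^ k))"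
      by (simp only: moment_diff_power)
    also have "\<dots> \<ge> 0"
    proof (intro sum_nonneg mult_nonneg_nonneg zero_le_power)
      fix a assume a: "a \<in> Z m"
      have "x m a \<le> L" using cx[OF elim a] L by linarith
      then show "0 \<le> 1 - x m a / L" using Lpos by (simp add: divide_le_eq)
    qed (use cx[OF elim] Lpos in auto)
    finally show ?case .
  qed
  ultimately show ?thesis by (intro tendsto_lowerbound[where F = sequentially]) auto
qed

text \<open>The moments are real, so membership in the nonnegative reals reduces to a sign.\<close>

lemma xi_moment_alternating_sum:
  assumes "L > 0"
  shows "(\<Sum>j\<le>k. (- 1) ^ j * of_nat (k choose j) * (xi_moment (n + j) / of_real L ^ (n + j))) \<in> \<real>\<^sub>\<ge>\<^sub>0
    \<longleftrightarrow> moment_diff (\<lambda>n. xi_moment_real n / L ^ n) n k \<ge> 0"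
proof -
  have "(\<Sum>j\<le>k. (- 1) ^ j * of_nat (k choose j) * (xi_moment (n + j) / of_real L ^ (n + j)))
      = complex_of_real (moment_diff (\<lambda>n. xi_moment_real n / L ^ n) n k)"
    by (simp add: moment_diff_def xi_moment_eq)
  then show ?thesis by (simp only: nonneg_Reals_of_real_iff)
qed

theorem corollary6:
  shows
    "(\<forall>s::complex. (\<lambda>n. of_real (xi_coeff n) * s ^ (2 * n)) sums riemann_xi (1 / 2 + s)) \<and>
     (\<forall>n. xi_coeff n > 0) \<and>
     (\<forall>n. xi_moment n = (- 1) ^ n * of_real (Determinant.det (xi_matrix n))) \<and>
     (\<forall>n. (- 1) ^ n * xi_moment n =
        of_real (xi_coeff 1 * xi_coeff (n + 1) / (xi_coeff 0)\<^sup>2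
                 - real (n + 2) * xi_coeff (n + 2) / xi_coeff 0)
        - (\<Sum>k<n. (- 1) ^ k * xi_moment k * of_real (xi_coeff (n - k)) / of_real (xi_coeff 0))) \<and>
     (riemann_hypothesis \<longleftrightarrow>
        (\<exists>L::real. L > 0 \<and> L > 1 / (Re xi_first_zero)\<^sup>2 \<and>
           (\<forall>n k. (\<Sum>j\<le>k. (- 1) ^ j * of_nat (k choose j) *
                     (xi_moment (n + j) / of_real L ^ (n + j))) \<in> \<real>\<^sub>\<ge>\<^sub>0)))"
proof (intro conjI allI)
  show "(\<lambda>n. of_real (xi_coeff n) * s ^ (2 * n)) sums riemann_xi (1 / 2 + s)" for s
    by (rule riemann_xi_sums)
  show "xi_coeff n > 0" for n by (rule xi_coeff_pos)
  show "xi_moment n = (- 1) ^ n * of_real (Determinant.det (xi_matrix n))" for n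
    unfolding xi_moment_real_det[symmetric] xi_moment_eq
    by (simp add: power_mult_distrib[symmetric] flip: mult.assoc)
  show "(- 1) ^ n * xi_moment n =
        of_real (xi_coeff 1 * xi_coeff (n + 1) / (xi_coeff 0)\<^sup>2
                 - real (n + 2) * xi_coeff (n + 2) / xi_coeff 0)
        - (\<Sum>k<n. (- 1) ^ k * xi_moment k * of_real (xi_coeff (n - k)) / of_real (xi_coeff 0))" for n
    using arg_cong[OF xi_moment_real_rec[of n], of complex_of_real] by (simp add: xi_moment_eq)
  show "riemann_hypothesis \<longleftrightarrow>
        (\<exists>L::real. L > 0 \<and> L > 1 / (Re xi_first_zero)\<^sup>2 \<and>
           (\<forall>n k. (\<Sum>j\<le>k. (- 1) ^ j * of_nat (k choose j) *
                     (xi_moment (n + j) / of_real L ^ (n + j))) \<in> \<real>\<^sub>\<ge>\<^sub>0))"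
  proof
    assume RH: riemann_hypothesis
    obtain \<delta> where \<delta>: "\<delta> > 0" "\<And>z. norm z < \<delta> \<Longrightarrow> xi_series z \<noteq> 0"
      using eventually_xi_series_nonzero unfolding eventually_nhds_metric by auto
    \<comment> \<open>The entry 1 / \<delta> brings every node 1 / |a| below L; the other entry,
      with its + 1, gives the strict lower bound on L.\<close>
    define L where "L = max (1 / \<delta>) (1 / (Re xi_first_zero)\<^sup>2 + 1)"
    have "1 / \<delta> \<le> L" by (simp add: L_def)
    moreover have L0: "L > 0" using \<delta>(1) by (simp add: L_def less_max_iff_disj)
    ultimately have "\<forall>n k. (\<Sum>j\<le>k. (- 1) ^ j * of_nat (k choose j) *
                     (xi_moment (n + j) / of_real L ^ (n + j))) \<in> \<real>\<^sub>\<ge>\<^sub>0"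
      unfolding xi_moment_alternating_sum[OF L0] using completely_monotone_if_RH[OF RH \<delta>] by blast
    moreover have "L > 1 / (Re xi_first_zero)\<^sup>2" by (simp add: L_def less_max_iff_disj)
    ultimately show "\<exists>L::real. L > 0 \<and> L > 1 / (Re xi_first_zero)\<^sup>2 \<and>
           (\<forall>n k. (\<Sum>j\<le>k. (- 1) ^ j * of_nat (k choose j) *
                     (xi_moment (n + j) / of_real L ^ (n + j))) \<in> \<real>\<^sub>\<ge>\<^sub>0)"
      using L0 by blast
  next
    assume "\<exists>L::real. L > 0 \<and> L > 1 / (Re xi_first_zero)\<^sup>2 \<and>
           (\<forall>n k. (\<Sum>j\<le>k. (- 1) ^ j * of_nat (k choose j) *
                     (xi_moment (n + j) / of_real L ^ (n + j))) \<in> \<real>\<^sub>\<ge>\<^sub>0)"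
    then obtain L :: real where L: "L > 0"
      "\<And>n k. moment_diff (\<lambda>n. xi_moment_real n / L ^ n) n k \<ge> 0"
      using xi_moment_alternating_sum by blast
    show riemann_hypothesis
      unfolding riemann_hypothesis_def using xi_zero_imp_real_if_completely_monotone[OF L] by blast
  qed
qed

end
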